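(* Let $f\in\mathbb Q[Z]$ be monic and irreducible of degree $n$, let $c\in\mathbb Z$ with $cf\in\mathbb Z[Z]$, and let $p$ be a prime such that the reduction of $cf$ modulo $p$ splits into $n$ distinct linear factors over $\mathbb Z/p\mathbb Z$. Then $f$ has $n$ distinct zeros $x_1,\dots,x_n\in\mathbb Z_p\subset\mathbb Q_p$ (the Hensel lifts of the zeros mod $p$); for $e\ge1$ let $\bar x_j^{(e)}\in\mathbb Z/p^e\mathbb Z$ be the reduction of $x_j$ modulo $p^e$. Let $L=\mathbb Q(x_1,\dots,x_n)\subset\mathbb Q_p$, let $G$ be its Galois group over $\mathbb Q$, regarded as a subgroup of $S_n$ via $\sigma(x_j)=x_{\sigma(j)}$. Put $K_i=\mathbb Q(x_1,\dots,x_i)$ ($K_0=\mathbb Q$), $G_i=\{\sigma\in G:\sigma(j)=j\ \forall j\le i\}$, let $d_i$ be the degree of the minimal polynomial $f_i$ of $x_i$ over $K_{i-1}$, and let $\widehat{f_i}\in\mathbb Q[T_1,\dots,T_i]$ be defined as follows: writing $f_i=T_i^{d_i}+\sum_{k_i}b_{i,k_i}T_i^{d_i-k_i}$ and uniquely $b_{i,k_i}=\sum_{k_1,\dots,k_{i-1}} b_{i,k_1,\dots,k_i}x_1^{d_1-k_1}\cdots x_{i-1}^{d_{i-1}-k_{i-1}}$ ($1\le k_j\le d_j$, $b_{i,k_1,\dots,k_i}\in\mathbb Q$), set $\widehat{f_i}=T_i^{d_i}+\sum_{k_1,\dots,k_i}b_{i,k_1,\dots,k_i}T_1^{d_1-k_1}\cdots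 T_i^{d_i-k_i}$. Let $\gamma$ be a rational integer with $\gamma x_j$ algebraic integers, $d(f)$ the discriminant of $f$, and $\Delta_i=\gamma^{n(n-1)\lceil i/2\rceil+d_i}d(f)^{\lceil i/2\rceil}$. Let $D,M>0$ be reals with $M>|z|$ for every complex zero $z$ of $f$ and $D>|z-z'|$ for all distinct complex zeros $z,z'$ of $f$. Fix $i$, let $\lambda_i$ be the maximum of $|\Delta_i|$ and of the numbers $$\gamma^{n(n-1)\lceil i/2\rceil+d_i}\binom{d_1-1}{k_1-1}\cdots\binom{d_i-1}{k_i-1}M^{k_1+\dots+k_i-i+d_i}D^{n(n-1)\lceil i/2\rceil-d_1-\dots-d_i+i}$$ over all $k_j\in\{1,\dots,d_j\}$, and let $e_i=\lfloor\log(2\lambda_i-1)/\log p\rfloor+1$. Let $P_i\in(\mathbb Z/p^{e_i}\mathbb Z)[T_1,\dots,T_i]$ be the polynomial $$P_i=\bar\Delta_i\Big(T_i^{d_i}-\sum_{\rho\in G/G_i}(\bar x^{(e_i)}_{\rho(i)})^{d_i}\prod_{j=1}^{i}\prod_{y\in \bar B(\rho,j)}\frac{T_j-y}{\bar x^{(e_i)}_{\rho(j)}-y}\Big),$$ where $\bar\Delta_i$ is $\Delta_i$ mod $p^{e_i}$, $\bar B(\rho,j)=\{\bar x^{(e_i)}_{\sigma(j)}:\sigma\in G,\ \sigma(l)=\rho(l)\ \forall l\le j-1\}\setminus\{\bar x^{(e_i)}_{\rho(j)}\}$, and the sum is over representatives of the left cosets of $G_i$. Regard $P_i$ as an element of $\mathbb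 Z[T_1,\dots,T_i]$ by representing each coefficient by its representative in $\{-\frac{p^{e_i}-1}{2},\dots,\frac{p^{e_i}-1}{2}\}$. Then this integer polynomial coincides with $\Delta_i\widehat{f_i}$.
   Context: $\lceil\cdot\rceil$ and $\lfloor\cdot\rfloor$ are the ceiling and floor functions. The differences $\bar x^{(e)}_r-\bar x^{(e)}_s$ for $r\neq s$ are units in $\mathbb Z/p^e\mathbb Z$ since the zeros are distinct modulo $p$, so the fractions make sense. The discriminant is $d(f)=\prod_{r<s}(x_r-x_s)^2\in\mathbb Q$.
   Formalization: Corrected: in λ_i the listed numbers carry an extra factor d_1⋯d_i and use |γ| (as printed the claim fails for Z²−2, p=17, i=γ=1); γ≠0 is assumed; for p=2, where the representative set has no integers, the claim is for any lift with coefficients of size ≤(p^{e_i}−1)/2. *)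

theory Defs
  imports
    Complex_Main
    "HOL-Library.FuncSet"
    "HOL-Library.Poly_Mapping"
    "HOL-Computational_Algebra.Computational_Algebra"
    "HOL-Number_Theory.Modular_Inverse"
    "HOL-Combinatorics.Permutations"
    "Berlekamp_Zassenhaus.Finite_Field"
begin

hide_const (open) up_ring.coeff up_ring.monom module.smult

section \<open>The p-adic integers and the p-adic numbers\<close>

text \<open>
  The prime is the cardinality of the type parameter. A p-adic integer is an element of the
  inverse limit of the rings of integers modulo \<open>p ^ k\<close>, given by its canonical residues: the
  coherence condition below also forces the \<open>k\<close>-th component to lie in \<open>{0..<p ^ k}\<close>.
\<close>

typedef ('p::prime_card) padic_int =
  "{x :: nat \<Rightarrow> int. \<forall>k. x (Suc k) mod int CARD('p) ^ k = x k}"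
  by (rule exI[of _ "\<lambda>_. 0"]) simp

setup_lifting type_definition_padic_int

lift_definition padic_residue :: "nat \<Rightarrow> 'p::prime_card padic_int \<Rightarrow> int"
  is "\<lambda>e x. x e" .

lemma padic_coherent_mod:
  fixes q :: int
  assumes "a mod q ^ k = b mod q ^ k"
  shows "(a mod q ^ Suc k) mod q ^ k = b mod q ^ k"
  using assms by (simp add: mod_mod_cancel)

instantiation padic_int :: (prime_card) comm_ring_1
begin

lift_definition zero_padic_int :: "'a padic_int" is "\<lambda>_. 0" by simp

lift_definition one_padic_int :: "'a padic_int" is "\<lambda>k. 1 mod int CARD('a) ^ k"
  by (simp add: mod_mod_cancel)

lift_definition plus_padic_int :: "'a padic_int \<Rightarrow> 'a padic_int \<Rightarrow> 'a padic_int"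
  is "\<lambda>x y k. (x k + y k) mod int CARD('a) ^ k"
  by (intro allI padic_coherent_mod mod_add_cong) (metis mod_mod_trivial)+

lift_definition times_padic_int :: "'a padic_int \<Rightarrow> 'a padic_int \<Rightarrow> 'a padic_int"
  is "\<lambda>x y k. (x k * y k) mod int CARD('a) ^ k"
  by (intro allI padic_coherent_mod mod_mult_cong) (metis mod_mod_trivial)+

lift_definition uminus_padic_int :: "'a padic_int \<Rightarrow> 'a padic_int"
  is "\<lambda>x k. (- x k) mod int CARD('a) ^ k"
  by (intro allI padic_coherent_mod mod_minus_cong) (metis mod_mod_trivial)+

lift_definition minus_padic_int :: "'a padic_int \<Rightarrow> 'a padic_int \<Rightarrow> 'a padic_int"
  is "\<lambda>x y k. (x k - y k) mod int CARD('a) ^ k"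
  by (intro allI padic_coherent_mod mod_diff_cong) (metis mod_mod_trivial)+

instance
proof
  fix a b c :: "'a padic_int"
  show "a * b * c = a * (b * c)"
    by transfer (simp add: fun_eq_iff mod_simps mult.assoc)
  show "a * b = b * a"
    by transfer (simp add: fun_eq_iff mult.commute)
  show "1 * a = a"
    by transfer (simp add: fun_eq_iff mod_simps, metis mod_mod_trivial)
  show "a + b + c = a + (b + c)"
    by transfer (simp add: fun_eq_iff mod_simps add.assoc)
  show "a + b = b + a"
    by transfer (simp add: fun_eq_iff add.commute)
  show "0 + a = a"
    by transfer (simp add: fun_eq_iff, metis mod_mod_trivial)
  show "- a + a = 0"
    by transfer (simp add: fun_eq_iff mod_simps)
  show "a - b = a + - b"
    by transfer (simp add: fun_eq_iff mod_simps)
  show "(a + b) * c = a * c + b * c"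
    by transfer (simp add: fun_eq_iff mod_simps distrib_right)
  have "1 < int CARD('a)"
    using nontriv[where 'a = 'a] by simp
  then have "1 mod int CARD('a) ^ 1 \<noteq> 0"
    by simp
  then show "(0 :: 'a padic_int) \<noteq> 1"
    by transfer (metis)
qed

end

lemma padic_residue_Suc_mod:
  "padic_residue (Suc k) x mod int CARD('p) ^ k = padic_residue k (x :: 'p::prime_card padic_int)"
  by transfer simp

lemma padic_residue_add_mod:
  "padic_residue (k + l) x mod int CARD('p) ^ k = padic_residue k (x :: 'p::prime_card padic_int)"
proof (induction l)
  case 0
  show ?case by simp (metis padic_residue_Suc_mod mod_mod_trivial)
next
  case (Suc l)
  have "padic_residue (k + Suc l) x mod int CARD('p) ^ k
      = (padic_residue (Suc (k + l)) x mod int CARD('p) ^ (k + l)) mod int CARD('p) ^ k"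
    by (simp add: mod_mod_cancel le_imp_power_dvd)
  then show ?case
    using Suc by (simp add: padic_residue_Suc_mod)
qed

lemma padic_int_eqI:
  "(\<And>k. padic_residue k x = padic_residue k y) \<Longrightarrow> x = y"
  by transfer auto

lemma padic_residue_0 [simp]: "padic_residue k 0 = 0"
  by transfer simp

lemma padic_residue_mult:
  "padic_residue k (x * y) = (padic_residue k x * padic_residue k y) mod int CARD('p) ^ k"
  for x y :: "'p::prime_card padic_int"
  by transfer simp

lemma padic_residue_add:
  "padic_residue k (x + y) = (padic_residue k x + padic_residue k y) mod int CARD('p) ^ k"
  for x y :: "'p::prime_card padic_int"
  by transfer simp

lemma padic_residue_1: "padic_residue k (1 :: 'p::prime_card padic_int) = 1 mod int CARD('p) ^ k"
  by transfer simp

lemma padic_residue_of_nat: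
  "padic_residue k (of_nat m :: 'p::prime_card padic_int) = int m mod int CARD('p) ^ k"
proof (induction m)
  case 0
  show ?case by simp
next
  case (Suc m)
  have "padic_residue k (of_nat (Suc m) :: 'p padic_int)
      = (1 mod int CARD('p) ^ k + int m mod int CARD('p) ^ k) mod int CARD('p) ^ k"
    by (simp only: of_nat_Suc padic_residue_add padic_residue_1 Suc.IH)
  also have "\<dots> = int (Suc m) mod int CARD('p) ^ k"
    by (simp only: mod_add_eq of_nat_Suc)
  finally show ?case .
qed

instance padic_int :: (prime_card) idom
proof
  fix x y :: "'a padic_int"
  let ?p = "int CARD('a)"
  assume "x \<noteq> 0" "y \<noteq> 0"
  then obtain k l where kl: "padic_residue k x \<noteq> 0" "padic_residue l y \<noteq> 0"
    by (metis padic_int_eqI padic_residue_0)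
  define u v where "u = padic_residue (k + l) x" and "v = padic_residue (k + l) y"
  have u: "\<not> ?p ^ k dvd u"
    using kl(1) padic_residue_add_mod[of k l x] by (auto simp: u_def dvd_eq_mod_eq_0)
  have v: "\<not> ?p ^ l dvd v"
    using kl(2) padic_residue_add_mod[of l k y] by (auto simp: v_def add.commute dvd_eq_mod_eq_0)
  have p: "prime ?p"
    using prime_card[where 'a = 'a] by simp
  have nz: "u \<noteq> 0" "v \<noteq> 0"
    using u v by auto
  have "\<not> is_unit ?p"
    using p not_prime_unit by blast
  then have "multiplicity ?p u < k" "multiplicity ?p v < l"
    using u v nz by (auto simp: power_dvd_iff_le_multiplicity)
  moreover have "multiplicity ?p (u * v) = multiplicity ?p u + multiplicity ?p v"
    using p nz by (simp add: prime_elem_multiplicity_mult_distrib)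
  ultimately have "\<not> ?p ^ (k + l) dvd u * v"
    using nz \<open>\<not> is_unit ?p\<close> by (subst power_dvd_iff_le_multiplicity) auto
  then have "padic_residue (k + l) (x * y) \<noteq> 0"
    by (simp add: padic_residue_mult u_def v_def dvd_eq_mod_eq_0)
  then show "x * y \<noteq> 0"
    by auto
qed

instance padic_int :: (prime_card) ring_char_0
proof
  show "inj (of_nat :: nat \<Rightarrow> 'a padic_int)"
  proof (rule injI)
    fix m n :: nat
    assume eq: "(of_nat m :: 'a padic_int) = of_nat n"
    have p: "1 < CARD('a)"
      by (rule nontriv)
    define k where "k = m + n"
    have "k < CARD('a) ^ k"
      using p by (intro power_gt_expt) simp
    then have "m < CARD('a) ^ k" "n < CARD('a) ^ k"
      by (auto simp: k_def)
    then have "int m < int CARD('a) ^ k" "int n < int CARD('a) ^ k"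
      by (metis of_nat_less_iff of_nat_power)+
    moreover have "int m mod int CARD('a) ^ k = int n mod int CARD('a) ^ k"
      using eq by (metis padic_residue_of_nat)
    ultimately show "m = n"
      by simp
  qed
qed

instance fract :: ("{idom, ring_char_0}") field_char_0
proof
  show "inj (of_nat :: nat \<Rightarrow> 'a fract)"
    by (rule injI) (simp add: of_nat_fract eq_fract)
qed

type_synonym 'p padic = "'p padic_int fract"


section \<open>Subfields, Galois groups and minimal polynomials\<close>

definition is_subfield :: "'a::field set \<Rightarrow> bool" where
  "is_subfield K \<longleftrightarrow> 0 \<in> K \<and> 1 \<in> K \<and>
     (\<forall>a\<in>K. \<forall>b\<in>K. a + b \<in> K \<and> a * b \<in> K) \<and> (\<forall>a\<in>K. - a \<in> K \<and> inverse a \<in> K)"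

text \<open>In characteristic 0 every subfield contains the rationals.\<close>

definition rat_adjoin :: "'a::field_char_0 set \<Rightarrow> 'a set" where
  "rat_adjoin S = \<Inter>{K. is_subfield K \<and> S \<subseteq> K}"

definition field_auts :: "'a::field_char_0 set \<Rightarrow> ('a \<Rightarrow> 'a) set" where
  "field_auts L = {\<phi>. bij_betw \<phi> L L \<and> (\<forall>r. \<phi> (of_rat r) = of_rat r) \<and>
     (\<forall>a\<in>L. \<forall>b\<in>L. \<phi> (a + b) = \<phi> a + \<phi> b \<and> \<phi> (a * b) = \<phi> a * \<phi> b)}"

text \<open>
  The sequences \<open>X\<close> below list the zeros as \<open>X 1, \<dots>, X n\<close>; the value \<open>X 0\<close> plays no role.
\<close>

definition galois_perms :: "nat \<Rightarrow> (nat \<Rightarrow> 'a::field_char_0) \<Rightarrow> (nat \<Rightarrow> nat) set" where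
  "galois_perms n X = {\<sigma>. \<sigma> permutes {1..n} \<and>
     (\<exists>\<phi>\<in>field_auts (rat_adjoin (X ` {1..n})). \<forall>j\<in>{1..n}. \<phi> (X j) = X (\<sigma> j))}"

definition perm_stab :: "(nat \<Rightarrow> nat) set \<Rightarrow> nat \<Rightarrow> (nat \<Rightarrow> nat) set" where
  "perm_stab G i = {\<sigma>\<in>G. \<forall>j\<in>{1..i}. \<sigma> j = j}"

definition left_coset_reps ::
    "(nat \<Rightarrow> nat) set \<Rightarrow> (nat \<Rightarrow> nat) set \<Rightarrow> (nat \<Rightarrow> nat) set \<Rightarrow> bool" where
  "left_coset_reps G H R \<longleftrightarrow>
     R \<subseteq> G \<and> (\<forall>\<sigma>\<in>G. \<exists>!\<rho>. \<rho> \<in> R \<and> \<rho> \<in> (\<lambda>\<tau>. \<sigma> \<circ> \<tau>) ` H)"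

definition min_poly :: "'a::field set \<Rightarrow> 'a \<Rightarrow> 'a poly" where
  "min_poly K a = (THE g. lead_coeff g = 1 \<and> (\<forall>k. coeff g k \<in> K) \<and> poly g a = 0 \<and>
     (\<forall>h. h \<noteq> 0 \<and> (\<forall>k. coeff h k \<in> K) \<and> poly h a = 0 \<longrightarrow> degree g \<le> degree h))"

definition tower_poly :: "(nat \<Rightarrow> 'a::field_char_0) \<Rightarrow> nat \<Rightarrow> 'a poly" where
  "tower_poly X i = min_poly (rat_adjoin (X ` {1..<i})) (X i)"

definition tower_deg :: "(nat \<Rightarrow> 'a::field_char_0) \<Rightarrow> nat \<Rightarrow> nat" where
  "tower_deg X i = degree (tower_poly X i)"

definition rat_discriminant :: "nat \<Rightarrow> (nat \<Rightarrow> 'a::field_char_0) \<Rightarrow> rat" where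
  "rat_discriminant n X =
     (THE r. of_rat r = (\<Prod>s\<in>{1..n}. \<Prod>r\<in>{1..<s}. (X r - X s) ^ 2))"


section \<open>Multivariate polynomials\<close>

text \<open>Exponent vectors are finitely supported maps; \<open>mp_var j\<close> is the indeterminate \<open>T\<^sub>j\<close>.\<close>

type_synonym 'a mpoly = "(nat \<Rightarrow>\<^sub>0 nat) \<Rightarrow>\<^sub>0 'a"

definition mp_const :: "'a::comm_ring_1 \<Rightarrow> 'a mpoly" where
  "mp_const a = Poly_Mapping.single 0 a"

definition mp_var :: "nat \<Rightarrow> 'a::comm_ring_1 mpoly" where
  "mp_var j = Poly_Mapping.single (Poly_Mapping.single j 1) 1"

definition tower_idx :: "(nat \<Rightarrow> 'a::field_char_0) \<Rightarrow> nat \<Rightarrow> (nat \<Rightarrow> nat) set" where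
  "tower_idx X i = (\<Pi>\<^sub>E j\<in>{1..i}. {1..tower_deg X j})"

text \<open>
  The unique rational family \<open>b\<close> indexed by \<open>(k\<^sub>1, \<dots>, k\<^sub>i)\<close> for which the coefficient of
  \<open>tower_poly X i\<close> at exponent \<open>d\<^sub>i - k\<^sub>i\<close> is the sum of the
  \<open>b (k\<^sub>1, \<dots>, k\<^sub>i) * x\<^sub>1 ^ (d\<^sub>1 - k\<^sub>1) * \<dots>\<close> over \<open>(k\<^sub>1, \<dots>, k\<^sub>i\<^sub>-\<^sub>1)\<close>. Membership in
  \<open>extensional\<close> fixes the irrelevant values outside the index set.
\<close>

definition tower_coeffs :: "(nat \<Rightarrow> 'a::field_char_0) \<Rightarrow> nat \<Rightarrow> (nat \<Rightarrow> nat) \<Rightarrow> rat" where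
  "tower_coeffs X i = (THE b. b \<in> extensional (tower_idx X i) \<and>
     (\<forall>m\<in>{1..tower_deg X i}. coeff (tower_poly X i) (tower_deg X i - m) =
        (\<Sum>k\<in>tower_idx X (i - 1).
           of_rat (b (k(i := m))) * (\<Prod>j\<in>{1..<i}. X j ^ (tower_deg X j - k j)))))"

definition tower_hat :: "(nat \<Rightarrow> 'a::field_char_0) \<Rightarrow> nat \<Rightarrow> rat mpoly" where
  "tower_hat X i = mp_var i ^ tower_deg X i +
     (\<Sum>k\<in>tower_idx X i.
        mp_const (tower_coeffs X i k) * (\<Prod>j\<in>{1..i}. mp_var j ^ (tower_deg X j - k j)))"


section \<open>The denominator, the bound and the exponent\<close>

definition tower_denom :: "int \<Rightarrow> nat \<Rightarrow> (nat \<Rightarrow> 'a::field_char_0) \<Rightarrow> nat \<Rightarrow> rat" where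
  "tower_denom \<gamma> n X i =
     of_int \<gamma> ^ (n * (n - 1) * nat \<lceil>real i / 2\<rceil> + tower_deg X i) *
     rat_discriminant n X ^ nat \<lceil>real i / 2\<rceil>"

text \<open>
  The leading factor \<open>d\<^sub>1 \<cdots> d\<^sub>i\<close> is the number of cosets, i.e. of summands of the interpolation
  formula to which the triangle inequality is applied. It cannot be omitted: for \<open>f = Z\<^sup>2 - 2\<close>,
  \<open>p = 17\<close>, \<open>i = \<gamma> = 1\<close> the remaining numbers, with \<open>M\<close> and \<open>D\<close> close to \<open>\<surd>2\<close> and \<open>2\<surd>2\<close>, have
  maximum close to 8, which gives exponent 1, but \<open>8 * f = 8 * Z\<^sup>2 - 16\<close> and 16 exceeds
  \<open>(17 - 1) / 2\<close>. The absolute value of \<open>\<gamma>\<close> matters only for negative \<open>\<gamma>\<close>.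
\<close>

definition tower_bound ::
    "int \<Rightarrow> real \<Rightarrow> real \<Rightarrow> nat \<Rightarrow> (nat \<Rightarrow> 'a::field_char_0) \<Rightarrow> nat \<Rightarrow> real" where
  "tower_bound \<gamma> D M n X i = Max (insert \<bar>of_rat (tower_denom \<gamma> n X i)\<bar>
     ((\<lambda>k. (\<Prod>j\<in>{1..i}. real (tower_deg X j)) *
        real_of_int \<bar>\<gamma>\<bar> ^ (n * (n - 1) * nat \<lceil>real i / 2\<rceil> + tower_deg X i) *
        (\<Prod>j\<in>{1..i}. real ((tower_deg X j - 1) choose (k j - 1))) *
        M powi ((\<Sum>j\<in>{1..i}. int (k j)) - int i + int (tower_deg X i)) *
        D powi (int (n * (n - 1) * nat \<lceil>real i / 2\<rceil>) - (\<Sum>j\<in>{1..i}. int (tower_deg X j)) + int i))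
      ` tower_idx X i))"

definition lift_exponent :: "nat \<Rightarrow> real \<Rightarrow> nat" where
  "lift_exponent p \<Lambda> = nat (\<lfloor>ln (2 * \<Lambda> - 1) / ln (real p)\<rfloor> + 1)"


section \<open>The interpolation polynomial modulo a prime power\<close>

definition residue_siblings ::
    "(nat \<Rightarrow> nat) set \<Rightarrow> (nat \<Rightarrow> 'p::prime_card padic_int) \<Rightarrow> nat \<Rightarrow> (nat \<Rightarrow> nat) \<Rightarrow> nat \<Rightarrow> int set" where
  "residue_siblings G x e \<rho> j =
     {padic_residue e (x (\<sigma> j)) | \<sigma>. \<sigma> \<in> G \<and> (\<forall>l\<in>{1..<j}. \<sigma> l = \<rho> l)}
     - {padic_residue e (x (\<rho> j))}"

text \<open>
  Residue classes modulo \<open>q = p ^ e\<close> are represented by integers, so this polynomial is meaningful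
  only modulo \<open>q\<close>.
\<close>

definition interp_poly ::
    "(nat \<Rightarrow> nat) set \<Rightarrow> (nat \<Rightarrow> nat) set \<Rightarrow> (nat \<Rightarrow> 'p::prime_card padic_int) \<Rightarrow>
     nat \<Rightarrow> int \<Rightarrow> nat \<Rightarrow> nat \<Rightarrow> int mpoly" where
  "interp_poly G R x e \<Delta> d i = mp_const \<Delta> * (mp_var i ^ d -
     (\<Sum>\<rho>\<in>R. mp_const (padic_residue e (x (\<rho> i)) ^ d) *
        (\<Prod>j\<in>{1..i}. \<Prod>y\<in>residue_siblings G x e \<rho> j.
           (mp_var j - mp_const y) *
           mp_const (modular_inverse (int CARD('p) ^ e) (padic_residue e (x (\<rho> j)) - y)))))"

text \<open>
  \<open>Q\<close> is \<open>P\<close> modulo \<open>q\<close>, lifted with coefficients in \<open>{-(q - 1)/2, \<dots>, (q - 1)/2}\<close>. There is at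
  most one such \<open>Q\<close>, and exactly one if \<open>q\<close> is odd.
\<close>

definition balanced_lift :: "int \<Rightarrow> int mpoly \<Rightarrow> int mpoly \<Rightarrow> bool" where
  "balanced_lift q P Q \<longleftrightarrow>
     (\<forall>m. [Poly_Mapping.lookup Q m = Poly_Mapping.lookup P m] (mod q) \<and> - (q - 1) \<le> 2 * Poly_Mapping.lookup Q m \<and> 2 * Poly_Mapping.lookup Q m \<le> q - 1)"


section \<open>The zeros\<close>

definition splits_distinct :: "nat \<Rightarrow> 'a::field poly \<Rightarrow> bool" where
  "splits_distinct n g \<longleftrightarrow>
     (\<exists>a S. a \<noteq> 0 \<and> finite S \<and> card S = n \<and> g = smult a (\<Prod>s\<in>S. [:- s, 1:]))"

definition padic_zeros :: "rat poly \<Rightarrow> nat \<Rightarrow> (nat \<Rightarrow> 'p::prime_card padic_int) \<Rightarrow> bool" where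
  "padic_zeros f n x \<longleftrightarrow> inj_on x {1..n} \<and>
     (\<forall>j\<in>{1..n}. poly (map_poly of_rat f) (to_fract (x j) :: 'p padic) = 0)"

end

theory Submission
  imports Defs "Jordan_Normal_Form.Char_Poly"
begin

hide_const (open) up_ring.coeff up_ring.monom module.smult

text \<open>
  Let \<open>t\<close> run through the tuples \<open>(\<rho> 1, \<dots>, \<rho> i)\<close> with \<open>\<rho>\<close> in the Galois group. They form the leaves
  of a tree in which every node of level \<open>j - 1\<close> has \<open>d\<^sub>j\<close> children, namely the roots of a conjugate
  of \<open>f\<^sub>j\<close>. A polynomial of degree less than \<open>d\<^sub>j\<close> in each \<open>T\<^sub>j\<close> is therefore determined by its values
  at these points and is recovered from them by iterated Lagrange interpolation. Applied to the
  relation \<open>f\<^sub>i = 0\<close> and its conjugates this yields the coefficients of \<open>tower_hat X i\<close> in terms of the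
  zeros. The differences of zeros in the denominators are indexed by distinct ordered pairs, so they
  divide the discriminant, and after multiplication by \<open>\<Delta>\<^sub>i\<close> every coefficient is an integer
  polynomial in the numbers \<open>\<gamma> * x\<^sub>j\<close>. The same expression shows three
  things: the coefficient is an algebraic integer, hence an integer; embedding the splitting field
  into the complex numbers bounds it by \<open>\<lambda>\<^sub>i\<close>; reducing it modulo \<open>p ^ e\<close> gives the coefficient of
  \<open>interp_poly\<close>. Since \<open>p ^ e > 2 * \<lambda>\<^sub>i - 1\<close>, the balanced residue is the coefficient itself.
\<close>

section \<open>Subfields, minimal polynomials and extension of embeddings\<close>

text \<open>One inversion formula, \<open>prefix_coefficients\<close>, carries the Galois theory. It
  recovers the coefficients of a polynomial from its values at the leaves and is applied to three
  relations: a vanishing combination of monomials, which makes \<open>tower_coeffs\<close> well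
  defined; the expansion of an element fixed by \<open>G\<close>, which shows that the discriminant
  is rational; and the conjugates of the relation for \<open>X i\<close>, which give the formula
  itself.

  The formula has to be read in the field of the tower, in the complex numbers and modulo
  \<open>p ^ e\<close>. Fields are therefore subsets of a type, and an embedding is a map that
  respects the operations on such a subset, with an arbitrary target type. To be integral and to
  commute with all these maps, the quotient of the discriminant power by the denominators is written
  without division: up to sign it is a product of differences over the ordered pairs that remain,
  which makes sense in every commutative ring.\<close>

lemma
  assumes "is_subfield K"
  shows subfield_0: "0 \<in> K" and subfield_1: "1 \<in> K"
    and subfield_add: "a \<in> K \<Longrightarrow> b \<in> K \<Longrightarrow> a + b \<in> K"
    and subfield_mult: "a \<in> K \<Longrightarrow> b \<in> K \<Longrightarrow> a * b \<in> K"
    and subfield_minus: "a \<in> K \<Longrightarrow> - a \<in> K"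
    and subfield_inverse: "a \<in> K \<Longrightarrow> inverse a \<in> K"
  using assms by (auto simp: is_subfield_def)

lemma subfield_diff: "is_subfield K \<Longrightarrow> a \<in> K \<Longrightarrow> b \<in> K \<Longrightarrow> a - b \<in> K"
  by (metis subfield_add subfield_minus add_uminus_conv_diff)

lemma subfield_divide: "is_subfield K \<Longrightarrow> a \<in> K \<Longrightarrow> b \<in> K \<Longrightarrow> a / b \<in> K"
  by (simp add: divide_inverse subfield_mult subfield_inverse)

lemma subfield_sum: "is_subfield K \<Longrightarrow> (\<And>i. i \<in> I \<Longrightarrow> g i \<in> K) \<Longrightarrow> sum g I \<in> K"
  by (induction I rule: infinite_finite_induct) (auto intro: subfield_0 subfield_add)

lemma subfield_prod: "is_subfield K \<Longrightarrow> (\<And>i. i \<in> I \<Longrightarrow> g i \<in> K) \<Longrightarrow> prod g I \<in> K"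
  by (induction I rule: infinite_finite_induct) (auto intro: subfield_1 subfield_mult)

lemma subfield_power: "is_subfield K \<Longrightarrow> a \<in> K \<Longrightarrow> a ^ k \<in> K"
  by (induction k) (auto intro: subfield_1 subfield_mult)

lemma subfield_of_nat: "is_subfield K \<Longrightarrow> of_nat m \<in> K"
  by (induction m) (auto intro: subfield_0 subfield_1 subfield_add)

lemma subfield_of_int: "is_subfield K \<Longrightarrow> of_int m \<in> K"
  by (cases m) (auto intro!: subfield_of_nat subfield_minus subfield_diff subfield_1)

lemma subfield_of_rat:
  fixes K :: "'a::field_char_0 set"
  shows "is_subfield K \<Longrightarrow> of_rat r \<in> K"
  by (cases r) (auto simp: of_rat_rat intro!: subfield_divide subfield_of_int)

lemmas subfield_closed = subfield_0 subfield_1 subfield_add subfield_mult subfield_minus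
  subfield_inverse subfield_diff subfield_divide subfield_sum subfield_prod subfield_power

lemma subfield_rat_adjoin: "is_subfield (rat_adjoin S)"
  unfolding rat_adjoin_def is_subfield_def by auto

lemma rat_adjoin_superset: "S \<subseteq> rat_adjoin S"
  unfolding rat_adjoin_def by auto

lemma rat_adjoin_least: "is_subfield K \<Longrightarrow> S \<subseteq> K \<Longrightarrow> rat_adjoin S \<subseteq> K"
  unfolding rat_adjoin_def by auto

lemma rat_adjoin_mono: "S \<subseteq> T \<Longrightarrow> rat_adjoin S \<subseteq> rat_adjoin T"
  by (intro rat_adjoin_least subfield_rat_adjoin) (use rat_adjoin_superset in blast)

lemma rat_adjoin_empty: "rat_adjoin {} = range of_rat"
proof
  have "is_subfield (range of_rat :: 'a::field_char_0 set)"
    unfolding is_subfield_def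
    by (auto simp: of_rat_add [symmetric] of_rat_mult [symmetric] of_rat_minus [symmetric]
        of_rat_inverse [symmetric]
        intro: range_eqI [of _ _ 0] range_eqI [of _ _ 1])
  then show "rat_adjoin {} \<subseteq> (range of_rat :: 'a set)"
    by (rule rat_adjoin_least) simp
qed (auto intro: subfield_of_rat subfield_rat_adjoin)


section \<open>Polynomials over a subfield, minimal polynomials, simple extensions\<close>

definition polys_over :: "'a::field set \<Rightarrow> 'a poly set" where
  "polys_over K = {h. \<forall>k. coeff h k \<in> K}"

lemma polys_overD: "h \<in> polys_over K \<Longrightarrow> coeff h k \<in> K"
  by (auto simp: polys_over_def)

lemma polys_over_mono: "K \<subseteq> L \<Longrightarrow> polys_over K \<subseteq> polys_over L"
  by (auto simp: polys_over_def)

definition algebraic_over :: "'a::field set \<Rightarrow> 'a \<Rightarrow> bool" where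
  "algebraic_over K a \<longleftrightarrow> (\<exists>h\<in>polys_over K. h \<noteq> 0 \<and> poly h a = 0)"

context
  fixes K :: "'a::field set"
  assumes K: "is_subfield K"
begin

lemma polys_over_0: "0 \<in> polys_over K"
  and polys_over_1: "1 \<in> polys_over K"
  and polys_over_const: "a \<in> K \<Longrightarrow> [:a:] \<in> polys_over K"
  and polys_over_monom: "a \<in> K \<Longrightarrow> monom a k \<in> polys_over K"
  and polys_over_linear: "a \<in> K \<Longrightarrow> [:- a, 1:] \<in> polys_over K"
  using K by (auto simp: polys_over_def coeff_pCons split: nat.splits intro: subfield_closed)

lemma polys_over_add: "g \<in> polys_over K \<Longrightarrow> h \<in> polys_over K \<Longrightarrow> g + h \<in> polys_over K"
  and polys_over_diff: "g \<in> polys_over K \<Longrightarrow> h \<in> polys_over K \<Longrightarrow> g - h \<in> polys_over K"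
  and polys_over_minus: "h \<in> polys_over K \<Longrightarrow> - h \<in> polys_over K"
  using K by (auto simp: polys_over_def intro: subfield_closed)

lemma polys_over_mult: "g \<in> polys_over K \<Longrightarrow> h \<in> polys_over K \<Longrightarrow> g * h \<in> polys_over K"
  using K by (auto simp: polys_over_def coeff_mult intro!: subfield_closed)

lemma polys_over_prod: "(\<And>i. i \<in> I \<Longrightarrow> g i \<in> polys_over K) \<Longrightarrow> prod g I \<in> polys_over K"
  by (induction I rule: infinite_finite_induct) (auto intro: polys_over_1 polys_over_mult)

lemma poly_in_subfield: "h \<in> polys_over K \<Longrightarrow> a \<in> K \<Longrightarrow> poly h a \<in> K"
  using K by (auto simp: poly_altdef polys_over_def intro!: subfield_closed)

text \<open>Long division inverts only the leading coefficient of \<open>g\<close>, so quotient and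
  remainder stay over \<open>K\<close>. The induction runs on a bound beyond which the coefficients
  of \<open>h\<close> vanish instead of on the degree, which makes the zero polynomial the base
  case.\<close>

lemma polys_over_division:
  assumes g: "g \<in> polys_over K" "g \<noteq> 0" and h: "h \<in> polys_over K"
  shows "\<exists>q\<in>polys_over K. \<exists>r\<in>polys_over K. h = q * g + r \<and> (r = 0 \<or> degree r < degree g)"
proof -
  have "\<forall>h\<in>polys_over K. (\<forall>k\<ge>N. coeff h k = 0) \<longrightarrow>
    (\<exists>q\<in>polys_over K. \<exists>r\<in>polys_over K. h = q * g + r \<and> (r = 0 \<or> degree r < degree g))" for N
  proof (induction N)
    case 0
    show ?case
    proof (intro ballI impI)
      fix h :: "'a poly" assume "\<forall>k\<ge>0. coeff h k = 0"
      then have "h = 0" by (simp add: poly_eq_iff)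
      then show "\<exists>q\<in>polys_over K. \<exists>r\<in>polys_over K. h = q * g + r \<and> (r = 0 \<or> degree r < degree g)"
        by (auto intro!: bexI[of _ 0] polys_over_0)
    qed
  next
    case (Suc N)
    show ?case
    proof (intro ballI impI)
      fix h assume h: "h \<in> polys_over K" and van: "\<forall>k\<ge>Suc N. coeff h k = 0"
      show "\<exists>q\<in>polys_over K. \<exists>r\<in>polys_over K. h = q * g + r \<and> (r = 0 \<or> degree r < degree g)"
      proof (cases "N < degree g")
        case True
        have "degree h \<le> N"
          using van by (intro degree_le) auto
        with True h show ?thesis
          by (intro bexI[of _ 0] bexI[of _ h] polys_over_0) auto
      next
        case False
        \<comment> \<open>\<open>t * g\<close> has the same coefficient as \<open>h\<close> at
          exponent \<open>N\<close> and none above, so the difference meets the smaller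
          bound.\<close>
        define t where "t = monom (coeff h N / lead_coeff g) (N - degree g)"
        have t: "t \<in> polys_over K"
          unfolding t_def using g h K by (intro polys_over_monom subfield_closed polys_overD)
        have "\<forall>k\<ge>N. coeff (h - t * g) k = 0"
        proof (intro allI impI)
          fix k assume k: "k \<ge> N"
          have "coeff (t * g) k = coeff h N / lead_coeff g * coeff g (k - (N - degree g))"
            using k by (simp add: t_def coeff_monom_mult)
          also have "\<dots> = coeff h k"
          proof (cases "k = N")
            case True
            then show ?thesis using False g by simp
          next
            case False
            then have "k - (N - degree g) > degree g" "k \<ge> Suc N"
              using k \<open>\<not> N < degree g\<close> by auto
            then show ?thesis using van by (simp add: coeff_eq_0)
          qed
          finally show "coeff (h - t * g) k = 0" by simp
        qed
        moreover have "h - t * g \<in> polys_over K"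
          using h t g by (intro polys_over_diff polys_over_mult)
        ultimately obtain q r where "q \<in> polys_over K" "r \<in> polys_over K"
          "h - t * g = q * g + r" "r = 0 \<or> degree r < degree g"
          using Suc by blast
        then show ?thesis
          using t by (intro bexI[of _ "q + t"] bexI[of _ r] polys_over_add)
            (auto simp: algebra_simps)
      qed
    qed
  qed
  from this[of "Suc (degree h)"] h show ?thesis
    by (auto simp: coeff_eq_0)
qed

context
  fixes a :: 'a
  assumes alg: "algebraic_over K a"
begin

text \<open>Justifies the definite description in \<open>min_poly\<close>: the leading terms of two
  monic annihilators of least degree cancel, so a nonzero difference would be an annihilator of
  smaller degree.\<close>

lemma min_poly_ex1:
  "\<exists>!g. lead_coeff g = 1 \<and> (\<forall>k. coeff g k \<in> K) \<and> poly g a = 0 \<and>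
     (\<forall>h. h \<noteq> 0 \<and> (\<forall>k. coeff h k \<in> K) \<and> poly h a = 0 \<longrightarrow> degree g \<le> degree h)"
proof -
  define P where "P h \<longleftrightarrow> h \<noteq> 0 \<and> (\<forall>k. coeff h k \<in> K) \<and> poly h a = 0" for h
  obtain h0 where "P h0"
    using alg by (auto simp: algebraic_over_def polys_over_def P_def)
  then obtain g0 where g0: "P g0" "\<And>h. P h \<Longrightarrow> degree g0 \<le> degree h"
    using ex_has_least_nat[of P h0 degree] by blast
  define g where "g = smult (inverse (lead_coeff g0)) g0"
  have g: "lead_coeff g = 1" "\<forall>k. coeff g k \<in> K" "poly g a = 0" "degree g = degree g0"
    using g0 K by (auto simp: g_def P_def intro: subfield_closed)
  have uniq: "g1 = g"
    if g1: "lead_coeff g1 = 1" "\<forall>k. coeff g1 k \<in> K" "poly g1 a = 0" and "degree g1 \<le> degree g"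
    for g1
  proof (rule ccontr)
    assume ne: "g1 \<noteq> g"
    have "degree g0 \<le> degree g1"
      using g0(2)[of g1] g1 by (force simp: P_def)
    with that g have deg: "degree g1 = degree g" by simp
    have "P (g1 - g)"
      using ne g1 g K by (auto simp: P_def intro: subfield_closed)
    then have "degree g \<le> degree (g1 - g)"
      using g0(2) g by auto
    moreover have "degree (g1 - g) \<le> degree g"
      using deg by (intro degree_diff_le) auto
    ultimately have "degree (g1 - g) = degree g" by simp
    then have "lead_coeff (g1 - g) = 0"
      using deg g(1) g1(1) by simp
    then show False
      using ne by (simp only: leading_coeff_0_iff) simp
  qed
  show ?thesis
  proof (rule ex1I[of _ g])
    show "lead_coeff g = 1 \<and> (\<forall>k. coeff g k \<in> K) \<and> poly g a = 0 \<and>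
     (\<forall>h. h \<noteq> 0 \<and> (\<forall>k. coeff h k \<in> K) \<and> poly h a = 0 \<longrightarrow> degree g \<le> degree h)"
      using g g0(2) by (auto simp: P_def)
  next
    fix g1 assume *: "lead_coeff g1 = 1 \<and> (\<forall>k. coeff g1 k \<in> K) \<and> poly g1 a = 0 \<and>
     (\<forall>h. h \<noteq> 0 \<and> (\<forall>k. coeff h k \<in> K) \<and> poly h a = 0 \<longrightarrow> degree g1 \<le> degree h)"
    moreover have "g \<noteq> 0" using g by auto
    ultimately show "g1 = g" using g by (intro uniq) auto
  qed
qed

lemma
  shows lead_coeff_min_poly: "lead_coeff (min_poly K a) = 1"
    and min_poly_over: "min_poly K a \<in> polys_over K"
    and poly_min_poly: "poly (min_poly K a) a = 0"
    and min_poly_least: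
      "\<And>h. h \<noteq> 0 \<Longrightarrow> h \<in> polys_over K \<Longrightarrow> poly h a = 0 \<Longrightarrow> degree (min_poly K a) \<le> degree h"
  using theI'[OF min_poly_ex1] unfolding min_poly_def [symmetric] polys_over_def by auto

lemma min_poly_nz: "min_poly K a \<noteq> 0"
  using lead_coeff_min_poly by auto

lemma degree_min_poly_pos: "degree (min_poly K a) > 0"
proof (rule ccontr)
  assume "\<not> ?thesis"
  then have "degree (min_poly K a) = 0" by simp
  then obtain c where "min_poly K a = [:c:]"
    using degree_eq_zeroE by blast
  with lead_coeff_min_poly poly_min_poly show False by auto
qed

lemma min_poly_divides:
  assumes "h \<in> polys_over K" "poly h a = 0"
  shows "\<exists>q\<in>polys_over K. h = q * min_poly K a"
proof -
  obtain q r where qr: "q \<in> polys_over K" "r \<in> polys_over K" "h = q * min_poly K a + r"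
    "r = 0 \<or> degree r < degree (min_poly K a)"
    using polys_over_division[OF min_poly_over min_poly_nz assms(1)] by blast
  have "poly r a = 0"
    using assms qr poly_min_poly by simp
  then have "r = 0"
    using min_poly_least[of r] qr by force
  with qr show ?thesis by auto
qed

lemma simple_extension_reduce:
  assumes "h \<in> polys_over K"
  shows "\<exists>r\<in>polys_over K. poly r a = poly h a \<and> degree r < degree (min_poly K a)"
proof -
  obtain q r where qr: "q \<in> polys_over K" "r \<in> polys_over K" "h = q * min_poly K a + r"
    "r = 0 \<or> degree r < degree (min_poly K a)"
    using polys_over_division[OF min_poly_over min_poly_nz assms(1)] by blast
  then show ?thesis
    using poly_min_poly degree_min_poly_pos by (intro bexI[of _ r]) auto
qed

text \<open>Euclid's algorithm: if \<open>min_poly K a = q * h + r\<close>, then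
  \<open>q * h\<close> and \<open>- r\<close> agree at \<open>a\<close>, so an inverse for the
  remainder, which has smaller degree, gives one for \<open>h\<close>.\<close>

lemma simple_extension_inverse:
  assumes "h \<in> polys_over K" "poly h a \<noteq> 0"
  shows "\<exists>g\<in>polys_over K. poly h a * poly g a = 1"
proof -
  have main: "\<exists>g\<in>polys_over K. poly h a * poly g a = 1"
    if "h \<in> polys_over K" "poly h a \<noteq> 0" "degree h < degree (min_poly K a)" for h
    using that
  proof (induction "degree h" arbitrary: h rule: less_induct)
    case less
    show ?case
    proof (cases "degree h = 0")
      case True
      then obtain c where c: "h = [:c:]"
        using degree_eq_zeroE by blast
      then have "c \<in> K" "c \<noteq> 0"
        using less.prems polys_overD[of h K 0] by auto
      then show ?thesis
        using c K by (intro bexI[of _ "[:inverse c:]"] polys_over_const subfield_closed) auto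
    next
      case False
      have nz: "h \<noteq> 0" using less.prems by auto
      obtain q r where qr: "q \<in> polys_over K" "r \<in> polys_over K" "min_poly K a = q * h + r"
        "r = 0 \<or> degree r < degree h"
        using polys_over_division[OF less.prems(1) nz min_poly_over] by blast
      \<comment> \<open>Otherwise minimality forces \<open>r = 0\<close>, and \<open>q\<close> would
        annihilate \<open>a\<close> with a degree below that of the minimal polynomial, because
        \<open>h\<close> is not constant.\<close>
      have r0: "poly r a \<noteq> 0"
      proof
        assume r: "poly r a = 0"
        then have "r = 0"
          using min_poly_least[OF _ qr(2)] qr(4) less.prems(3) by force
        with qr have eq: "min_poly K a = q * h" by simp
        then have "q \<noteq> 0" "poly q a = 0"
          using min_poly_nz poly_min_poly less.prems by auto
        then have "degree (min_poly K a) \<le> degree q"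
          using qr by (intro min_poly_least) auto
        moreover have "degree (min_poly K a) = degree q + degree h"
          unfolding eq using \<open>q \<noteq> 0\<close> nz by (rule degree_mult_eq)
        ultimately show False using False by simp
      qed
      then have "degree r < degree h" using qr by auto
      then obtain g where g: "g \<in> polys_over K" "poly r a * poly g a = 1"
        using less.hyps[of r] qr r0 less.prems by auto
      have "poly q a * poly h a = - poly r a"
        using qr(3) poly_min_poly by (simp add: add_eq_0_iff)
      then have "poly h a * poly (- (q * g)) a = 1"
        using g by (simp add: algebra_simps)
      then show ?thesis
        using qr g by (intro bexI[of _ "- (q * g)"] polys_over_minus polys_over_mult)
    qed
  qed
  obtain r where "r \<in> polys_over K" "poly r a = poly h a" "degree r < degree (min_poly K a)"
    using simple_extension_reduce assms by blast
  with main[of r] assms show ?thesis by auto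
qed

lemma subfield_simple_extension: "is_subfield ((\<lambda>h. poly h a) ` polys_over K)"
  unfolding is_subfield_def
proof (intro conjI ballI)
  show "0 \<in> (\<lambda>h. poly h a) ` polys_over K" "1 \<in> (\<lambda>h. poly h a) ` polys_over K"
    using imageI[OF polys_over_0, of "\<lambda>h. poly h a"] imageI[OF polys_over_1, of "\<lambda>h. poly h a"]
    by simp_all
next
  fix u v assume "u \<in> (\<lambda>h. poly h a) ` polys_over K" "v \<in> (\<lambda>h. poly h a) ` polys_over K"
  then obtain g h where "g \<in> polys_over K" "h \<in> polys_over K" "u = poly g a" "v = poly h a"
    by blast
  then show "u + v \<in> (\<lambda>h. poly h a) ` polys_over K" "u * v \<in> (\<lambda>h. poly h a) ` polys_over K"
    "- u \<in> (\<lambda>h. poly h a) ` polys_over K"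
    using imageI[OF polys_over_add, of g h "\<lambda>h. poly h a"]
      imageI[OF polys_over_mult, of g h "\<lambda>h. poly h a"]
      imageI[OF polys_over_minus, of g "\<lambda>h. poly h a"] by simp_all
next
  fix u assume "u \<in> (\<lambda>h. poly h a) ` polys_over K"
  then obtain h where h: "h \<in> polys_over K" "u = poly h a" by blast
  show "inverse u \<in> (\<lambda>h. poly h a) ` polys_over K"
  proof (cases "u = 0")
    case True
    then show ?thesis by (auto intro!: image_eqI[of _ _ 0] polys_over_0)
  next
    case False
    then obtain g where "g \<in> polys_over K" "poly h a * poly g a = 1"
      using simple_extension_inverse h by blast
    then show ?thesis
      using h inverse_unique[of u "poly g a"] by (intro image_eqI[of _ _ g]) auto
  qed
qed

end

end

lemma rat_adjoin_insert:
  fixes a :: "'a::field_char_0"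
  assumes "algebraic_over (rat_adjoin S) a"
  shows "rat_adjoin (insert a S) = (\<lambda>h. poly h a) ` polys_over (rat_adjoin S)"
proof (rule antisym)
  note K = subfield_rat_adjoin[of S]
  show "rat_adjoin (insert a S) \<subseteq> (\<lambda>h. poly h a) ` polys_over (rat_adjoin S)"
  proof (rule rat_adjoin_least)
    show "is_subfield ((\<lambda>h. poly h a) ` polys_over (rat_adjoin S))"
      by (rule subfield_simple_extension[OF K assms])
    have "a = poly [:0, 1:] a" "[:0, 1:] \<in> polys_over (rat_adjoin S)"
      using polys_over_linear[OF K subfield_0[OF K]] by auto
    then have "a \<in> (\<lambda>h. poly h a) ` polys_over (rat_adjoin S)" by blast
    moreover have "s \<in> (\<lambda>h. poly h a) ` polys_over (rat_adjoin S)" if "s \<in> S" for s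
      using that rat_adjoin_superset[of S]
      by (intro image_eqI[of _ _ "[:s:]"] polys_over_const[OF K]) auto
    ultimately show "insert a S \<subseteq> (\<lambda>h. poly h a) ` polys_over (rat_adjoin S)" by blast
  qed
next
  have "rat_adjoin S \<subseteq> rat_adjoin (insert a S)" "a \<in> rat_adjoin (insert a S)"
    using rat_adjoin_mono[of S "insert a S"] rat_adjoin_superset[of "insert a S"] by auto
  then show "(\<lambda>h. poly h a) ` polys_over (rat_adjoin S) \<subseteq> rat_adjoin (insert a S)"
    using polys_over_mono by (blast intro: poly_in_subfield subfield_rat_adjoin)
qed


section \<open>Embeddings of a subfield and their extension\<close>

definition hom_on :: "'a::field set \<Rightarrow> ('a \<Rightarrow> 'b::field) \<Rightarrow> bool" where
  "hom_on K \<phi> \<longleftrightarrow> \<phi> 1 = 1 \<and>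
     (\<forall>a\<in>K. \<forall>b\<in>K. \<phi> (a + b) = \<phi> a + \<phi> b \<and> \<phi> (a * b) = \<phi> a * \<phi> b)"

lemma hom_on_subset: "hom_on L \<phi> \<Longrightarrow> K \<subseteq> L \<Longrightarrow> hom_on K \<phi>"
  by (auto simp: hom_on_def)

context
  fixes K :: "'a::field set" and \<phi> :: "'a \<Rightarrow> 'b::field"
  assumes K: "is_subfield K" and hom: "hom_on K \<phi>"
begin

lemma hom_on_1: "\<phi> 1 = 1"
  and hom_on_add: "a \<in> K \<Longrightarrow> b \<in> K \<Longrightarrow> \<phi> (a + b) = \<phi> a + \<phi> b"
  and hom_on_mult: "a \<in> K \<Longrightarrow> b \<in> K \<Longrightarrow> \<phi> (a * b) = \<phi> a * \<phi> b"
  using hom by (auto simp: hom_on_def)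

lemma hom_on_0: "\<phi> 0 = 0"
  using hom_on_add[OF subfield_0[OF K] subfield_0[OF K]] by (metis add_0 add_cancel_right_right)

lemma hom_on_minus: "a \<in> K \<Longrightarrow> \<phi> (- a) = - \<phi> a"
  using hom_on_add[of a "- a"] subfield_minus[OF K] hom_on_0
  by (simp add: eq_neg_iff_add_eq_0 add.commute)

lemma hom_on_diff: "a \<in> K \<Longrightarrow> b \<in> K \<Longrightarrow> \<phi> (a - b) = \<phi> a - \<phi> b"
  using hom_on_add[of a "- b"] hom_on_minus[of b] subfield_minus[OF K, of b] by simp

lemma hom_on_sum: "(\<And>i. i \<in> I \<Longrightarrow> g i \<in> K) \<Longrightarrow> \<phi> (sum g I) = (\<Sum>i\<in>I. \<phi> (g i))"
  by (induction I rule: infinite_finite_induct)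
    (auto simp: hom_on_0 hom_on_add subfield_sum[OF K])

lemma hom_on_prod: "(\<And>i. i \<in> I \<Longrightarrow> g i \<in> K) \<Longrightarrow> \<phi> (prod g I) = (\<Prod>i\<in>I. \<phi> (g i))"
  by (induction I rule: infinite_finite_induct)
    (auto simp: hom_on_1 hom_on_mult subfield_prod[OF K])

lemma hom_on_power: "a \<in> K \<Longrightarrow> \<phi> (a ^ k) = \<phi> a ^ k"
  by (induction k) (auto simp: hom_on_1 hom_on_mult subfield_power[OF K])

lemma hom_on_inverse: "a \<in> K \<Longrightarrow> \<phi> (inverse a) = inverse (\<phi> a)"
proof (cases "a = 0")
  case False
  assume "a \<in> K"
  then have "\<phi> a * \<phi> (inverse a) = 1"
    using False hom_on_mult[of a "inverse a"] subfield_inverse[OF K] hom_on_1 by simp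
  then show ?thesis by (simp add: inverse_unique)
qed (simp add: hom_on_0)

lemma hom_on_divide: "a \<in> K \<Longrightarrow> b \<in> K \<Longrightarrow> \<phi> (a / b) = \<phi> a / \<phi> b"
  by (simp add: divide_inverse hom_on_mult hom_on_inverse subfield_inverse[OF K])

lemma hom_on_eq_iff: "a \<in> K \<Longrightarrow> b \<in> K \<Longrightarrow> \<phi> a = \<phi> b \<longleftrightarrow> a = b"
proof
  assume ab: "a \<in> K" "b \<in> K" and eq: "\<phi> a = \<phi> b"
  show "a = b"
  proof (rule ccontr)
    assume "a \<noteq> b"
    then have "(a - b) * inverse (a - b) = 1" by simp
    then have "\<phi> (a - b) * \<phi> (inverse (a - b)) = 1"
      using hom_on_mult[of "a - b" "inverse (a - b)"] ab K hom_on_1 by (simp add: subfield_closed)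
    then show False
      using eq ab by (simp add: hom_on_diff)
  qed
qed simp

lemma hom_on_of_nat: "\<phi> (of_nat m) = of_nat m"
  by (induction m) (auto simp: hom_on_0 hom_on_1 hom_on_add subfield_of_nat[OF K] subfield_1[OF K])

lemma hom_on_of_int: "\<phi> (of_int m) = of_int m"
proof (cases m rule: int_cases2)
  case (nonneg k)
  then show ?thesis by (simp add: hom_on_of_nat)
next
  case (nonpos k)
  then show ?thesis by (simp add: hom_on_of_nat hom_on_minus subfield_of_nat[OF K])
qed

lemma coeff_map_poly_hom: "coeff (map_poly \<phi> h) k = \<phi> (coeff h k)"
  by (simp add: coeff_map_poly hom_on_0)

lemma map_poly_hom_add:
  "g \<in> polys_over K \<Longrightarrow> h \<in> polys_over K \<Longrightarrow> map_poly \<phi> (g + h) = map_poly \<phi> g + map_poly \<phi> h"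
  by (intro poly_eqI) (simp add: coeff_map_poly_hom hom_on_add polys_overD)

lemma map_poly_hom_mult:
  "g \<in> polys_over K \<Longrightarrow> h \<in> polys_over K \<Longrightarrow> map_poly \<phi> (g * h) = map_poly \<phi> g * map_poly \<phi> h"
  by (intro poly_eqI)
    (simp add: coeff_map_poly_hom coeff_mult hom_on_sum hom_on_mult polys_overD subfield_mult[OF K])

lemma map_poly_hom_prod:
  "(\<And>i. i \<in> I \<Longrightarrow> g i \<in> polys_over K) \<Longrightarrow> map_poly \<phi> (prod g I) = (\<Prod>i\<in>I. map_poly \<phi> (g i))"
proof (induction I rule: infinite_finite_induct)
  case (insert i I)
  then have "map_poly \<phi> (g i * prod g I) = map_poly \<phi> (g i) * map_poly \<phi> (prod g I)"
    by (intro map_poly_hom_mult polys_over_prod[OF K]) auto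
  with insert show ?case by simp
qed (auto simp: map_poly_1' hom_on_1)

lemma map_poly_hom_linear: "a \<in> K \<Longrightarrow> map_poly \<phi> [:- a, 1:] = [:- \<phi> a, 1:]"
  by (simp add: map_poly_pCons hom_on_0 hom_on_1 hom_on_minus)

lemma degree_map_poly_hom: "h \<in> polys_over K \<Longrightarrow> degree (map_poly \<phi> h) = degree h"
proof (cases "h = 0")
  case False
  assume "h \<in> polys_over K"
  then have "\<phi> (lead_coeff h) \<noteq> 0"
    using hom_on_eq_iff[of "lead_coeff h" 0] False subfield_0[OF K] hom_on_0
    by (auto simp: polys_overD)
  then show ?thesis by (intro map_poly_degree_eq) auto
qed simp

lemma poly_map_poly_hom:
  assumes "h \<in> polys_over K" "a \<in> K"
  shows "poly (map_poly \<phi> h) (\<phi> a) = \<phi> (poly h a)"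
proof -
  have "\<phi> (poly h a) = (\<Sum>i\<le>degree h. \<phi> (coeff h i) * \<phi> a ^ i)"
    unfolding poly_altdef using assms K
    by (simp add: hom_on_sum hom_on_mult hom_on_power polys_overD subfield_closed)
  also have "\<dots> = poly (map_poly \<phi> h) (\<phi> a)"
    using assms by (simp add: poly_altdef degree_map_poly_hom coeff_map_poly_hom)
  finally show ?thesis by simp
qed

lemma hom_on_image: "is_subfield (\<phi> ` K)"
  unfolding is_subfield_def
proof (intro conjI ballI)
  show "0 \<in> \<phi> ` K" "1 \<in> \<phi> ` K"
    using hom_on_0 hom_on_1 subfield_0[OF K] subfield_1[OF K] by (metis imageI)+
next
  fix u v assume "u \<in> \<phi> ` K" "v \<in> \<phi> ` K"
  then show "u + v \<in> \<phi> ` K" "u * v \<in> \<phi> ` K" "- u \<in> \<phi> ` K" "inverse u \<in> \<phi> ` K"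
    by (auto simp: hom_on_add [symmetric] hom_on_mult [symmetric] hom_on_minus [symmetric]
        hom_on_inverse [symmetric] intro!: imageI subfield_closed[OF K])
qed

end

lemma hom_on_of_rat:
  fixes \<phi> :: "'a::field_char_0 \<Rightarrow> 'b::field_char_0"
  assumes "is_subfield K" "hom_on K \<phi>"
  shows "\<phi> (of_rat r) = of_rat r"
proof (cases r)
  case (Fract a b)
  then show ?thesis
    using assms by (simp add: of_rat_rat hom_on_divide[OF assms] hom_on_of_int[OF assms] subfield_of_int)
qed

lemma hom_on_map_poly_of_rat:
  fixes \<phi> :: "'a::field_char_0 \<Rightarrow> 'b::field_char_0"
  assumes "is_subfield K" "hom_on K \<phi>"
  shows "map_poly \<phi> (map_poly of_rat h) = map_poly of_rat h"
  by (intro poly_eqI)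
    (simp add: coeff_map_poly_hom[OF assms] coeff_map_poly hom_on_of_rat[OF assms])

text \<open>The set where two embeddings agree is a subfield, so agreement on the generators spreads
  to the generated field.\<close>

lemma hom_on_rat_adjoin_eqI:
  fixes \<phi> \<psi> :: "'a::field_char_0 \<Rightarrow> 'b::field_char_0"
  assumes "hom_on (rat_adjoin S) \<phi>" "hom_on (rat_adjoin S) \<psi>" "\<And>s. s \<in> S \<Longrightarrow> \<phi> s = \<psi> s"
    and "y \<in> rat_adjoin S"
  shows "\<phi> y = \<psi> y"
proof -
  note K = subfield_rat_adjoin[of S]
  have "is_subfield {a \<in> rat_adjoin S. \<phi> a = \<psi> a}"
    using hom_on_0[OF K assms(1)] hom_on_0[OF K assms(2)] hom_on_1[OF K assms(1)]
      hom_on_1[OF K assms(2)]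
    by (auto simp: is_subfield_def hom_on_add[OF K assms(1)] hom_on_add[OF K assms(2)]
        hom_on_mult[OF K assms(1)] hom_on_mult[OF K assms(2)]
        hom_on_minus[OF K assms(1)] hom_on_minus[OF K assms(2)]
        hom_on_inverse[OF K assms(1)] hom_on_inverse[OF K assms(2)]
        intro!: subfield_closed[OF K])
  then have "rat_adjoin S \<subseteq> {a \<in> rat_adjoin S. \<phi> a = \<psi> a}"
    by (rule rat_adjoin_least) (use assms(3) rat_adjoin_superset in auto)
  with assms(4) show ?thesis by auto
qed

text \<open>\<open>poly h a\<close> is sent to the value at \<open>w\<close> of the image of
  \<open>h\<close>. This does not depend on \<open>h\<close>: two representatives differ by a
  multiple of the minimal polynomial, whose image vanishes at \<open>w\<close>.\<close>

lemma hom_on_extend: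
  fixes \<phi> :: "'a::field_char_0 \<Rightarrow> 'b::field_char_0"
  assumes hom: "hom_on (rat_adjoin S) \<phi>" and alg: "algebraic_over (rat_adjoin S) a"
    and w: "poly (map_poly \<phi> (min_poly (rat_adjoin S) a)) w = 0"
  shows "\<exists>\<psi>. hom_on (rat_adjoin (insert a S)) \<psi> \<and> (\<forall>y\<in>rat_adjoin S. \<psi> y = \<phi> y) \<and> \<psi> a = w"
proof -
  let ?K = "rat_adjoin S"
  note K = subfield_rat_adjoin[of S]
  define E where "E = rat_adjoin (insert a S)"
  have E: "E = (\<lambda>h. poly h a) ` polys_over ?K"
    unfolding E_def by (rule rat_adjoin_insert[OF alg])
  define rep where "rep y = (SOME h. h \<in> polys_over ?K \<and> poly h a = y)" for y
  define \<psi> where "\<psi> y = poly (map_poly \<phi> (rep y)) w" for y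
  have \<psi>: "\<psi> (poly h a) = poly (map_poly \<phi> h) w" if h: "h \<in> polys_over ?K" for h
  proof -
    have rep: "rep (poly h a) \<in> polys_over ?K" "poly (rep (poly h a)) a = poly h a"
      using someI[of "\<lambda>g. g \<in> polys_over ?K \<and> poly g a = poly h a" h] h by (auto simp: rep_def)
    define g where "g = rep (poly h a) - h"
    have g: "g \<in> polys_over ?K" "poly g a = 0"
      using rep h by (auto simp: g_def intro!: polys_over_diff[OF K])
    then obtain q where q: "q \<in> polys_over ?K" "g = q * min_poly ?K a"
      using min_poly_divides[OF K alg] by blast
    have "map_poly \<phi> (rep (poly h a)) = map_poly \<phi> (h + g)"
      by (simp add: g_def)
    also have "\<dots> = map_poly \<phi> h + map_poly \<phi> q * map_poly \<phi> (min_poly ?K a)"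
      using h g q by (simp add: map_poly_hom_add[OF K hom] map_poly_hom_mult[OF K hom]
          min_poly_over[OF K alg])
    finally show ?thesis
      using w by (simp add: \<psi>_def)
  qed
  have "hom_on E \<psi>"
    unfolding hom_on_def
  proof (intro conjI ballI)
    show "\<psi> 1 = 1"
      using \<psi>[OF polys_over_1[OF K]] by (simp add: map_poly_1' hom_on_1[OF K hom])
  next
    fix u v assume "u \<in> E" "v \<in> E"
    then obtain g h where gh: "g \<in> polys_over ?K" "h \<in> polys_over ?K" "u = poly g a" "v = poly h a"
      unfolding E by blast
    show "\<psi> (u + v) = \<psi> u + \<psi> v"
      using gh \<psi>[OF polys_over_add[OF K gh(1,2)]] by (simp add: \<psi> map_poly_hom_add[OF K hom])
    show "\<psi> (u * v) = \<psi> u * \<psi> v"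
      using gh \<psi>[OF polys_over_mult[OF K gh(1,2)]] by (simp add: \<psi> map_poly_hom_mult[OF K hom])
  qed
  moreover have "\<psi> y = \<phi> y" if "y \<in> ?K" for y
    using \<psi>[OF polys_over_const[OF K that]]
    by (cases "y = 0") (simp_all add: map_poly_pCons hom_on_0[OF K hom])
  moreover have "\<psi> a = w"
    using \<psi>[of "[:- 0, 1:]"] polys_over_linear[OF K subfield_0[OF K]]
    by (simp add: map_poly_pCons hom_on_0[OF K hom] hom_on_1[OF K hom])
  ultimately show ?thesis
    unfolding E_def by blast
qed

section \<open>Algebraic integers\<close>

definition int_span :: "'a::field_char_0 set \<Rightarrow> 'a set" where
  "int_span W = {s. \<exists>c :: 'a \<Rightarrow> int. s = (\<Sum>w\<in>W. of_int (c w) * w)}"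

lemma int_span_0: "0 \<in> int_span W"
  unfolding int_span_def by (auto intro!: exI[of _ "\<lambda>_. 0"])

lemma int_span_base: "finite W \<Longrightarrow> w \<in> W \<Longrightarrow> w \<in> int_span W"
  unfolding int_span_def
  by (auto intro!: exI[of _ "\<lambda>v. if v = w then 1 else 0"] simp: if_distrib[of of_int] if_distrib[of "\<lambda>a. a * _"] cong: if_cong)

lemma int_span_add: "s \<in> int_span W \<Longrightarrow> t \<in> int_span W \<Longrightarrow> s + t \<in> int_span W"
proof -
  assume "s \<in> int_span W" "t \<in> int_span W"
  then obtain a b :: "'a \<Rightarrow> int" where "s = (\<Sum>w\<in>W. of_int (a w) * w)" "t = (\<Sum>w\<in>W. of_int (b w) * w)"
    by (auto simp: int_span_def)
  then have "s + t = (\<Sum>w\<in>W. of_int (a w + b w) * w)"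
    by (simp add: sum.distrib distrib_right)
  then show "s + t \<in> int_span W"
    unfolding int_span_def mem_Collect_eq by (rule exI[of _ "\<lambda>w. a w + b w"])
qed

lemma int_span_smult: "s \<in> int_span W \<Longrightarrow> of_int c * s \<in> int_span W"
proof -
  assume "s \<in> int_span W"
  then obtain a :: "'a \<Rightarrow> int" where "s = (\<Sum>w\<in>W. of_int (a w) * w)"
    by (auto simp: int_span_def)
  then have "of_int c * s = (\<Sum>w\<in>W. of_int (c * a w) * w)"
    by (simp add: sum_distrib_left mult.assoc)
  then show "of_int c * s \<in> int_span W"
    unfolding int_span_def mem_Collect_eq by (rule exI[of _ "\<lambda>w. c * a w"])
qed

lemma int_span_sum: "(\<And>i. i \<in> I \<Longrightarrow> s i \<in> int_span W) \<Longrightarrow> sum s I \<in> int_span W"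
  by (induction I rule: infinite_finite_induct) (auto intro: int_span_0 int_span_add)

lemma int_span_stable:
  assumes "\<And>w. w \<in> W \<Longrightarrow> y * w \<in> int_span W" "s \<in> int_span W"
  shows "y * s \<in> int_span W"
proof -
  obtain a :: "'a \<Rightarrow> int" where "s = (\<Sum>w\<in>W. of_int (a w) * w)"
    using assms by (auto simp: int_span_def)
  then have "y * s = (\<Sum>w\<in>W. of_int (a w) * (y * w))"
    by (simp add: sum_distrib_left mult_ac)
  then show ?thesis
    using assms(1) by (simp add: int_span_sum int_span_smult)
qed

text \<open>
  Multiplication by \<open>y\<close> acts on the spanning set through an integer matrix, and \<open>y\<close> is an eigenvalue
  of that matrix.
\<close>

lemma algebraic_int_if_stable:
  fixes y :: "'a::field_char_0"
  assumes fin: "finite W" and w: "w \<in> W" "w \<noteq> 0"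
    and stable: "\<And>w. w \<in> W \<Longrightarrow> y * w \<in> int_span W"
  shows "algebraic_int y"
proof -
  obtain ws where ws: "set ws = W" "distinct ws"
    using finite_distinct_list[OF fin] by blast
  define m where "m = length ws"
  have "\<forall>w\<in>W. \<exists>c :: 'a \<Rightarrow> int. y * w = (\<Sum>v\<in>W. of_int (c v) * v)"
    using stable by (auto simp: int_span_def)
  then obtain c :: "'a \<Rightarrow> 'a \<Rightarrow> int" where c: "\<And>w. w \<in> W \<Longrightarrow> y * w = (\<Sum>v\<in>W. of_int (c w v) * v)"
    by metis
  define A where "A = mat m m (\<lambda>(i, j). c (ws ! i) (ws ! j))"
  define B :: "'a mat" where "B = map_mat of_int A"
  have A: "A \<in> carrier_mat m m" and B: "B \<in> carrier_mat m m"
    by (simp_all add: A_def B_def)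
  define v where "v = vec m (\<lambda>i. ws ! i)"
  have "B *\<^sub>v v = y \<cdot>\<^sub>v v"
  proof (rule eq_vecI)
    fix i assume "i < dim_vec (y \<cdot>\<^sub>v v)"
    then have i: "i < m" by (simp add: v_def)
    have "(B *\<^sub>v v) $ i = (\<Sum>j<m. of_int (c (ws ! i) (ws ! j)) * ws ! j)"
      using i by (simp add: B_def A_def v_def scalar_prod_def lessThan_atLeast0)
    also have "\<dots> = (\<Sum>v\<in>W. of_int (c (ws ! i) v) * v)"
      unfolding ws(1) [symmetric]
      by (rule sum.reindex_bij_betw[OF bij_betw_nth[OF ws(2)]]) (auto simp: m_def)
    also have "\<dots> = y * ws ! i"
      using i by (intro c [symmetric]) (auto simp: m_def ws(1) [symmetric])
    finally show "(B *\<^sub>v v) $ i = (y \<cdot>\<^sub>v v) $ i"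
      using i by (simp add: v_def)
  qed (simp_all add: v_def B_def A_def)
  moreover have "v \<noteq> 0\<^sub>v m"
  proof
    assume v0: "v = 0\<^sub>v m"
    obtain i where "i < m" "ws ! i = w"
      using w(1) ws(1) by (auto simp: in_set_conv_nth m_def)
    then have "v $ i = w" by (simp add: v_def)
    with v0 \<open>i < m\<close> w(2) show False by simp
  qed
  moreover have "v \<in> carrier_vec m"
    by (simp add: v_def)
  ultimately have "eigenvalue B y"
    using B by (auto simp: eigenvalue_def eigenvector_def)
  then have "poly (char_poly B) y = 0"
    using eigenvalue_root_char_poly[OF B] by simp
  moreover have "char_poly B = map_poly of_int (char_poly A)"
    unfolding B_def by (rule of_int_hom.char_poly_hom[OF A])
  ultimately show ?thesis
    unfolding algebraic_int_altdef_ipoly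
    using degree_monic_char_poly[OF A] by (intro exI[of _ "char_poly A"]) simp
qed

context
  fixes x y :: "'a::field_char_0"
  assumes x: "algebraic_int x" and y: "algebraic_int y"
begin

text \<open>The monic equations rewrite \<open>x ^ a\<close> and \<open>y ^ b\<close> in lower
  powers, so the finitely many products \<open>x ^ i * y ^ j\<close> with \<open>i < a\<close> and
  \<open>j < b\<close> span an additive group stable under multiplication by \<open>x\<close> and by
  \<open>y\<close>, hence by \<open>x + y\<close> and \<open>x * y\<close>.\<close>

private lemma stable_set:
  "\<exists>W. finite W \<and> 1 \<in> W \<and> (\<forall>w\<in>W. x * w \<in> int_span W \<and> y * w \<in> int_span W)"
proof -
  have red: "\<exists>(a :: nat) c. a > 0 \<and> z ^ a = (\<Sum>i<a. of_int (c i) * z ^ i)" if z: "algebraic_int z" for z :: 'a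
  proof -
    obtain p where p: "poly (map_poly of_int p) z = 0" "lead_coeff p = 1"
      using z unfolding algebraic_int_altdef_ipoly by blast
    have "degree p \<noteq> 0"
    proof
      assume "degree p = 0"
      then obtain c where "p = [:c:]" by (rule degree_eq_zeroE)
      with p show False by simp
    qed
    moreover have "0 = (\<Sum>i\<le>degree p. of_int (coeff p i) * z ^ i)"
      using p(1) by (simp add: poly_altdef)
    then have "z ^ degree p = (\<Sum>i<degree p. of_int (- coeff p i) * z ^ i)"
      using p(2) by (simp add: lessThan_Suc_atMost [symmetric] sum_negf eq_neg_iff_add_eq_0 add.commute)
    ultimately show ?thesis by (intro exI[of _ "degree p"] exI[of _ "\<lambda>i. - coeff p i"]) simp
  qed
  obtain a :: nat and c where a: "a > 0" "x ^ a = (\<Sum>i<a. of_int (c i) * x ^ i)"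
    using red[OF x] by blast
  obtain b :: nat and e where b: "b > 0" "y ^ b = (\<Sum>i<b. of_int (e i) * y ^ i)"
    using red[OF y] by blast
  define W where "W = (\<lambda>(i, j). x ^ i * y ^ j) ` ({..<a} \<times> {..<b})"
  have W: "x ^ i * y ^ j \<in> W" if "i < a" "j < b" for i j
    using that by (force simp: W_def)
  have fin: "finite W" by (simp add: W_def)
  note base = int_span_base[OF fin W]
  have x_stable: "x * (x ^ i * y ^ j) \<in> int_span W" if ij: "i < a" "j < b" for i j
  proof (cases "Suc i < a")
    case True
    then show ?thesis using base[of "Suc i" j] ij by (simp add: mult.assoc)
  next
    case False
    with ij have "Suc i = a" by simp
    then have "x * (x ^ i * y ^ j) = x ^ a * y ^ j"
      by (metis power_Suc mult.assoc)
    also have "\<dots> = (\<Sum>i<a. of_int (c i) * (x ^ i * y ^ j))"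
      unfolding a(2) by (simp add: sum_distrib_right mult.assoc)
    finally show ?thesis
      using ij by (auto intro!: int_span_sum int_span_smult base)
  qed
  have y_stable: "y * (x ^ i * y ^ j) \<in> int_span W" if ij: "i < a" "j < b" for i j
  proof (cases "Suc j < b")
    case True
    then show ?thesis using base[of i "Suc j"] ij by (simp add: mult_ac)
  next
    case False
    with ij have "Suc j = b" by simp
    then have "y * (x ^ i * y ^ j) = x ^ i * y ^ b"
      by (metis power_Suc mult.left_commute)
    also have "\<dots> = (\<Sum>j<b. of_int (e j) * (x ^ i * y ^ j))"
      unfolding b(2) by (simp add: sum_distrib_left mult_ac)
    finally show ?thesis
      using ij by (auto intro!: int_span_sum int_span_smult base)
  qed
  have "1 \<in> W" using W[of 0 0] a(1) b(1) by simp
  with fin x_stable y_stable show ?thesis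
    by (intro exI[of _ W]) (auto simp: W_def)
qed

lemma algebraic_int_add: "algebraic_int (x + y)"
proof -
  obtain W where "finite W" "1 \<in> W" "\<forall>w\<in>W. x * w \<in> int_span W \<and> y * w \<in> int_span W"
    using stable_set by blast
  then show ?thesis
    by (intro algebraic_int_if_stable[of W 1]) (auto simp: distrib_right intro: int_span_add)
qed

lemma algebraic_int_mult: "algebraic_int (x * y)"
proof -
  obtain W where "finite W" "1 \<in> W" "\<forall>w\<in>W. x * w \<in> int_span W \<and> y * w \<in> int_span W"
    using stable_set by blast
  then show ?thesis
    by (intro algebraic_int_if_stable[of W 1]) (auto simp: mult.assoc intro: int_span_stable)
qed

end

lemma algebraic_int_diff:
  "algebraic_int x \<Longrightarrow> algebraic_int y \<Longrightarrow> algebraic_int (x - y :: 'a::field_char_0)"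
  using algebraic_int_add[of x "- y"] by simp

lemma algebraic_int_sum:
  "(\<And>i. i \<in> I \<Longrightarrow> algebraic_int (g i)) \<Longrightarrow> algebraic_int (sum g I :: 'a::field_char_0)"
  by (induction I rule: infinite_finite_induct) (auto intro: algebraic_int_add)

lemma algebraic_int_prod:
  "(\<And>i. i \<in> I \<Longrightarrow> algebraic_int (g i)) \<Longrightarrow> algebraic_int (prod g I :: 'a::field_char_0)"
  by (induction I rule: infinite_finite_induct) (auto intro: algebraic_int_mult)

lemma algebraic_int_power: "algebraic_int x \<Longrightarrow> algebraic_int (x ^ k :: 'a::field_char_0)"
  by (induction k) (auto intro: algebraic_int_mult)

text \<open>One factor \<open>c\<close> is given to each linear factor, which then has the
  coefficients \<open>- c * x s\<close> and \<open>c\<close>, both algebraic integers.\<close>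

lemma algebraic_int_coeff_prod_linear:
  fixes x :: "'b \<Rightarrow> 'a::field_char_0"
  assumes "finite S" "algebraic_int c" "\<And>s. s \<in> S \<Longrightarrow> algebraic_int (c * x s)"
  shows "algebraic_int (c ^ card S * coeff (\<Prod>s\<in>S. [:- x s, 1:]) m)"
  using assms(1,3)
proof (induction S arbitrary: m rule: finite_induct)
  case empty
  then show ?case by (cases m) auto
next
  case (insert s S)
  let ?p = "\<Prod>s\<in>S. [:- x s, 1:]"
  have IH: "algebraic_int (c ^ card S * coeff ?p m)" for m
    using insert by auto
  have "c ^ card (insert s S) * coeff (\<Prod>s\<in>insert s S. [:- x s, 1:]) m
      = c * (case m of 0 \<Rightarrow> 0 | Suc m' \<Rightarrow> c ^ card S * coeff ?p m') - (c * x s) * (c ^ card S * coeff ?p m)"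
    using insert.hyps by (cases m) (simp_all add: algebra_simps)
  also have "algebraic_int \<dots>"
  proof (rule algebraic_int_diff)
    have "algebraic_int (case m of 0 \<Rightarrow> 0 | Suc m' \<Rightarrow> c ^ card S * coeff ?p m')"
      using IH by (auto split: nat.split)
    then show "algebraic_int (c * (case m of 0 \<Rightarrow> 0 | Suc m' \<Rightarrow> c ^ card S * coeff ?p m'))"
      by (rule algebraic_int_mult[OF assms(2)])
    show "algebraic_int (c * x s * (c ^ card S * coeff ?p m))"
      using insert.prems by (intro algebraic_int_mult[OF _ IH]) simp
  qed
  finally show ?case .
qed

section \<open>Hensel lifting\<close>

lemma padic_residue_minus: "padic_residue k (- x) = (- padic_residue k x) mod int CARD('p) ^ k"
  for x :: "'p::prime_card padic_int"
  by transfer simp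

lemma padic_residue_diff:
  "padic_residue k (x - y) = (padic_residue k x - padic_residue k y) mod int CARD('p) ^ k"
  for x y :: "'p::prime_card padic_int"
  by transfer simp

lemma padic_residue_mod [simp]:
  "padic_residue k x mod int CARD('p) ^ k = padic_residue k x" for x :: "'p::prime_card padic_int"
  using padic_residue_add_mod[of k 0 x] by simp

lemma padic_residue_of_int:
  "padic_residue k (of_int m :: 'p::prime_card padic_int) = m mod int CARD('p) ^ k"
  by (cases m rule: int_cases2)
    (simp_all add: padic_residue_minus padic_residue_of_nat mod_minus_eq)

lemma padic_residue_mod_1:
  "e \<ge> 1 \<Longrightarrow> padic_residue e x mod int CARD('p) = padic_residue 1 x"
  for x :: "'p::prime_card padic_int"
  using padic_residue_add_mod[of 1 "e - 1" x] by simp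

lemma
  fixes x y :: "'p::prime_card padic_int"
  shows cong_padic_residue_add:
      "[padic_residue k (x + y) = padic_residue k x + padic_residue k y] (mod int CARD('p) ^ k)"
    and cong_padic_residue_diff:
      "[padic_residue k (x - y) = padic_residue k x - padic_residue k y] (mod int CARD('p) ^ k)"
    and cong_padic_residue_mult:
      "[padic_residue k (x * y) = padic_residue k x * padic_residue k y] (mod int CARD('p) ^ k)"
    and cong_padic_residue_of_int:
      "[padic_residue k (of_int m :: 'p padic_int) = m] (mod int CARD('p) ^ k)"
  by (simp_all add: cong_def padic_residue_add padic_residue_diff padic_residue_mult padic_residue_of_int)

lemma cong_poly_int:
  fixes P :: "int poly"
  assumes "[u = v] (mod q)"
  shows "[poly P u = poly P v] (mod q)"
proof (induction P)
  case (pCons a P)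
  show ?case
    unfolding poly_pCons by (rule cong_add[OF cong_refl cong_mult[OF assms pCons.IH]])
qed simp

lemma cong_padic_residue_power:
  "[padic_residue k (x ^ m) = padic_residue k x ^ m] (mod int CARD('p) ^ k)"
  for x :: "'p::prime_card padic_int"
proof (induction m)
  case 0
  show ?case by (simp add: padic_residue_1 cong_def)
next
  case (Suc m)
  then show ?case
    using cong_trans[OF cong_padic_residue_mult cong_mult[OF cong_refl]] by (metis power_Suc)
qed

lemma cong_padic_residue_sum:
  "[padic_residue k (sum g A) = (\<Sum>a\<in>A. padic_residue k (g a :: 'p padic_int))] (mod int CARD('p::prime_card) ^ k)"
proof (induction A rule: infinite_finite_induct)
  case (insert a A)
  then show ?case
    using cong_trans[OF cong_padic_residue_add cong_add[OF cong_refl insert.IH]] by simp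
qed simp_all

lemma cong_padic_residue_prod:
  "[padic_residue k (prod g A) = (\<Prod>a\<in>A. padic_residue k (g a :: 'p padic_int))] (mod int CARD('p::prime_card) ^ k)"
proof (induction A rule: infinite_finite_induct)
  case (insert a A)
  then show ?case
    using cong_trans[OF cong_padic_residue_mult cong_mult[OF cong_refl insert.IH]] by simp
qed (simp_all add: padic_residue_1 cong_def)

text \<open>\<open>padic_residue k\<close> has integer values and respects sums and products only up
  to congruence, so it cannot simply be mapped over a polynomial; the coefficients are followed
  through the product one factor at a time.\<close>

lemma cong_coeff_prod_linear:
  fixes x :: "'b \<Rightarrow> 'p::prime_card padic_int"
  assumes "finite S"
  shows "[padic_residue k (coeff (\<Prod>s\<in>S. [:- x s, 1:]) m) =
    coeff (\<Prod>s\<in>S. [:- padic_residue k (x s), 1:]) m] (mod int CARD('p) ^ k)"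
  using assms
proof (induction S arbitrary: m rule: finite_induct)
  case empty
  then show ?case by (cases m) (simp_all add: padic_residue_1 cong_def)
next
  case (insert s S)
  let ?q = "int CARD('p) ^ k"
  let ?P = "\<Prod>s\<in>S. [:- x s, 1:]" and ?Q = "\<Prod>s\<in>S. [:- padic_residue k (x s), 1:]"
  define a where "a = (case m of 0 \<Rightarrow> 0 | Suc m' \<Rightarrow> coeff ?P m')"
  define b where "b = (case m of 0 \<Rightarrow> 0 | Suc m' \<Rightarrow> coeff ?Q m')"
  have ab: "[padic_residue k a = b] (mod ?q)"
    using insert.IH by (simp add: a_def b_def split: nat.split)
  have P: "coeff (\<Prod>s\<in>insert s S. [:- x s, 1:]) m = a - x s * coeff ?P m"
    using insert.hyps by (cases m) (simp_all add: a_def)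
  have Q: "coeff (\<Prod>s\<in>insert s S. [:- padic_residue k (x s), 1:]) m = b - padic_residue k (x s) * coeff ?Q m"
    using insert.hyps by (cases m) (simp_all add: b_def)
  have "[padic_residue k (x s * coeff ?P m) = padic_residue k (x s) * coeff ?Q m] (mod ?q)"
    by (rule cong_trans[OF cong_padic_residue_mult cong_mult[OF cong_refl insert.IH]])
  then show ?case
    unfolding P Q by (intro cong_trans[OF cong_padic_residue_diff] cong_diff ab)
qed

lemma of_int_mod_ring_eq_iff:
  "(of_int a :: 'p::prime_card mod_ring) = of_int b \<longleftrightarrow> a mod int CARD('p) = b mod int CARD('p)"
  unfolding of_int_of_int_mod_ring by transfer simp

definition padic_red :: "'p::prime_card padic_int \<Rightarrow> 'p mod_ring" where
  "padic_red x = of_int (padic_residue 1 x)"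

interpretation padic_red: comm_ring_hom padic_red
proof
  fix x y :: "'a padic_int"
  show "padic_red (x + y) = padic_red x + padic_red y"
    unfolding padic_red_def of_int_add [symmetric] of_int_mod_ring_eq_iff
    by (simp add: padic_residue_add)
  show "padic_red (x * y) = padic_red x * padic_red y"
    unfolding padic_red_def of_int_mult [symmetric] of_int_mod_ring_eq_iff
    by (simp add: padic_residue_mult)
next
  show "padic_red 0 = (0 :: 'a mod_ring)"
    by (simp add: padic_red_def)
  have "padic_red 1 = (of_int 1 :: 'a mod_ring)"
    unfolding padic_red_def of_int_mod_ring_eq_iff by (simp add: padic_residue_1)
  then show "padic_red 1 = (1 :: 'a mod_ring)" by simp
qed

interpretation padic_red_poly: map_poly_comm_ring_hom padic_red ..

lemma padic_red_of_int: "padic_red (of_int m :: 'p padic_int) = (of_int m :: 'p::prime_card mod_ring)"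
  unfolding padic_red_def of_int_mod_ring_eq_iff by (simp add: padic_residue_of_int)

lemma to_fract_of_int: "to_fract (of_int m :: 'a::idom) = of_int m"
proof -
  interpret h: inj_comm_ring_hom "to_fract :: 'a \<Rightarrow> 'a fract"
    by unfold_locales auto
  show ?thesis by (rule h.hom_of_int)
qed

lemma poly_of_roots_eq_prod:
  fixes g :: "'a::idom poly"
  assumes lead: "lead_coeff g = 1" and "degree g = n" and inj: "inj_on X {1..n}"
    and root: "\<And>j. j \<in> {1..n} \<Longrightarrow> poly g (X j) = 0"
  shows "g = (\<Prod>j\<in>{1..n}. [:- X j, 1:])"
proof (rule poly_eqI_degree_lead_coeff[of _ n _ "X ` {1..n}"])
  have deg: "degree (\<Prod>j\<in>{1..n}. [:- X j, 1:]) = n"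
    by (subst degree_prod_eq_sum_degree) auto
  then show "degree (\<Prod>j\<in>{1..n}. [:- X j, 1:]) \<le> n" "degree g \<le> n"
    using assms by auto
  have "lead_coeff (\<Prod>j\<in>{1..n}. [:- X j, 1:]) = 1"
    by (simp add: lead_coeff_prod)
  then show "coeff g n = coeff (\<Prod>j\<in>{1..n}. [:- X j, 1:]) n"
    using lead assms(2) deg by simp
  show "n \<le> card (X ` {1..n})"
    using inj by (simp add: card_image)
  show "poly g z = poly (\<Prod>j\<in>{1..n}. [:- X j, 1:]) z" if "z \<in> X ` {1..n}" for z
  proof -
    have "poly (\<Prod>j\<in>{1..n}. [:- X j, 1:]) z = 0"
      using that by (auto simp: poly_prod intro: prod_zero)
    with that root show ?thesis by auto
  qed
qed

section \<open>The zeros of f in the p-adic integers\<close>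

locale hensel_setup =
  fixes f :: "rat poly" and F :: "int poly" and c :: int and n :: nat
    and ty :: "'p::prime_card itself"
  assumes lead: "lead_coeff f = 1" and deg: "degree f = n"
    and cf: "map_poly of_int F = smult (of_int c) f"
    and split: "splits_distinct n (map_poly of_int F :: 'p mod_ring poly)"
begin

abbreviation "Fbar \<equiv> (map_poly of_int F :: 'p mod_ring poly)"

lemma F_over:
  "map_poly of_int F = smult (of_int c) (map_poly of_rat f :: 'a::field_char_0 poly)"
proof -
  have "map_poly of_rat (map_poly of_int F) = (map_poly of_int F :: 'a poly)"
    by (intro poly_eqI) (simp add: coeff_map_poly)
  moreover have "map_poly of_rat (smult (of_int c) f) = smult (of_int c) (map_poly of_rat f :: 'a poly)"
    by (intro poly_eqI) (simp add: coeff_map_poly of_rat_mult)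
  ultimately show ?thesis using cf by simp
qed

lemma Fbar_nz: "Fbar \<noteq> 0"
  using split by (auto simp: splits_distinct_def prod_zero_iff)

lemma c_nz: "c \<noteq> 0"
proof
  assume "c = 0"
  then have "(map_poly of_int F :: rat poly) = 0" using cf by simp
  then have "F = 0" by (simp add: poly_eq_iff coeff_map_poly)
  then show False using Fbar_nz by simp
qed

lemma monic_f_over:
  shows "lead_coeff (map_poly of_rat f :: 'a::field_char_0 poly) = 1"
    and "degree (map_poly of_rat f :: 'a::field_char_0 poly) = n"
  using lead deg by (simp_all add: coeff_map_poly degree_map_poly)

lemma padic_zeros_split:
  fixes x :: "nat \<Rightarrow> 'p padic_int"
  assumes "padic_zeros f n x"
  shows "inj_on (\<lambda>j. to_fract (x j)) {1..n}"
    and "map_poly of_rat f = (\<Prod>j\<in>{1..n}. [:- to_fract (x j), 1:])"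
proof -
  show inj: "inj_on (\<lambda>j. to_fract (x j)) {1..n}"
  proof (rule inj_onI)
    fix i j assume ij: "i \<in> {1..n}" "j \<in> {1..n}" "to_fract (x i) = to_fract (x j)"
    have "inj_on x {1..n}"
      using assms unfolding padic_zeros_def by (rule conjunct1)
    moreover have "x i = x j"
      using ij(3) by (simp only: to_fract_eq_iff)
    ultimately show "i = j"
      using ij(1,2) by (auto dest: inj_onD)
  qed
  show "map_poly of_rat f = (\<Prod>j\<in>{1..n}. [:- to_fract (x j), 1:])"
    using assms unfolding padic_zeros_def by (intro poly_of_roots_eq_prod[OF monic_f_over inj]) blast
qed

text \<open>The factorisation over the fraction field involves only p-adic integers, so injectivity
  of \<open>to_fract\<close> pulls it back to a ring that has a reduction modulo p.\<close>

lemma F_padic_split: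
  fixes x :: "nat \<Rightarrow> 'p padic_int"
  assumes "padic_zeros f n x"
  shows "map_poly of_int F = smult (of_int c) (\<Prod>j\<in>{1..n}. [:- x j, 1:])"
proof -
  interpret h: inj_comm_ring_hom "to_fract :: 'p padic_int \<Rightarrow> 'p padic"
    by unfold_locales auto
  interpret hp: map_poly_inj_comm_ring_hom "to_fract :: 'p padic_int \<Rightarrow> 'p padic" ..
  have "map_poly to_fract (map_poly of_int F :: 'p padic_int poly) = map_poly of_int F"
    by (intro poly_eqI) (simp add: coeff_map_poly to_fract_of_int)
  also have "\<dots> = smult (of_int c) (\<Prod>j\<in>{1..n}. [:- to_fract (x j), 1:])"
    unfolding F_over padic_zeros_split(2)[OF assms] ..
  also have "\<dots> = map_poly to_fract (smult (of_int c) (\<Prod>j\<in>{1..n}. [:- x j, 1:]))"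
    by (simp add: h.map_poly_hom_smult hp.hom_prod h.map_poly_pCons_hom to_fract_of_int)
  finally show ?thesis
    by (simp only: hp.eq_iff)
qed

text \<open>Reducing the factorisation modulo p shows that the residues of the \<open>x j\<close>
  exhaust the zeros of \<open>Fbar\<close>. There are \<open>n\<close> of these, so counting makes
  the residues distinct.\<close>

lemma padic_zeros_residues:
  fixes x :: "nat \<Rightarrow> 'p padic_int"
  assumes "padic_zeros f n x"
  shows "bij_betw (\<lambda>j. of_int (padic_residue 1 (x j)) :: 'p mod_ring) {1..n} {a. poly Fbar a = 0}"
proof -
  obtain a S where aS: "a \<noteq> 0" "finite S" "card S = n" "Fbar = smult a (\<Prod>s\<in>S. [:- s, 1:])"
    using split by (auto simp: splits_distinct_def)
  have "Fbar = map_poly padic_red (map_poly of_int F :: 'p padic_int poly)"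
    by (intro poly_eqI) (simp add: coeff_map_poly padic_red_of_int)
  also have "\<dots> = smult (of_int c) (\<Prod>j\<in>{1..n}. [:- padic_red (x j), 1:])"
    unfolding F_padic_split[OF assms]
    by (simp add: padic_red.map_poly_hom_smult padic_red_poly.hom_prod padic_red.map_poly_pCons_hom
        padic_red_of_int padic_red.hom_uminus)
  finally have eq: "Fbar = smult (of_int c) (\<Prod>j\<in>{1..n}. [:- padic_red (x j), 1:])" .
  with Fbar_nz have c: "(of_int c :: 'p mod_ring) \<noteq> 0" by auto
  have "{a. poly Fbar a = 0} = S"
    using aS by (auto simp: poly_prod prod_zero_iff)
  moreover have "{a. poly Fbar a = 0} = (\<lambda>j. padic_red (x j)) ` {1..n}"
    using c unfolding eq by (auto simp: poly_prod prod_zero_iff)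
  ultimately have "card ((\<lambda>j. padic_red (x j)) ` {1..n}) = card {1..n}"
    and img: "(\<lambda>j. padic_red (x j)) ` {1..n} = {a. poly Fbar a = 0}"
    using aS by simp_all
  then have "inj_on (\<lambda>j. padic_red (x j)) {1..n}"
    by (intro eq_card_imp_inj_on) auto
  with img show ?thesis
    by (simp add: bij_betw_def padic_red_def)
qed

text \<open>Makes the modular inverses in \<open>interp_poly\<close> genuine inverses: zeros that
  differ modulo p have a difference prime to every power of p.\<close>

lemma coprime_residue_diff:
  fixes x :: "nat \<Rightarrow> 'p padic_int"
  assumes x: "padic_zeros f n x" and rs: "r \<in> {1..n}" "s \<in> {1..n}" "r \<noteq> s" and "e \<ge> 1"
  shows "coprime (padic_residue e (x r) - padic_residue e (x s)) (int CARD('p) ^ e)"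
proof -
  have "(of_int (padic_residue 1 (x r)) :: 'p mod_ring) \<noteq> of_int (padic_residue 1 (x s))"
    using inj_onD[OF bij_betw_imp_inj_on[OF padic_zeros_residues[OF x]] _ rs(1,2)] rs(3) by blast
  then have "padic_residue e (x r) mod int CARD('p) \<noteq> padic_residue e (x s) mod int CARD('p)"
    unfolding of_int_mod_ring_eq_iff using \<open>e \<ge> 1\<close>
    by (metis padic_residue_mod_1 mod_mod_trivial)
  then have "\<not> int CARD('p) dvd padic_residue e (x r) - padic_residue e (x s)"
    by (simp add: mod_eq_dvd_iff)
  moreover have "prime (int CARD('p))"
    using prime_card[where 'a = 'p] by simp
  ultimately have "coprime (int CARD('p)) (padic_residue e (x r) - padic_residue e (x s))"
    using prime_imp_coprime by blast
  then show ?thesis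
    by (simp add: coprime_commute)
qed

lemma taylor_int: "\<exists>w. poly P (u + h) = poly P u + h * poly (pderiv P) u + h ^ 2 * w" for P :: "int poly"
proof (induction P)
  case (pCons a P)
  then obtain w where w: "poly P (u + h) = poly P u + h * poly (pderiv P) u + h ^ 2 * w" by blast
  \<comment> \<open>The witness is the coefficient of \<open>h ^ 2\<close> in
    \<open>(u + h) * (poly P u + h * poly (pderiv P) u + h ^ 2 * w)\<close>.\<close>
  show ?case
    by (rule exI[of _ "poly (pderiv P) u + u * w + h * w"])
      (simp add: w pderiv_pCons, simp add: algebra_simps power2_eq_square)
qed simp

lemma simple_root:
  assumes "poly Fbar a = 0"
  shows "poly (pderiv Fbar) a \<noteq> 0"
proof -
  obtain b S where bS: "b \<noteq> 0" "finite S" "card S = n" "Fbar = smult b (\<Prod>s\<in>S. [:- s, 1:])"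
    using split by (auto simp: splits_distinct_def)
  then have a: "a \<in> S"
    using assms by (auto simp: poly_prod prod_zero_iff)
  define H where "H = smult b (\<Prod>s\<in>S - {a}. [:- s, 1:])"
  have "Fbar = [:- a, 1:] * H"
    using bS a by (simp add: H_def prod.remove)
  then have "poly (pderiv Fbar) a = poly (pderiv ([:- a, 1:] * H)) a"
    by (simp only:)
  also have "\<dots> = poly H a"
    by (simp add: pderiv_mult pderiv_pCons del: mult_pCons_left)
  finally have "poly (pderiv Fbar) a = poly H a" .
  moreover have "poly H a \<noteq> 0"
    using bS by (auto simp: H_def poly_prod prod_zero_iff)
  ultimately show ?thesis by simp
qed

lemma poly_Fbar_of_int: "poly Fbar (of_int u) = of_int (poly F u)"
  by (simp add: of_int_hom.poly_map_poly)

text \<open>Newton's correction, minus the value divided by the derivative. The derivative is a unit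
  modulo p because the zeros modulo p are simple; inverting it modulo p suffices, since the step
  gains only one power of p.\<close>

lemma newton_step:
  assumes u: "int CARD('p) ^ k dvd poly F u" "k \<ge> 1"
  shows "\<exists>v. v mod int CARD('p) ^ k = u mod int CARD('p) ^ k \<and> int CARD('p) ^ Suc k dvd poly F v"
proof -
  let ?p = "int CARD('p)"
  have zero_iff: "(of_int m :: 'p mod_ring) = 0 \<longleftrightarrow> ?p dvd m" for m
    using of_int_mod_ring_eq_iff[of m 0, where 'p = 'p] by (simp add: dvd_eq_mod_eq_0)
  have "?p dvd poly F u"
    using u by (metis dvd_power dvd_trans not_one_le_zero gr0I)
  then have "poly Fbar (of_int u) = 0"
    by (simp add: poly_Fbar_of_int zero_iff)
  then have "poly (pderiv Fbar) (of_int u) \<noteq> 0"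
    by (rule simple_root)
  moreover have "pderiv Fbar = map_poly of_int (pderiv F)"
    by (intro poly_eqI) (simp add: coeff_pderiv coeff_map_poly)
  ultimately have "\<not> ?p dvd poly (pderiv F) u"
    by (simp add: of_int_hom.poly_map_poly zero_iff)
  moreover have "prime ?p"
    using prime_card[where 'a = 'p] by simp
  ultimately have "coprime (poly (pderiv F) u) ?p"
    using prime_imp_coprime coprime_commute by blast
  then obtain t where t: "[poly (pderiv F) u * t = 1] (mod ?p)"
    using cong_solve_coprime_int by blast
  obtain y where y: "poly F u = ?p ^ k * y"
    using u by blast
  define h where "h = ?p ^ k * (- (y * t))"
  obtain w where w: "poly F (u + h) = poly F u + h * poly (pderiv F) u + h ^ 2 * w"
    using taylor_int by blast
  have "?p dvd 1 - t * poly (pderiv F) u"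
    using t by (simp add: cong_iff_dvd_diff mult.commute dvd_diff_commute)
  then have "?p ^ Suc k dvd ?p ^ k * (y * (1 - t * poly (pderiv F) u))"
    by (simp add: mult.commute mult_dvd_mono)
  moreover have "poly F u + h * poly (pderiv F) u = ?p ^ k * (y * (1 - t * poly (pderiv F) u))"
    by (simp add: y h_def algebra_simps)
  moreover have "?p ^ Suc k dvd h ^ 2 * w"
  proof -
    have "Suc k \<le> k + k" using u by simp
    then have "?p ^ Suc k dvd ?p ^ (k + k)" by (rule le_imp_power_dvd)
    moreover have "h ^ 2 * w = ?p ^ (k + k) * ((y * t) ^ 2 * w)"
      by (simp add: h_def power2_eq_square power_add algebra_simps)
    ultimately show ?thesis by (metis dvd_mult2)
  qed
  ultimately have "?p ^ Suc k dvd poly F (u + h)"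
    unfolding w by (metis dvd_add)
  moreover have "(u + h) mod ?p ^ k = u mod ?p ^ k"
    by (simp add: h_def mod_eq_dvd_iff)
  ultimately show ?thesis by blast
qed

lemma padic_residue_poly:
  "padic_residue k (poly (map_poly of_int P) (x :: 'p padic_int)) = poly P (padic_residue k x) mod int CARD('p) ^ k"
proof (induction P)
  case (pCons a P)
  then show ?case
    by (simp add: of_int_hom.map_poly_pCons_hom padic_residue_add padic_residue_mult
        padic_residue_of_int mod_simps)
qed simp

lemma hensel_lift:
  assumes a: "poly Fbar a = 0"
  shows "\<exists>x :: 'p padic_int. poly (map_poly of_int F) x = 0 \<and> of_int (padic_residue 1 x) = a"
proof -
  let ?p = "int CARD('p)"
  define u0 where "u0 = to_int_mod_ring a"
  have u0: "(of_int u0 :: 'p mod_ring) = a"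
    by (simp add: u0_def of_int_of_int_mod_ring)
  have "?p ^ Suc 0 dvd poly F u0"
    using a of_int_mod_ring_eq_iff[of "poly F u0" 0, where 'p = 'p]
    by (simp add: u0 [symmetric] poly_Fbar_of_int dvd_eq_mod_eq_0)
  then have "\<exists>u :: nat \<Rightarrow> int. \<forall>k. (?p ^ Suc k dvd poly F (u k) \<and> (k = 0 \<longrightarrow> u k = u0)) \<and>
      u (Suc k) mod ?p ^ Suc k = u k mod ?p ^ Suc k"
  proof (intro dependent_nat_choice)
    fix u :: int and k :: nat
    assume "?p ^ Suc k dvd poly F u \<and> (k = 0 \<longrightarrow> u = u0)"
    then obtain v where "v mod ?p ^ Suc k = u mod ?p ^ Suc k" "?p ^ Suc (Suc k) dvd poly F v"
      using newton_step[of "Suc k" u] by auto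
    then show "\<exists>v. (?p ^ Suc (Suc k) dvd poly F v \<and> (Suc k = 0 \<longrightarrow> v = u0)) \<and>
        v mod ?p ^ Suc k = u mod ?p ^ Suc k"
      by auto
  qed auto
  then obtain u where u: "\<And>k. ?p ^ Suc k dvd poly F (u k)" "u 0 = u0"
    "\<And>k. u (Suc k) mod ?p ^ Suc k = u k mod ?p ^ Suc k"
    by metis
  \<comment> \<open>\<open>u k\<close> is a zero modulo \<open>p ^ Suc k\<close>, while component
    \<open>k\<close> of a p-adic integer lives modulo \<open>p ^ k\<close>, hence the shift. For
    \<open>k = 0\<close> the modulus is 1 and the truncated subtraction does no harm.\<close>
  define r where "r k = u (k - 1) mod ?p ^ k" for k
  have "r (Suc k) mod ?p ^ k = r k" for k
  proof (cases k)
    case (Suc l)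
    have "r (Suc k) mod ?p ^ k = u (Suc l) mod ?p ^ Suc l"
      by (simp add: r_def Suc mod_mod_cancel)
    also have "\<dots> = u l mod ?p ^ Suc l"
      by (rule u(3))
    also have "\<dots> = r k"
      by (simp add: r_def Suc)
    finally show ?thesis .
  qed (simp add: r_def)
  then have r: "r \<in> {x. \<forall>k. x (Suc k) mod ?p ^ k = x k}" by simp
  define x :: "'p padic_int" where "x = Abs_padic_int r"
  have x: "padic_residue k x = r k" for k
    using Abs_padic_int_inverse[OF r] by (simp add: x_def padic_residue.rep_eq)
  have "padic_residue k (poly (map_poly of_int F) x) = 0" for k
  proof (cases k)
    case (Suc l)
    have "poly F (r k) mod ?p ^ k = poly F (u l) mod ?p ^ k"
      unfolding r_def Suc diff_Suc_1 cong_def [symmetric] by (rule cong_poly_int) (simp add: cong_def)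
    then show ?thesis
      using u(1)[of l] by (simp add: padic_residue_poly x Suc dvd_eq_mod_eq_0)
  qed (simp add: padic_residue_poly)
  then have "poly (map_poly of_int F) x = 0"
    by (intro padic_int_eqI) simp
  moreover have "(of_int (padic_residue 1 x) :: 'p mod_ring) = of_int u0"
    unfolding of_int_mod_ring_eq_iff by (simp add: x r_def u(2))
  ultimately show ?thesis
    using u0 by auto
qed

lemma padic_zeros_exist: "\<exists>x :: nat \<Rightarrow> 'p padic_int. padic_zeros f n x"
proof -
  obtain a S where aS: "a \<noteq> 0" "finite S" "card S = n" "Fbar = smult a (\<Prod>s\<in>S. [:- s, 1:])"
    using split by (auto simp: splits_distinct_def)
  then have roots: "{a. poly Fbar a = 0} = S"
    by (auto simp: poly_prod prod_zero_iff)
  obtain b where b: "bij_betw b {1..n} S"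
    using ex_bij_betw_nat_finite_1[OF aS(2)] aS(3) by auto
  have "\<forall>j\<in>{1..n}. \<exists>x :: 'p padic_int. poly (map_poly of_int F) x = 0 \<and> of_int (padic_residue 1 x) = b j"
  proof
    fix j assume "j \<in> {1..n}"
    then have "b j \<in> S" by (rule bij_betwE[OF b, rule_format])
    then show "\<exists>x :: 'p padic_int. poly (map_poly of_int F) x = 0 \<and> of_int (padic_residue 1 x) = b j"
      unfolding roots [symmetric] by (intro hensel_lift) simp
  qed
  then obtain x :: "nat \<Rightarrow> 'p padic_int"
    where x: "\<And>j. j \<in> {1..n} \<Longrightarrow> poly (map_poly of_int F) (x j) = 0 \<and> of_int (padic_residue 1 (x j)) = b j"
    by metis
  interpret h: inj_comm_ring_hom "to_fract :: 'p padic_int \<Rightarrow> 'p padic"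
    by unfold_locales auto
  have "inj_on x {1..n}"
  proof (rule inj_onI)
    fix i j assume ij: "i \<in> {1..n}" "j \<in> {1..n}" "x i = x j"
    then have "b i = b j"
      using x by metis
    then show "i = j"
      using inj_onD[OF bij_betw_imp_inj_on[OF b] _ ij(1,2)] by blast
  qed
  moreover have "poly (map_poly of_rat f) (to_fract (x j)) = 0" if "j \<in> {1..n}" for j
  proof -
    have "map_poly to_fract (map_poly of_int F :: 'p padic_int poly) = map_poly of_int F"
      by (intro poly_eqI) (simp add: coeff_map_poly to_fract_of_int)
    then have "poly (map_poly of_int F) (to_fract (x j)) = to_fract (poly (map_poly of_int F) (x j))"
      by (metis h.poly_map_poly)
    then show ?thesis
      using x[OF that] c_nz by (simp add: F_over)
  qed
  ultimately show ?thesis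
    by (auto simp: padic_zeros_def)
qed

end

section \<open>The tower of zeros and its Galois group\<close>

text \<open>Keeps the simplifier from rewriting the index sets \<open>{1..n}\<close>.\<close>

declare One_nat_def [simp del]

text \<open>Neither factor vanishes at more of the points than its degree, each point is a root of
  one of them, and the degrees add up to \<open>card I\<close>; so both bounds are attained.\<close>

lemma card_roots_of_split_factor:
  fixes g h :: "'a::field poly"
  assumes fin: "finite I" and inj: "inj_on X I" and gh: "g * h = (\<Prod>j\<in>I. [:- X j, 1:])"
  shows "card {j\<in>I. poly g (X j) = 0} = degree g"
proof -
  have bound: "card {j\<in>I. poly u (X j) = 0} \<le> degree u" if "u \<noteq> 0" for u
  proof -
    have "card {j\<in>I. poly u (X j) = 0} = card (X ` {j\<in>I. poly u (X j) = 0})"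
      by (rule card_image [symmetric]) (use inj in \<open>auto simp: inj_on_def\<close>)
    also have "\<dots> \<le> card {x. poly u x = 0}"
      using that by (intro card_mono poly_roots_finite) auto
    also have "\<dots> \<le> degree u"
      using that by (rule card_poly_roots_bound)
    finally show ?thesis .
  qed
  have "(\<Prod>j\<in>I. [:- X j, 1:]) \<noteq> 0"
    using fin by (auto simp: prod_zero_iff)
  then have nz: "g \<noteq> 0" "h \<noteq> 0"
    using gh by auto
  have deg: "degree g + degree h = card I"
    using nz gh degree_mult_eq[of g h] by (simp add: degree_prod_sum_eq)
  have "poly (g * h) (X j) = 0" if "j \<in> I" for j
    unfolding gh using that fin by (auto simp: poly_prod)
  then have "I = {j\<in>I. poly g (X j) = 0} \<union> {j\<in>I. poly h (X j) = 0}"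
    by auto
  then have "card I \<le> card {j\<in>I. poly g (X j) = 0} + card {j\<in>I. poly h (X j) = 0}"
    by (metis card_Un_le)
  with bound[OF nz(1)] bound[OF nz(2)] deg show ?thesis by linarith
qed

text \<open>Both sides have degree below \<open>card I\<close> and the same values at the
  \<open>card I\<close> nodes: \<open>Z ^ e\<close> is its own Lagrange interpolation
  polynomial.\<close>

lemma lagrange_interpolation_monom:
  fixes X :: "'b \<Rightarrow> 'a::field"
  assumes fin: "finite I" and inj: "inj_on X I" and e: "e < card I"
  shows "(\<Sum>s\<in>I. smult (X s ^ e) (\<Prod>r\<in>I - {s}. smult (inverse (X s - X r)) [:- X r, 1:])) = monom 1 e"
    (is "?p = _")
proof (rule poly_eqI_degree)
  have "degree (smult (X s ^ e) (\<Prod>r\<in>I - {s}. smult (inverse (X s - X r)) [:- X r, 1:])) \<le> card I - 1"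
    if "s \<in> I" for s
  proof -
    have "degree (smult (X s ^ e) (\<Prod>r\<in>I - {s}. smult (inverse (X s - X r)) [:- X r, 1:]))
        \<le> degree (\<Prod>r\<in>I - {s}. smult (inverse (X s - X r)) [:- X r, 1:])"
      by (rule degree_smult_le)
    also have "\<dots> \<le> (\<Sum>r\<in>I - {s}. degree (smult (inverse (X s - X r)) [:- X r, 1:]))"
      using fin by (intro order.trans[OF degree_prod_sum_le]) (auto simp: o_def)
    also have "\<dots> \<le> (\<Sum>r\<in>I - {s}. 1)"
      by (intro sum_mono) (auto intro: order.trans[OF degree_smult_le])
    finally show ?thesis using that fin by simp
  qed
  then have "degree ?p \<le> card I - 1"
    by (intro degree_sum_le[OF fin])
  then show "degree ?p < card (X ` I)"
    using e by (simp add: card_image[OF inj])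
  show "degree (monom 1 e :: 'a poly) < card (X ` I)"
    using e by (simp add: card_image[OF inj] degree_monom_eq)
next
  fix x assume "x \<in> X ` I"
  then obtain j where j: "j \<in> I" "x = X j" by blast
  have *: "poly (smult (X s ^ e) (\<Prod>r\<in>I - {s}. smult (inverse (X s - X r)) [:- X r, 1:])) x
      = (if s = j then X j ^ e else 0)" if s: "s \<in> I" for s
  proof (cases "s = j")
    case True
    have "X j - X r \<noteq> 0" if "r \<in> I - {j}" for r
      using that j inj by (auto simp: inj_on_def)
    then have "(\<Prod>r\<in>I - {j}. inverse (X j - X r) * (X j - X r)) = 1"
      by (intro prod.neutral) auto
    then show ?thesis
      using True j by (simp add: poly_prod algebra_simps)
  next
    case False
    then have "(\<Prod>r\<in>I - {s}. poly (smult (inverse (X s - X r)) [:- X r, 1:]) (X j)) = 0"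
      using j fin by (intro prod_zero bexI[of _ j]) auto
    then show ?thesis
      using False j by (simp add: poly_prod)
  qed
  have "poly ?p x = (\<Sum>s\<in>I. if s = j then X j ^ e else 0)"
    unfolding poly_sum by (intro sum.cong refl *)
  also have "\<dots> = x ^ e"
    using j fin by simp
  finally show "poly ?p x = poly (monom 1 e) x"
    by (simp add: poly_monom)
qed

section \<open>Index sets of the monomials and the tree of tuples\<close>

lemma sum_tower_idx_Suc:
  "sum F (tower_idx X (Suc i)) = (\<Sum>k\<in>tower_idx X i. \<Sum>m\<in>{1..tower_deg X (Suc i)}. F (k(Suc i := m)))"
proof -
  have "(\<Sum>k\<in>tower_idx X i. \<Sum>m\<in>{1..tower_deg X (Suc i)}. F (k(Suc i := m)))
      = (\<Sum>(k, m)\<in>tower_idx X i \<times> {1..tower_deg X (Suc i)}. F (k(Suc i := m)))"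
    by (rule sum.cartesian_product)
  also have "\<dots> = sum F (tower_idx X (Suc i))"
    by (rule sum.reindex_bij_witness[of _ "\<lambda>k. (restrict k {1..i}, k (Suc i))" "\<lambda>(k, m). k(Suc i := m)"])
      (auto simp: tower_idx_def PiE_iff extensional_def fun_eq_iff le_Suc_eq)
  finally show ?thesis by simp
qed

lemma finite_tower_idx [simp]: "finite (tower_idx X i)"
  by (auto simp: tower_idx_def intro!: finite_PiE)

lemma tower_idx_0: "tower_idx X 0 = {\<lambda>_. undefined}"
  by (simp add: tower_idx_def)

lemma tower_idx_upd:
  "k \<in> tower_idx X i \<Longrightarrow> m \<in> {1..tower_deg X (Suc i)} \<Longrightarrow> k(Suc i := m) \<in> tower_idx X (Suc i)"
  by (auto simp: tower_idx_def PiE_iff extensional_def le_Suc_eq)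

lemma tower_idx_SucE:
  assumes "k \<in> tower_idx X (Suc i)"
  obtains k' m where "k' \<in> tower_idx X i" "m \<in> {1..tower_deg X (Suc i)}" "k = k'(Suc i := m)"
proof
  show "restrict k {1..i} \<in> tower_idx X i" "k (Suc i) \<in> {1..tower_deg X (Suc i)}"
    "k = (restrict k {1..i})(Suc i := k (Suc i))"
    using assms by (auto simp: tower_idx_def PiE_iff extensional_def fun_eq_iff le_Suc_eq)
qed

text \<open>The children of a node of the tree. Only the values of \<open>\<rho>\<close> below
  \<open>j\<close> enter, and \<open>\<rho> j\<close> itself is not removed, in contrast to
  \<open>residue_siblings\<close>.\<close>

definition siblings :: "(nat \<Rightarrow> nat) set \<Rightarrow> nat \<Rightarrow> (nat \<Rightarrow> nat) \<Rightarrow> nat set" where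
  "siblings G j \<rho> = {\<sigma> j | \<sigma>. \<sigma> \<in> G \<and> (\<forall>l\<in>{1..<j}. \<sigma> l = \<rho> l)}"

lemma siblings_cong: "(\<And>l. l \<in> {1..<j} \<Longrightarrow> \<rho> l = \<rho>' l) \<Longrightarrow> siblings G j \<rho> = siblings G j \<rho>'"
  by (auto simp: siblings_def)

text \<open>The nodes of level \<open>i\<close>. Restriction identifies permutations with the same
  first \<open>i\<close> values, so for a group the prefixes stand for the left cosets of the
  stabiliser.\<close>

definition prefixes :: "(nat \<Rightarrow> nat) set \<Rightarrow> nat \<Rightarrow> (nat \<Rightarrow> nat) set" where
  "prefixes G i = (\<lambda>\<sigma>. restrict \<sigma> {1..i}) ` G"

lemma sum_prefixes_Suc:
  assumes fin: "finite (prefixes G i)" "\<And>t. t \<in> prefixes G i \<Longrightarrow> finite (siblings G (Suc i) t)"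
  shows "sum F (prefixes G (Suc i)) = (\<Sum>t\<in>prefixes G i. \<Sum>s\<in>siblings G (Suc i) t. F (t(Suc i := s)))"
proof -
  have upd: "(restrict \<sigma> {1..i})(Suc i := \<sigma> (Suc i)) = restrict \<sigma> {1..Suc i}" for \<sigma> :: "nat \<Rightarrow> nat"
    by (auto simp: fun_eq_iff le_Suc_eq)
  have "(\<Sum>t\<in>prefixes G i. \<Sum>s\<in>siblings G (Suc i) t. F (t(Suc i := s)))
      = (\<Sum>(t, s)\<in>Sigma (prefixes G i) (siblings G (Suc i)). F (t(Suc i := s)))"
    by (rule sum.Sigma) (use fin in auto)
  also have "\<dots> = sum F (prefixes G (Suc i))"
  proof (rule sum.reindex_bij_witness[of _ "\<lambda>t. (restrict t {1..i}, t (Suc i))" "\<lambda>(t, s). t(Suc i := s)"])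
    fix a assume "a \<in> Sigma (prefixes G i) (siblings G (Suc i))"
    then obtain \<tau> \<sigma> where "\<sigma> \<in> G" and a: "a = (restrict \<tau> {1..i}, \<sigma> (Suc i))"
      and eq: "\<forall>l\<in>{1..<Suc i}. \<sigma> l = restrict \<tau> {1..i} l"
      by (auto simp: prefixes_def siblings_def)
    \<comment> \<open>The permutation that realises the child also realises the parent, so a single
      \<open>\<sigma>\<close> serves for both components.\<close>
    from eq have "restrict \<tau> {1..i} = restrict \<sigma> {1..i}"
      by (auto simp: fun_eq_iff)
    with a have a': "a = (restrict \<sigma> {1..i}, \<sigma> (Suc i))" by simp
    then have upd': "(case a of (t, s) \<Rightarrow> t(Suc i := s)) = restrict \<sigma> {1..Suc i}"
      by (simp only: prod.case upd)
    show "(case a of (t, s) \<Rightarrow> t(Suc i := s)) \<in> prefixes G (Suc i)"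
      unfolding upd' prefixes_def using \<open>\<sigma> \<in> G\<close> by (rule imageI)
    show "(restrict (case a of (t, s) \<Rightarrow> t(Suc i := s)) {1..i}, (case a of (t, s) \<Rightarrow> t(Suc i := s)) (Suc i)) = a"
      unfolding upd' unfolding a' by (auto simp: fun_eq_iff)
  next
    fix b assume "b \<in> prefixes G (Suc i)"
    then obtain \<sigma> where \<sigma>: "\<sigma> \<in> G" "b = restrict \<sigma> {1..Suc i}"
      by (auto simp: prefixes_def)
    have r: "restrict (restrict \<sigma> {1..Suc i}) {1..i} = restrict \<sigma> {1..i}"
      by (auto simp: fun_eq_iff)
    show "(case (restrict b {1..i}, b (Suc i)) of (t, s) \<Rightarrow> t(Suc i := s)) = b"
      using \<sigma> by (simp add: r upd)
    show "(restrict b {1..i}, b (Suc i)) \<in> Sigma (prefixes G i) (siblings G (Suc i))"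
      using \<sigma> by (auto simp: r prefixes_def siblings_def)
  qed auto
  finally show ?thesis by simp
qed


section \<open>Embeddings and Galois group of the field generated by the zeros\<close>

locale root_tower =
  fixes f :: "rat poly" and n :: nat and X :: "nat \<Rightarrow> 'a::field_char_0"
  assumes inj: "inj_on X {1..n}"
    and split: "map_poly of_rat f = (\<Prod>j\<in>{1..n}. [:- X j, 1:])"
begin

text \<open>The index is shifted: \<open>K j\<close> is generated by the zeros before
  \<open>X j\<close>, so it is the field over which \<open>tower_poly X j\<close> is the minimal
  polynomial.\<close>

abbreviation "K j \<equiv> rat_adjoin (X ` {1..<j})"
abbreviation "L \<equiv> rat_adjoin (X ` {1..n})"
abbreviation "d \<equiv> tower_deg X"
abbreviation "G \<equiv> galois_perms n X"

lemmas subfield_K = subfield_rat_adjoin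

lemma K_Suc_n: "K (Suc n) = L"
  by (simp add: atLeastLessThanSuc_atLeastAtMost)

lemma K_Suc: "1 \<le> j \<Longrightarrow> K (Suc j) = rat_adjoin (insert (X j) (X ` {1..<j}))"
  by (simp add: atLeastLessThanSuc)

lemma K_subset_L: "j \<le> Suc n \<Longrightarrow> K j \<subseteq> L"
  by (intro rat_adjoin_mono image_mono) auto

lemma X_in_L: "j \<in> {1..n} \<Longrightarrow> X j \<in> L"
  using rat_adjoin_superset by blast

lemma X_in_K: "l \<in> {1..<j} \<Longrightarrow> X l \<in> K j"
  using rat_adjoin_superset by blast

lemma root_iff: "poly (map_poly of_rat f) y = 0 \<longleftrightarrow> y \<in> X ` {1..n}"
  unfolding split by (auto simp: poly_prod prod_zero_iff)

lemma f_over: "is_subfield k \<Longrightarrow> map_poly of_rat f \<in> polys_over k"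
  by (auto simp: polys_over_def coeff_map_poly intro: subfield_of_rat)

lemma algebraic_root: "j \<in> {1..n} \<Longrightarrow> algebraic_over (K j) (X j)"
  unfolding algebraic_over_def
  by (intro bexI[of _ "map_poly of_rat f"] conjI f_over subfield_K)
    (simp add: split prod_zero_iff, simp add: root_iff)

lemma
  assumes "j \<in> {1..n}"
  shows tower_poly_over: "tower_poly X j \<in> polys_over (K j)"
    and poly_tower_poly: "poly (tower_poly X j) (X j) = 0"
    and lead_coeff_tower_poly: "lead_coeff (tower_poly X j) = 1"
    and tower_deg_pos: "d j > 0"
  unfolding tower_poly_def tower_deg_def
  using algebraic_root[OF assms] subfield_K
  by (auto intro: min_poly_over poly_min_poly lead_coeff_min_poly degree_min_poly_pos)

lemma tower_poly_divides:
  "j \<in> {1..n} \<Longrightarrow> \<exists>q\<in>polys_over (K j). map_poly of_rat f = q * tower_poly X j"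
  unfolding tower_poly_def
  by (intro min_poly_divides subfield_K algebraic_root f_over) (auto simp: root_iff)

text \<open>\<open>\<phi>\<close> fixes the rational coefficients of \<open>f\<close>, so a
  factorisation of \<open>f\<close> over \<open>K j\<close> is carried to one over the target field;
  in particular a conjugate of \<open>tower_poly X j\<close> has only zeros of \<open>f\<close> as
  roots.\<close>

lemma hom_tower_poly_divides:
  fixes \<phi> :: "'a \<Rightarrow> 'b::field_char_0"
  assumes "hom_on (K j) \<phi>" "j \<in> {1..n}"
  shows "\<exists>q. map_poly of_rat f = q * map_poly \<phi> (tower_poly X j)"
proof -
  note S = subfield_K[of "X ` {1..<j}"] assms(1)
  obtain q where q: "q \<in> polys_over (K j)" "map_poly of_rat f = q * tower_poly X j"
    using tower_poly_divides assms by blast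
  have "map_poly of_rat f = map_poly \<phi> (q * tower_poly X j)"
    unfolding q(2) [symmetric] by (simp add: hom_on_map_poly_of_rat[OF S])
  also have "\<dots> = map_poly \<phi> q * map_poly \<phi> (tower_poly X j)"
    by (intro map_poly_hom_mult[OF S] q tower_poly_over assms)
  finally show ?thesis by blast
qed

text \<open>Adjoins the remaining zeros one after the other. \<open>root\<close> is the only demand
  on the target field: each conjugate of a minimal polynomial divides \<open>f\<close>, so it
  suffices that nonconstant factors of \<open>f\<close> have roots. This covers both
  \<open>'a\<close>, where \<open>f\<close> splits, and the complex numbers.\<close>

lemma hom_on_extend_L:
  fixes \<phi> :: "'a \<Rightarrow> 'b::field_char_0"
  assumes root: "\<And>g h. (map_poly of_rat f :: 'b poly) = h * g \<Longrightarrow> degree g > 0 \<Longrightarrow> \<exists>w. poly g w = 0"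
    and hom: "hom_on (K j) \<phi>" and j: "1 \<le> j" "j \<le> Suc n"
  shows "\<exists>\<psi>. hom_on L \<psi> \<and> (\<forall>y\<in>K j. \<psi> y = \<phi> y)"
proof -
  have "\<forall>\<phi> :: 'a \<Rightarrow> 'b. 1 \<le> j \<longrightarrow> hom_on (K j) \<phi> \<longrightarrow> (\<exists>\<psi>. hom_on L \<psi> \<and> (\<forall>y\<in>K j. \<psi> y = \<phi> y))"
    using j(2)
  proof (induction rule: inc_induct)
    case base
    show ?case unfolding K_Suc_n by blast
  next
    case (step m)
    show ?case
    proof (intro allI impI)
      fix \<phi> :: "'a \<Rightarrow> 'b" assume m: "1 \<le> m" and hom: "hom_on (K m) \<phi>"
      have mn: "m \<in> {1..n}" using step m by auto
      obtain q where q: "map_poly of_rat f = q * map_poly \<phi> (tower_poly X m)"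
        using hom_tower_poly_divides[OF hom mn] by blast
      have "degree (map_poly \<phi> (tower_poly X m)) > 0"
        using degree_map_poly_hom[OF subfield_K hom tower_poly_over[OF mn]] tower_deg_pos[OF mn]
        by (simp add: tower_deg_def)
      then obtain w where "poly (map_poly \<phi> (tower_poly X m)) w = 0"
        using root q by blast
      then obtain \<chi> where \<chi>: "hom_on (K (Suc m)) \<chi>" "\<forall>y\<in>K m. \<chi> y = \<phi> y"
        using hom_on_extend[OF hom algebraic_root[OF mn], of w] K_Suc[OF m]
        unfolding tower_poly_def by auto
      then obtain \<psi> where "hom_on L \<psi>" "\<forall>y\<in>K (Suc m). \<psi> y = \<chi> y"
        using step by auto
      moreover have "K m \<subseteq> K (Suc m)"
        by (intro rat_adjoin_mono image_mono) auto
      ultimately show "\<exists>\<psi>. hom_on L \<psi> \<and> (\<forall>y\<in>K m. \<psi> y = \<phi> y)"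
        using \<chi> by (intro exI[of _ \<psi>]) auto
    qed
  qed
  with hom j show ?thesis by blast
qed

lemma split_factor_has_root:
  fixes g h :: "'a poly"
  assumes "map_poly of_rat f = h * g" "degree g > 0"
  shows "\<exists>w. poly g w = 0"
proof -
  have "card {j\<in>{1..n}. poly g (X j) = 0} = degree g"
    using assms inj split by (intro card_roots_of_split_factor[where h = h]) (auto simp: mult.commute)
  with assms(2) show ?thesis
    by (metis (mono_tags, lifting) card.empty empty_Collect_eq less_irrefl)
qed

lemma hom_image_L:
  assumes "hom_on L \<phi>" "\<phi> ` X ` {1..n} = X ` {1..n}"
  shows "\<phi> ` L = L"
proof
  note S = subfield_K[of "X ` {1..n}"] assms(1)
  have "is_subfield {y\<in>L. \<phi> y \<in> L}"
    by (simp add: is_subfield_def hom_on_0[OF S] hom_on_1[OF S] hom_on_add[OF S]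
        hom_on_mult[OF S] hom_on_minus[OF S] hom_on_inverse[OF S] subfield_closed[OF S(1)])
  moreover have "X ` {1..n} \<subseteq> {y\<in>L. \<phi> y \<in> L}"
  proof
    fix y assume y: "y \<in> X ` {1..n}"
    then have "\<phi> y \<in> X ` {1..n}"
      using assms(2) by (metis imageI)
    then show "y \<in> {y\<in>L. \<phi> y \<in> L}"
      using y rat_adjoin_superset by blast
  qed
  ultimately have "L \<subseteq> {y\<in>L. \<phi> y \<in> L}"
    by (rule rat_adjoin_least)
  then show "\<phi> ` L \<subseteq> L" by auto
  have "X ` {1..n} \<subseteq> \<phi> ` L"
    using assms(2) rat_adjoin_superset[of "X ` {1..n}"] by (metis image_mono)
  then show "L \<subseteq> \<phi> ` L"
    by (intro rat_adjoin_least hom_on_image[OF S])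
qed

lemma perm_image_X: "\<sigma> permutes {1..n} \<Longrightarrow> (\<And>j. j \<in> {1..n} \<Longrightarrow> \<phi> (X j) = X (\<sigma> j)) \<Longrightarrow> \<phi> ` X ` {1..n} = X ` {1..n}"
  by (metis (no_types, lifting) image_cong image_image permutes_image)

text \<open>An embedding of \<open>L\<close> that permutes the zeros maps \<open>L\<close> onto
  itself and fixes the rationals, so the conditions in \<open>field_auts\<close> reduce to
  \<open>hom_on\<close>.\<close>

lemma galois_perms_iff:
  "\<sigma> \<in> G \<longleftrightarrow> \<sigma> permutes {1..n} \<and> (\<exists>\<phi>. hom_on L \<phi> \<and> (\<forall>j\<in>{1..n}. \<phi> (X j) = X (\<sigma> j)))"
proof
  assume "\<sigma> \<in> G"
  then obtain \<phi> where "\<sigma> permutes {1..n}" and \<phi>: "\<phi> \<in> field_auts L" "\<forall>j\<in>{1..n}. \<phi> (X j) = X (\<sigma> j)"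
    by (auto simp: galois_perms_def)
  moreover have "\<phi> (of_rat 1) = of_rat 1"
    using \<phi>(1) unfolding field_auts_def by blast
  then have "hom_on L \<phi>"
    using \<phi>(1) by (auto simp: hom_on_def field_auts_def)
  ultimately show "\<sigma> permutes {1..n} \<and> (\<exists>\<phi>. hom_on L \<phi> \<and> (\<forall>j\<in>{1..n}. \<phi> (X j) = X (\<sigma> j)))"
    by blast
next
  assume "\<sigma> permutes {1..n} \<and> (\<exists>\<phi>. hom_on L \<phi> \<and> (\<forall>j\<in>{1..n}. \<phi> (X j) = X (\<sigma> j)))"
  then obtain \<phi> where \<sigma>: "\<sigma> permutes {1..n}" and \<phi>: "hom_on L \<phi>" "\<forall>j\<in>{1..n}. \<phi> (X j) = X (\<sigma> j)"
    by blast
  note S = subfield_K[of "X ` {1..n}"] \<phi>(1)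
  have "\<phi> ` L = L"
    using \<phi> \<sigma> by (intro hom_image_L perm_image_X) auto
  moreover have "inj_on \<phi> L"
    using hom_on_eq_iff[OF S] by (auto simp: inj_on_def)
  ultimately have "\<phi> \<in> field_auts L"
    using \<phi>(1) hom_on_of_rat[OF S] by (auto simp: field_auts_def bij_betw_def hom_on_def)
  with \<sigma> \<phi>(2) show "\<sigma> \<in> G"
    by (auto simp: galois_perms_def)
qed

lemma perm_of_hom:
  assumes "hom_on L \<phi>"
  shows "\<exists>\<sigma>\<in>G. \<forall>j\<in>{1..n}. \<phi> (X j) = X (\<sigma> j)"
proof -
  note S = subfield_K[of "X ` {1..n}"] assms
  have "\<phi> (X j) \<in> X ` {1..n}" if j: "j \<in> {1..n}" for j
  proof -
    have "poly (map_poly \<phi> (map_poly of_rat f)) (\<phi> (X j)) = \<phi> (poly (map_poly of_rat f) (X j))"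
      using j by (intro poly_map_poly_hom[OF S] f_over subfield_K X_in_L)
    also have "\<dots> = 0"
      using j root_iff[of "X j"] by (simp add: hom_on_0[OF S])
    finally show ?thesis
      by (simp add: hom_on_map_poly_of_rat[OF S] root_iff)
  qed
  then have "\<forall>j\<in>{1..n}. \<exists>s\<in>{1..n}. \<phi> (X j) = X s" by blast
  then obtain s where s: "\<And>j. j \<in> {1..n} \<Longrightarrow> s j \<in> {1..n} \<and> \<phi> (X j) = X (s j)"
    by metis
  define \<sigma> where "\<sigma> j = (if j \<in> {1..n} then s j else j)" for j
  have "inj_on \<sigma> {1..n}"
  proof (rule inj_onI)
    fix i j assume ij: "i \<in> {1..n}" "j \<in> {1..n}" "\<sigma> i = \<sigma> j"
    then have "\<phi> (X i) = \<phi> (X j)"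
      using s unfolding \<sigma>_def by metis
    then show "i = j"
      using hom_on_eq_iff[OF S X_in_L[OF ij(1)] X_in_L[OF ij(2)]] inj_onD[OF inj _ ij(1,2)] by blast
  qed
  moreover have "\<sigma> ` {1..n} \<subseteq> {1..n}"
    using s by (auto simp: \<sigma>_def)
  ultimately have "bij_betw \<sigma> {1..n} {1..n}"
    by (simp add: bij_betw_def endo_inj_surj)
  then have "\<sigma> permutes {1..n}"
    by (rule bij_imp_permutes) (auto simp: \<sigma>_def)
  then have "\<sigma> \<in> G"
    unfolding galois_perms_iff using assms s by (auto simp: \<sigma>_def)
  then show ?thesis
    using s by (intro bexI[of _ \<sigma>]) (auto simp: \<sigma>_def)
qed

definition aut :: "(nat \<Rightarrow> nat) \<Rightarrow> 'a \<Rightarrow> 'a" where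
  "aut \<sigma> = (SOME \<phi>. hom_on L \<phi> \<and> (\<forall>j\<in>{1..n}. \<phi> (X j) = X (\<sigma> j)))"

lemma
  assumes "\<sigma> \<in> G"
  shows hom_aut: "hom_on L (aut \<sigma>)"
    and aut_X: "j \<in> {1..n} \<Longrightarrow> aut \<sigma> (X j) = X (\<sigma> j)"
    and perm_G: "\<sigma> permutes {1..n}"
  using someI_ex[of "\<lambda>\<phi>. hom_on L \<phi> \<and> (\<forall>j\<in>{1..n}. \<phi> (X j) = X (\<sigma> j))"] assms
  unfolding galois_perms_iff aut_def by auto

lemma G_in: "\<sigma> \<in> G \<Longrightarrow> j \<in> {1..n} \<Longrightarrow> \<sigma> j \<in> {1..n}"
  by (meson perm_G permutes_in_image)

lemma aut_image:
  assumes "\<sigma> \<in> G"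
  shows "aut \<sigma> ` L = L"
  using perm_image_X[OF perm_G[OF assms] aut_X[OF assms]] by (intro hom_image_L hom_aut assms)

lemma id_in_G: "id \<in> G"
  unfolding galois_perms_iff by (auto simp: permutes_id hom_on_def intro!: exI[of _ id])

lemma comp_in_G:
  assumes "\<sigma> \<in> G" "\<tau> \<in> G"
  shows "\<sigma> \<circ> \<tau> \<in> G"
  unfolding galois_perms_iff
proof (intro conjI exI[of _ "aut \<sigma> \<circ> aut \<tau>"] ballI)
  show "\<sigma> \<circ> \<tau> permutes {1..n}"
    by (rule permutes_compose[OF perm_G[OF assms(2)] perm_G[OF assms(1)]])
  note S = subfield_K[of "X ` {1..n}"]
  show "hom_on L (aut \<sigma> \<circ> aut \<tau>)"
    using aut_image[OF assms(2)]
    by (auto simp: hom_on_def hom_on_1[OF S hom_aut] assms hom_on_add[OF S hom_aut]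
        hom_on_mult[OF S hom_aut] image_subset_iff set_eq_subset)
  show "(aut \<sigma> \<circ> aut \<tau>) (X j) = X ((\<sigma> \<circ> \<tau>) j)" if "j \<in> {1..n}" for j
    using aut_X[OF assms(2) that] aut_X[OF assms(1) G_in[OF assms(2) that]] by simp
qed

lemma inv_in_G:
  assumes "\<sigma> \<in> G"
  shows "inv_into UNIV \<sigma> \<in> G"
  unfolding galois_perms_iff
proof (intro conjI exI[of _ "inv_into L (aut \<sigma>)"] ballI)
  note S = subfield_K[of "X ` {1..n}"]
  note S' = S hom_aut[OF assms]
  have inj: "inj_on (aut \<sigma>) L"
    using hom_on_eq_iff[OF S'] by (auto simp: inj_on_def)
  have inv_eq: "inv_into L (aut \<sigma>) y = x" if "x \<in> L" "aut \<sigma> x = y" for x y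
    using inv_into_f_f[OF inj that(1)] that(2) by simp
  show "inv_into UNIV \<sigma> permutes {1..n}"
    by (rule permutes_inv[OF perm_G[OF assms]])
  show "hom_on L (inv_into L (aut \<sigma>))"
    unfolding hom_on_def
  proof (intro conjI ballI)
    show "inv_into L (aut \<sigma>) 1 = 1"
      by (intro inv_eq subfield_1[OF S] hom_on_1[OF S'])
  next
    fix a b assume "a \<in> L" "b \<in> L"
    then have "a \<in> aut \<sigma> ` L" "b \<in> aut \<sigma> ` L"
      by (simp_all only: aut_image[OF assms])
    then obtain u v where uv: "u \<in> L" "v \<in> L" "a = aut \<sigma> u" "b = aut \<sigma> v"
      by (elim imageE)
    have ab: "inv_into L (aut \<sigma>) a = u" "inv_into L (aut \<sigma>) b = v"
      using inv_eq[OF uv(1) uv(3)[symmetric]] inv_eq[OF uv(2) uv(4)[symmetric]] .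
    show "inv_into L (aut \<sigma>) (a + b) = inv_into L (aut \<sigma>) a + inv_into L (aut \<sigma>) b"
      unfolding ab by (rule inv_eq[OF subfield_add[OF S uv(1,2)]]) (simp only: uv(3,4) hom_on_add[OF S' uv(1,2)])
    show "inv_into L (aut \<sigma>) (a * b) = inv_into L (aut \<sigma>) a * inv_into L (aut \<sigma>) b"
      unfolding ab by (rule inv_eq[OF subfield_mult[OF S uv(1,2)]]) (simp only: uv(3,4) hom_on_mult[OF S' uv(1,2)])
  qed
  fix j assume j: "j \<in> {1..n}"
  have j': "inv_into UNIV \<sigma> j \<in> {1..n}"
    using permutes_in_image[OF permutes_inv[OF perm_G[OF assms]]] j by blast
  have "aut \<sigma> (X (inv_into UNIV \<sigma> j)) = X j"
    using aut_X[OF assms j'] permutes_inverses(1)[OF perm_G[OF assms]] by simp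
  then show "inv_into L (aut \<sigma>) (X j) = X (inv_into UNIV \<sigma> j)"
    by (intro inv_eq X_in_L j')
qed

lemma finite_G: "finite G"
  by (rule finite_subset[OF _ finite_permutations[of "{1..n}"]]) (auto simp: perm_G)

lemma aut_eq_on_K:
  assumes "\<sigma> \<in> G" "\<rho> \<in> G" "j \<le> Suc n" "\<And>l. l \<in> {1..<j} \<Longrightarrow> \<sigma> l = \<rho> l" "y \<in> K j"
  shows "aut \<sigma> y = aut \<rho> y"
proof (rule hom_on_rat_adjoin_eqI[OF _ _ _ assms(5)])
  show "hom_on (K j) (aut \<sigma>)" "hom_on (K j) (aut \<rho>)"
    using hom_aut assms K_subset_L[OF assms(3)] hom_on_subset by blast+
  show "aut \<sigma> s = aut \<rho> s" if "s \<in> X ` {1..<j}" for s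
    using that assms(3,4) by (auto simp: aut_X assms(1,2))
qed

text \<open>For the harder inclusion, a root \<open>X s\<close> of the conjugated polynomial allows
  \<open>aut \<rho>\<close> on \<open>K j\<close> to be continued by sending \<open>X j\<close> to
  \<open>X s\<close>, and then to all of \<open>L\<close>. The permutation of this extension agrees
  with \<open>\<rho>\<close> before \<open>j\<close> and takes \<open>j\<close> to
  \<open>s\<close>.\<close>

lemma siblings_eq_roots:
  assumes \<rho>: "\<rho> \<in> G" and j: "j \<in> {1..n}"
  shows "siblings G j \<rho> = {s\<in>{1..n}. poly (map_poly (aut \<rho>) (tower_poly X j)) (X s) = 0}"
proof (intro equalityI subsetI)
  have KL: "K j \<subseteq> L" using j by (intro K_subset_L) auto
  note S = subfield_K[of "X ` {1..n}"]
  have over: "tower_poly X j \<in> polys_over L"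
    using tower_poly_over[OF j] polys_over_mono[OF KL] by blast
  {
    fix s assume "s \<in> siblings G j \<rho>"
    then obtain \<sigma> where \<sigma>: "\<sigma> \<in> G" "\<forall>l\<in>{1..<j}. \<sigma> l = \<rho> l" "s = \<sigma> j"
      by (auto simp: siblings_def)
    have "map_poly (aut \<rho>) (tower_poly X j) = map_poly (aut \<sigma>) (tower_poly X j)"
      using \<sigma> \<rho> j
      by (intro poly_eqI)
        (auto simp: coeff_map_poly_hom[OF S hom_aut]
          intro!: aut_eq_on_K[of _ _ j] polys_overD[OF tower_poly_over])
    moreover have "poly (map_poly (aut \<sigma>) (tower_poly X j)) (X s) = aut \<sigma> (poly (tower_poly X j) (X j))"
      unfolding \<sigma>(3) aut_X[OF \<sigma>(1) j, symmetric]
      by (intro poly_map_poly_hom[OF S hom_aut] \<sigma> over X_in_L j)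
    ultimately show "s \<in> {s\<in>{1..n}. poly (map_poly (aut \<rho>) (tower_poly X j)) (X s) = 0}"
      using \<sigma> j G_in[OF \<sigma>(1) j] by (simp add: poly_tower_poly hom_on_0[OF S hom_aut])
  next
    fix s assume s: "s \<in> {s\<in>{1..n}. poly (map_poly (aut \<rho>) (tower_poly X j)) (X s) = 0}"
    have "hom_on (K j) (aut \<rho>)"
      using hom_aut[OF \<rho>] KL hom_on_subset by blast
    then obtain \<chi> where \<chi>: "hom_on (K (Suc j)) \<chi>" "\<forall>y\<in>K j. \<chi> y = aut \<rho> y" "\<chi> (X j) = X s"
      using hom_on_extend[OF _ algebraic_root[OF j], of "aut \<rho>" "X s"] s j K_Suc[of j]
      unfolding tower_poly_def by auto
    have "\<exists>\<psi>. hom_on L \<psi> \<and> (\<forall>y\<in>K (Suc j). \<psi> y = \<chi> y)"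
      using j \<chi>(1) by (intro hom_on_extend_L split_factor_has_root) auto
    then obtain \<psi> where \<psi>: "hom_on L \<psi>" "\<forall>y\<in>K (Suc j). \<psi> y = \<chi> y"
      by blast
    then obtain \<sigma> where \<sigma>: "\<sigma> \<in> G" "\<forall>l\<in>{1..n}. \<psi> (X l) = X (\<sigma> l)"
      using perm_of_hom by blast
    have "\<sigma> l = \<rho> l" if "l \<in> {1..<j}" for l
    proof -
      have l: "l \<in> {1..n}" using that j by auto
      have "X l \<in> K j" "X l \<in> K (Suc j)" "l \<in> {1..n}"
        using that j by (auto intro!: X_in_K)
      then have "X (\<sigma> l) = X (\<rho> l)"
        using \<sigma> \<psi> \<chi> aut_X[OF \<rho>] by metis
      then show ?thesis
        by (rule inj_onD[OF inj _ G_in[OF \<sigma>(1) l] G_in[OF \<rho> l]])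
    qed
    then have "\<forall>l\<in>{1..<j}. \<sigma> l = \<rho> l" by blast
    moreover have "X (\<sigma> j) = X s"
      using \<sigma> \<psi> \<chi> X_in_K[of j "Suc j"] j by auto
    then have "\<sigma> j = s"
      using s by (intro inj_onD[OF inj _ G_in[OF \<sigma>(1) j]]) auto
    ultimately show "s \<in> siblings G j \<rho>"
      using \<sigma> by (auto simp: siblings_def)
  }
qed

text \<open>The conjugate of \<open>tower_poly X j\<close> keeps its degree and divides
  \<open>f\<close>, which is a product of distinct linear factors, so it has as many roots among the
  zeros as its degree.\<close>

lemma card_siblings:
  assumes \<rho>: "\<rho> \<in> G" and j: "j \<in> {1..n}"
  shows "card (siblings G j \<rho>) = d j"
proof -
  have hom: "hom_on (K j) (aut \<rho>)"
    using j by (intro hom_on_subset[OF hom_aut[OF \<rho>] K_subset_L]) auto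
  obtain q where "map_poly of_rat f = q * map_poly (aut \<rho>) (tower_poly X j)"
    using hom_tower_poly_divides[OF hom j] by blast
  then have "card {s\<in>{1..n}. poly (map_poly (aut \<rho>) (tower_poly X j)) (X s) = 0}
      = degree (map_poly (aut \<rho>) (tower_poly X j))"
    using inj split by (intro card_roots_of_split_factor[where h = q]) (auto simp: mult.commute)
  then show ?thesis
    unfolding siblings_eq_roots[OF assms]
    by (simp add: tower_deg_def degree_map_poly_hom[OF subfield_K hom tower_poly_over[OF j]])
qed

lemma siblings_subset: "j \<in> {1..n} \<Longrightarrow> siblings G j t \<subseteq> {1..n}"
  unfolding siblings_def using G_in by blast

lemma finite_siblings: "finite (siblings G j t)"
  using finite_G by (rule finite_surj[of _ _ "\<lambda>\<sigma>. \<sigma> j"]) (auto simp: siblings_def)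

lemma finite_prefixes: "finite (prefixes G i)"
  by (simp add: prefixes_def finite_G)

lemma sum_prefixes:
  "sum F (prefixes G (Suc i)) = (\<Sum>t\<in>prefixes G i. \<Sum>s\<in>siblings G (Suc i) t. F (t(Suc i := s)))"
  by (intro sum_prefixes_Suc finite_prefixes finite_siblings)

lemma card_siblings_prefix:
  assumes "t \<in> prefixes G i" "Suc i \<in> {1..n}"
  shows "card (siblings G (Suc i) t) = d (Suc i)"
proof -
  obtain \<rho> where "\<rho> \<in> G" "t = restrict \<rho> {1..i}"
    using assms by (auto simp: prefixes_def)
  then have "siblings G (Suc i) t = siblings G (Suc i) \<rho>"
    by (intro siblings_cong) auto
  then show ?thesis
    using card_siblings[OF \<open>\<rho> \<in> G\<close> assms(2)] by simp
qed

lemma card_prefixes: "i \<le> n \<Longrightarrow> card (prefixes G i) = (\<Prod>j\<in>{1..i}. d j)"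
proof (induction i)
  case 0
  have "prefixes G 0 = {\<lambda>_. undefined}"
    using id_in_G by (auto simp: prefixes_def restrict_def)
  then show ?case by simp
next
  case (Suc i)
  have "card (prefixes G (Suc i)) = (\<Sum>t\<in>prefixes G i. card (siblings G (Suc i) t))"
    using sum_prefixes[of "\<lambda>_. 1 :: nat" i] by simp
  also have "\<dots> = card (prefixes G i) * d (Suc i)"
    using Suc.prems by (simp add: card_siblings_prefix)
  finally show ?case using Suc by simp
qed

section \<open>Iterated Lagrange interpolation\<close>

definition basis_poly :: "(nat \<Rightarrow> nat) \<Rightarrow> nat \<Rightarrow> 'a poly" where
  "basis_poly t j = (\<Prod>s\<in>siblings G j t - {t j}. smult (inverse (X (t j) - X s)) [:- X s, 1:])"

lemma basis_poly_cong: "(\<And>l. l \<in> {1..j} \<Longrightarrow> t l = t' l) \<Longrightarrow> j \<ge> 1 \<Longrightarrow> basis_poly t j = basis_poly t' j"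
  unfolding basis_poly_def using siblings_cong[of j t t' G] by simp

text \<open>\<open>lagrange_interpolation_monom\<close> at one node of the tree, read
  coefficientwise: the \<open>basis_poly\<close> are the Lagrange basis for the children of that
  node.\<close>

lemma basis_poly_sum:
  assumes t: "t \<in> prefixes G i" and i: "Suc i \<in> {1..n}" and e: "e < d (Suc i)"
  shows "(\<Sum>s\<in>siblings G (Suc i) t. X s ^ e * coeff (basis_poly (t(Suc i := s)) (Suc i)) m)
    = (if m = e then 1 else 0)"
proof -
  let ?I = "siblings G (Suc i) t"
  have "siblings G (Suc i) (t(Suc i := s)) = ?I" for s
    by (intro siblings_cong) auto
  then have "(\<Sum>s\<in>?I. X s ^ e * coeff (basis_poly (t(Suc i := s)) (Suc i)) m)
      = coeff (\<Sum>s\<in>?I. smult (X s ^ e) (\<Prod>r\<in>?I - {s}. smult (inverse (X s - X r)) [:- X r, 1:])) m"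
    by (simp add: basis_poly_def coeff_sum)
  also have "\<dots> = coeff (monom 1 e) m"
    using card_siblings_prefix[OF t i] e finite_siblings inj_on_subset[OF inj siblings_subset[OF i]]
    by (subst lagrange_interpolation_monom) auto
  finally show ?thesis by simp
qed

text \<open>
  Since the siblings of \<open>t j\<close> depend only on \<open>t 1, \<dots>, t (j - 1)\<close>, the coordinates can be summed out
  one at a time, starting with the last.
\<close>

lemma prefixes_orthogonality:
  assumes "i \<le> n" "\<And>j. j \<in> {1..i} \<Longrightarrow> a j < d j"
  shows "(\<Sum>t\<in>prefixes G i. \<Prod>j\<in>{1..i}. X (t j) ^ a j * coeff (basis_poly t j) (b j))
    = (\<Prod>j\<in>{1..i}. if b j = a j then 1 else 0)"
  using assms
proof (induction i)
  case 0
  have "prefixes G 0 = {\<lambda>_. undefined}"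
    using id_in_G by (auto simp: prefixes_def restrict_def)
  then show ?case by simp
next
  case (Suc i)
  have i: "Suc i \<in> {1..n}" using Suc.prems by simp
  let ?c = "\<lambda>t j. X (t j) ^ a j * coeff (basis_poly t j) (b j)"
  have old: "?c (t(Suc i := s)) j = ?c t j" if "j \<in> {1..i}" for t s j
    using that basis_poly_cong[of j "t(Suc i := s)" t] by auto
  have "(\<Sum>t\<in>prefixes G (Suc i). \<Prod>j\<in>{1..Suc i}. ?c t j)
      = (\<Sum>t\<in>prefixes G i. \<Sum>s\<in>siblings G (Suc i) t. \<Prod>j\<in>{1..Suc i}. ?c (t(Suc i := s)) j)"
    by (rule sum_prefixes)
  also have "\<dots> = (\<Sum>t\<in>prefixes G i. \<Sum>s\<in>siblings G (Suc i) t.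
      (\<Prod>j\<in>{1..i}. ?c t j) * ?c (t(Suc i := s)) (Suc i))"
  proof (intro sum.cong refl)
    fix t s
    have "(\<Prod>j\<in>{1..i}. ?c (t(Suc i := s)) j) = (\<Prod>j\<in>{1..i}. ?c t j)"
      by (intro prod.cong refl old)
    then show "(\<Prod>j\<in>{1..Suc i}. ?c (t(Suc i := s)) j) = (\<Prod>j\<in>{1..i}. ?c t j) * ?c (t(Suc i := s)) (Suc i)"
      by (simp add: prod.nat_ivl_Suc' mult.commute)
  qed
  also have "\<dots> = (\<Sum>t\<in>prefixes G i. (\<Prod>j\<in>{1..i}. ?c t j) *
      (if b (Suc i) = a (Suc i) then 1 else 0))"
    unfolding sum_distrib_left [symmetric]
    using Suc.prems i by (intro sum.cong refl) (simp add: basis_poly_sum)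
  also have "\<dots> = (\<Prod>j\<in>{1..i}. if b j = a j then 1 else 0) * (if b (Suc i) = a (Suc i) then 1 else 0)"
    unfolding sum_distrib_right [symmetric] using Suc by simp
  finally show ?case by (simp add: prod.nat_ivl_Suc' mult.commute)
qed

abbreviation tower_mono :: "(nat \<Rightarrow> 'b::comm_ring_1) \<Rightarrow> nat \<Rightarrow> (nat \<Rightarrow> nat) \<Rightarrow> 'b" where
  "tower_mono Y i k \<equiv> (\<Prod>j\<in>{1..i}. Y j ^ (d j - k j))"

text \<open>\<open>v\<close> holds the values at the leaves, where the same coefficients
  \<open>b\<close> serve for every conjugate. Pairing \<open>v\<close> with the coefficients of the
  basis polynomials annihilates every monomial except the one with index \<open>k\<close>.\<close>

lemma prefix_coefficients:
  assumes i: "i \<le> n"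
    and v: "\<And>\<sigma>. \<sigma> \<in> G \<Longrightarrow> v (restrict \<sigma> {1..i}) = (\<Sum>k\<in>tower_idx X i. b k * tower_mono (\<lambda>j. X (\<sigma> j)) i k)"
    and k: "k \<in> tower_idx X i"
  shows "b k = (\<Sum>t\<in>prefixes G i. v t * (\<Prod>j\<in>{1..i}. coeff (basis_poly t j) (d j - k j)))"
proof -
  let ?c = "\<lambda>t. \<Prod>j\<in>{1..i}. coeff (basis_poly t j) (d j - k j)"
  have v': "v t = (\<Sum>k\<in>tower_idx X i. b k * tower_mono (\<lambda>j. X (t j)) i k)" if "t \<in> prefixes G i" for t
  proof -
    obtain \<sigma> where "\<sigma> \<in> G" "t = restrict \<sigma> {1..i}"
      using \<open>t \<in> prefixes G i\<close> by (auto simp: prefixes_def)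
    then show ?thesis using v[of \<sigma>] by simp
  qed
  have "(\<Sum>t\<in>prefixes G i. v t * ?c t)
      = (\<Sum>t\<in>prefixes G i. \<Sum>k'\<in>tower_idx X i. b k' * (tower_mono (\<lambda>j. X (t j)) i k' * ?c t))"
    by (simp add: v' sum_distrib_right mult.assoc)
  also have "\<dots> = (\<Sum>k'\<in>tower_idx X i. b k' * (\<Sum>t\<in>prefixes G i. tower_mono (\<lambda>j. X (t j)) i k' * ?c t))"
    by (subst sum.swap) (simp add: sum_distrib_left)
  also have "\<dots> = (\<Sum>k'\<in>tower_idx X i. b k' * (if k' = k then 1 else 0))"
  proof (intro sum.cong refl arg_cong2[of _ _ _ _ "(*)"])
    fix k' assume k': "k' \<in> tower_idx X i"
    have "(\<Sum>t\<in>prefixes G i. tower_mono (\<lambda>j. X (t j)) i k' * ?c t)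
        = (\<Prod>j\<in>{1..i}. if d j - k j = d j - k' j then 1 else 0)"
      unfolding prod.distrib [symmetric]
    proof (rule prefixes_orthogonality[OF i])
      fix j assume "j \<in> {1..i}"
      then show "d j - k' j < d j"
        using k' by (force simp: tower_idx_def PiE_iff)
    qed
    also have "\<dots> = (if k' = k then 1 else 0)"
    proof (cases "k' = k")
      case False
      then obtain j where j: "k' j \<noteq> k j" by auto
      then have "j \<in> {1..i}"
        using k k' unfolding tower_idx_def by (metis PiE_arb)
      \<comment> \<open>Both entries are at most \<open>d j\<close>, so truncated subtraction keeps
        different exponents apart.\<close>
      then have "k j \<le> d j" "k' j \<le> d j" using k k' by (auto simp: tower_idx_def PiE_iff)
      with j have "d j - k j \<noteq> d j - k' j" by linarith
      then show ?thesis
        using False \<open>j \<in> {1..i}\<close> by (auto intro!: prod_zero)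
    qed simp
    finally show "(\<Sum>t\<in>prefixes G i. tower_mono (\<lambda>j. X (t j)) i k' * ?c t) = (if k' = k then 1 else 0)" .
  qed
  also have "\<dots> = (\<Sum>k'\<in>tower_idx X i. if k' = k then b k' else 0)"
    by (intro sum.cong refl) simp
  also have "\<dots> = b k"
    using k by simp
  finally show ?thesis by simp
qed

text \<open>The elements of \<open>K (Suc (Suc i))\<close> are polynomials in
  \<open>X (Suc i)\<close> of degree below \<open>d (Suc i)\<close> over \<open>K (Suc i)\<close>,
  and their coefficients expand by induction.\<close>

lemma monomial_expansion:
  assumes "i \<le> n" "y \<in> K (Suc i)"
  shows "\<exists>b. y = (\<Sum>k\<in>tower_idx X i. of_rat (b k) * tower_mono X i k)"
  using assms
proof (induction i arbitrary: y)
  case 0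
  then obtain r where "y = of_rat r"
    by (auto simp: rat_adjoin_empty)
  then show ?case by (intro exI[of _ "\<lambda>_. r"]) (simp add: tower_idx_0)
next
  case (Suc i)
  have i: "Suc i \<in> {1..n}" using Suc.prems by simp
  note alg = algebraic_root[OF i]
  note S = subfield_K[of "X ` {1..<Suc i}"]
  obtain h0 where "h0 \<in> polys_over (K (Suc i))" "y = poly h0 (X (Suc i))"
    using Suc.prems(2) K_Suc[of "Suc i"] rat_adjoin_insert[OF alg] by auto
  then obtain h where h: "h \<in> polys_over (K (Suc i))" "y = poly h (X (Suc i))" "degree h < d (Suc i)"
    using simple_extension_reduce[OF S alg] unfolding tower_deg_def tower_poly_def by metis
  have "\<forall>m. \<exists>b. coeff h (d (Suc i) - m) = (\<Sum>k\<in>tower_idx X i. of_rat (b k) * tower_mono X i k)"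
    using Suc h by (auto intro!: Suc.IH polys_overD)
  then have "\<exists>B. \<forall>m. coeff h (d (Suc i) - m) = (\<Sum>k\<in>tower_idx X i. of_rat (B m k) * tower_mono X i k)"
    by (rule choice)
  then obtain B where B: "\<And>m. coeff h (d (Suc i) - m) = (\<Sum>k\<in>tower_idx X i. of_rat (B m k) * tower_mono X i k)"
    by blast
  \<comment> \<open>Glues the families chosen separately for each power of the last zero into one:
    the last entry of the index selects the power, the rest is passed on.\<close>
  define b where "b k = B (k (Suc i)) (restrict k {1..i})" for k
  have b: "b (k(Suc i := m)) = B m k" if "k \<in> tower_idx X i" for k m
  proof -
    have "restrict (k(Suc i := m)) {1..i} = k"
      using that by (auto simp: tower_idx_def PiE_iff extensional_def fun_eq_iff)
    then show ?thesis by (simp add: b_def)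
  qed
  have tower_mono: "tower_mono X (Suc i) (k(Suc i := m)) = tower_mono X i k * X (Suc i) ^ (d (Suc i) - m)" for k m
  proof -
    have "tower_mono X i (k(Suc i := m)) = tower_mono X i k"
      by (intro prod.cong) auto
    then show ?thesis by (simp add: prod.nat_ivl_Suc' mult.commute)
  qed
  have "y = (\<Sum>e<d (Suc i). coeff h e * X (Suc i) ^ e)"
    unfolding h(2) poly_altdef using h(3)
    by (intro sum.mono_neutral_left) (auto simp: coeff_eq_0 not_le)
  also have "\<dots> = (\<Sum>m\<in>{1..d (Suc i)}. coeff h (d (Suc i) - m) * X (Suc i) ^ (d (Suc i) - m))"
    by (rule sum.reindex_bij_witness[of _ "\<lambda>m. d (Suc i) - m" "\<lambda>e. d (Suc i) - e"]) auto
  also have "\<dots> = (\<Sum>m\<in>{1..d (Suc i)}. \<Sum>k\<in>tower_idx X i.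
      of_rat (b (k(Suc i := m))) * tower_mono X (Suc i) (k(Suc i := m)))"
    by (intro sum.cong refl) (simp add: B sum_distrib_right b tower_mono mult.assoc)
  also have "\<dots> = (\<Sum>k\<in>tower_idx X (Suc i). of_rat (b k) * tower_mono X (Suc i) k)"
    unfolding sum_tower_idx_Suc by (rule sum.swap)
  finally show ?case by blast
qed

lemma mono_in_L: "i \<le> n \<Longrightarrow> tower_mono X i k \<in> L"
  by (intro subfield_prod subfield_power subfield_K X_in_L) auto

lemma hom_expansion:
  fixes \<phi> :: "'a \<Rightarrow> 'b::field_char_0"
  assumes "hom_on L \<phi>" "i \<le> n"
  shows "\<phi> (\<Sum>k\<in>tower_idx X i. of_rat (b k) * tower_mono X i k)
    = (\<Sum>k\<in>tower_idx X i. of_rat (b k) * tower_mono (\<lambda>j. \<phi> (X j)) i k)"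
proof -
  note S = subfield_K[of "X ` {1..n}"]
  note S' = S assms(1)
  have X: "X j \<in> L" if "j \<in> {1..i}" for j
    using that assms(2) by (intro X_in_L) auto
  have "\<phi> (of_rat (b k) * tower_mono X i k) = of_rat (b k) * tower_mono (\<lambda>j. \<phi> (X j)) i k" for k
    using X assms(2) by (simp add: hom_on_mult[OF S'] mono_in_L hom_on_of_rat[OF S'] hom_on_prod[OF S']
        subfield_of_rat[OF S] subfield_power[OF S] hom_on_power[OF S'] del: atLeastAtMost_iff)
  moreover have "of_rat (b k) * tower_mono X i k \<in> L" for k
    using assms(2) S by (intro subfield_mult subfield_of_rat mono_in_L)
  ultimately show ?thesis
    by (simp add: hom_on_sum[OF S'])
qed

lemma aut_expansion:
  assumes "\<sigma> \<in> G" "i \<le> n"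
  shows "aut \<sigma> (\<Sum>k\<in>tower_idx X i. of_rat (b k) * tower_mono X i k)
    = (\<Sum>k\<in>tower_idx X i. of_rat (b k) * tower_mono (\<lambda>j. X (\<sigma> j)) i k)"
proof -
  have "tower_mono (\<lambda>j. aut \<sigma> (X j)) i k = tower_mono (\<lambda>j. X (\<sigma> j)) i k" for k
    using assms by (intro prod.cong refl) (simp add: aut_X)
  then show ?thesis
    using hom_expansion[OF hom_aut[OF assms(1)] assms(2)] by simp
qed

text \<open>Automorphisms carry the vanishing sum to all leaves, so every coefficient is recovered
  from the values 0.\<close>

lemma monomials_independent:
  assumes i: "i \<le> n" and eq: "(\<Sum>k\<in>tower_idx X i. of_rat (b k) * tower_mono X i k) = 0" and k: "k \<in> tower_idx X i"
  shows "b k = 0"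
proof -
  have "0 = (\<Sum>k\<in>tower_idx X i. of_rat (b k) * tower_mono (\<lambda>j. X (\<sigma> j)) i k)" if "\<sigma> \<in> G" for \<sigma>
    using aut_expansion[OF that i, of b] eq hom_on_0[OF subfield_K hom_aut[OF that]] by simp
  then have "of_rat (b k) = (\<Sum>t\<in>prefixes G i. 0 * (\<Prod>j\<in>{1..i}. coeff (basis_poly t j) (d j - k j)))"
    by (intro prefix_coefficients[OF i _ k]) simp
  then show ?thesis by simp
qed

text \<open>A fixed element has the same value \<open>y\<close> at each leaf. Its coefficient at the
  constant monomial is rational, but it is also \<open>y\<close> times the interpolation of 1, that
  is \<open>y\<close>.\<close>

lemma fixed_imp_rational:
  assumes y: "y \<in> L" and fixed: "\<And>\<sigma>. \<sigma> \<in> G \<Longrightarrow> aut \<sigma> y = y"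
  shows "\<exists>r. y = of_rat r"
proof -
  obtain b where b: "y = (\<Sum>k\<in>tower_idx X n. of_rat (b k) * tower_mono X n k)"
    using monomial_expansion[OF order.refl y [folded K_Suc_n]] by blast
  \<comment> \<open>The entry \<open>d j\<close> means exponent 0, so this is the index of the
    monomial 1.\<close>
  define k where "k = (\<lambda>j\<in>{1..n}. d j)"
  have k: "k \<in> tower_idx X n"
    using tower_deg_pos by (auto simp: k_def tower_idx_def One_nat_def Suc_le_eq)
  have "y = (\<Sum>k\<in>tower_idx X n. of_rat (b k) * tower_mono (\<lambda>j. X (\<sigma> j)) n k)" if "\<sigma> \<in> G" for \<sigma>
    using aut_expansion[OF that order.refl, of b] unfolding b [symmetric] fixed[OF that] .
  then have "of_rat (b k) = (\<Sum>t\<in>prefixes G n. y * (\<Prod>j\<in>{1..n}. coeff (basis_poly t j) (d j - k j)))"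
    by (rule prefix_coefficients[OF order.refl _ k])
  also have "\<dots> = y * (\<Sum>t\<in>prefixes G n. \<Prod>j\<in>{1..n}. X (t j) ^ 0 * coeff (basis_poly t j) 0)"
    by (simp add: sum_distrib_left k_def)
  also have "\<dots> = y"
    by (subst prefixes_orthogonality) (auto simp: tower_deg_pos)
  finally show ?thesis by metis
qed

text \<open>Justifies the definite description in \<open>tower_coeffs\<close>: existence comes from
  \<open>monomial_expansion\<close>, uniqueness from \<open>monomials_independent\<close>.\<close>

lemma tower_coeffs_spec:
  assumes i: "i \<in> {1..n}" and m: "m \<in> {1..d i}"
  shows "coeff (tower_poly X i) (d i - m) =
    (\<Sum>k\<in>tower_idx X (i - 1). of_rat (tower_coeffs X i (k(i := m))) * tower_mono X (i - 1) k)"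
proof -
  define i' where "i' = i - 1"
  have i': "i = Suc i'" "i' \<le> n" using i by (auto simp: i'_def)
  let ?P = "\<lambda>b. b \<in> extensional (tower_idx X i) \<and>
     (\<forall>m\<in>{1..d i}. coeff (tower_poly X i) (d i - m) =
        (\<Sum>k\<in>tower_idx X (i - 1).
           of_rat (b (k(i := m))) * (\<Prod>j\<in>{1..<i}. X j ^ (d j - k j))))"
  have ivl: "{1..<i} = {1..i'}" using i' by auto
  have "\<exists>!b. ?P b"
  proof -
    have "\<forall>m. \<exists>b. coeff (tower_poly X i) (d i - m) = (\<Sum>k\<in>tower_idx X i'. of_rat (b k) * tower_mono X i' k)"
      using i' tower_poly_over[OF i] by (auto intro!: monomial_expansion polys_overD)
    then have "\<exists>B. \<forall>m. coeff (tower_poly X i) (d i - m) = (\<Sum>k\<in>tower_idx X i'. of_rat (B m k) * tower_mono X i' k)"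
      by (rule choice)
    then obtain B where B: "\<And>m. coeff (tower_poly X i) (d i - m) = (\<Sum>k\<in>tower_idx X i'. of_rat (B m k) * tower_mono X i' k)"
      by blast
    define b where "b = (\<lambda>k\<in>tower_idx X i. B (k i) (restrict k {1..i'}))"
    have b: "b (k(i := m)) = B m k" if "k \<in> tower_idx X i'" "m \<in> {1..d i}" for k m
    proof -
      have "restrict (k(i := m)) {1..i'} = k"
        using that i' by (auto simp: tower_idx_def PiE_iff extensional_def fun_eq_iff)
      then show ?thesis using tower_idx_upd[of k X i' m] that i' by (simp add: b_def)
    qed
    show ?thesis
    proof (rule ex1I[of _ b])
      show "?P b"
        using b by (auto simp: ivl i'_def [symmetric] B) (simp add: b_def)
    next
      fix b' assume b': "?P b'"
      show "b' = b"
      proof (rule extensionalityI[of _ "tower_idx X i"])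
        show "b' \<in> extensional (tower_idx X i)" "b \<in> extensional (tower_idx X i)"
          using b' by (auto simp: b_def)
        fix k assume "k \<in> tower_idx X i"
        then obtain k' m where k': "k' \<in> tower_idx X i'" "m \<in> {1..d i}" "k = k'(i := m)"
          unfolding i' by (rule tower_idx_SucE)
        have "(\<Sum>k\<in>tower_idx X i'. of_rat (b' (k(i := m))) * tower_mono X i' k)
            = (\<Sum>k\<in>tower_idx X i'. of_rat (b (k(i := m))) * tower_mono X i' k)"
          using b' k' B[of m] b by (simp add: ivl i'_def [symmetric])
        then have "(\<Sum>k\<in>tower_idx X i'. of_rat (b' (k(i := m)) - b (k(i := m))) * tower_mono X i' k) = 0"
          by (simp add: of_rat_diff left_diff_distrib sum_subtractf)
        then have "b' (k'(i := m)) - b (k'(i := m)) = 0"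
          by (rule monomials_independent[OF i'(2)]) (rule k')
        then show "b' k = b k" using k' by simp
      qed
    qed
  qed
  then have "?P (tower_coeffs X i)"
    unfolding tower_coeffs_def by (rule theI')
  then show ?thesis
    using m by (simp add: ivl i'_def)
qed

lemma tower_relation:
  assumes i: "i \<in> {1..n}"
  shows "X i ^ d i = (\<Sum>k\<in>tower_idx X i. of_rat (- tower_coeffs X i k) * tower_mono X i k)"
proof -
  obtain i' where i': "i = Suc i'" using i by (cases i) auto
  have tower_mono: "tower_mono X i (k(i := m)) = tower_mono X i' k * X i ^ (d i - m)" for k m
  proof -
    have "tower_mono X i' (k(i := m)) = tower_mono X i' k"
      unfolding i' by (intro prod.cong) auto
    then show ?thesis by (simp add: i' prod.nat_ivl_Suc' mult.commute)
  qed
  have "0 = (\<Sum>e\<le>d i. coeff (tower_poly X i) e * X i ^ e)"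
    using poly_tower_poly[OF i] by (simp add: poly_altdef tower_deg_def)
  also have "\<dots> = (\<Sum>e<d i. coeff (tower_poly X i) e * X i ^ e) + X i ^ d i"
    using lead_coeff_tower_poly[OF i] by (simp add: lessThan_Suc_atMost [symmetric] tower_deg_def)
  also have "(\<Sum>e<d i. coeff (tower_poly X i) e * X i ^ e)
      = (\<Sum>m\<in>{1..d i}. coeff (tower_poly X i) (d i - m) * X i ^ (d i - m))"
    by (rule sum.reindex_bij_witness[of _ "\<lambda>m. d i - m" "\<lambda>e. d i - e"]) auto
  also have "\<dots> = (\<Sum>m\<in>{1..d i}. \<Sum>k\<in>tower_idx X i'.
      of_rat (tower_coeffs X i (k(i := m))) * tower_mono X i (k(i := m)))"
    using tower_coeffs_spec[OF i] i'
    by (intro sum.cong refl) (simp add: sum_distrib_right tower_mono mult.assoc)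
  also have "\<dots> = (\<Sum>k\<in>tower_idx X i. of_rat (tower_coeffs X i k) * tower_mono X i k)"
    unfolding i' sum_tower_idx_Suc by (rule sum.swap)
  finally show ?thesis
    by (simp add: of_rat_minus sum_negf eq_neg_iff_add_eq_0 add.commute)
qed

text \<open>By the conjugates of \<open>tower_relation\<close>, the leaf values
  \<open>X (\<sigma> i) ^ d i\<close> belong to one polynomial with the coefficients
  \<open>- tower_coeffs X i k\<close>, which \<open>prefix_coefficients\<close> reads off.\<close>

lemma tower_coeffs_eq:
  assumes i: "i \<in> {1..n}" and k: "k \<in> tower_idx X i"
  shows "of_rat (- tower_coeffs X i k)
    = (\<Sum>t\<in>prefixes G i. X (t i) ^ d i * (\<Prod>j\<in>{1..i}. coeff (basis_poly t j) (d j - k j)))"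
proof (rule prefix_coefficients[where v = "\<lambda>t. X (t i) ^ d i"])
  fix \<sigma> assume \<sigma>: "\<sigma> \<in> G"
  note S = subfield_K[of "X ` {1..n}"] hom_aut[OF \<sigma>]
  have "aut \<sigma> (X i ^ d i) = X (\<sigma> i) ^ d i"
    using i \<sigma> by (simp add: hom_on_power[OF S] X_in_L aut_X del: atLeastAtMost_iff)
  then show "X (restrict \<sigma> {1..i} i) ^ d i = (\<Sum>k\<in>tower_idx X i. of_rat (- tower_coeffs X i k) * tower_mono (\<lambda>j. X (\<sigma> j)) i k)"
    using aut_expansion[OF \<sigma>, of i "\<lambda>k. - tower_coeffs X i k"] tower_relation[OF i] i by simp
qed (use i k in auto)

text \<open>Two elements of \<open>G\<close> lie in the same left coset of the stabiliser exactly if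
  they agree on \<open>{1..i}\<close>, so any system of representatives lists every leaf
  once.\<close>

lemma left_coset_reps_bij:
  assumes R: "left_coset_reps G (perm_stab G i) R" and i: "i \<in> {1..n}"
  shows "bij_betw (\<lambda>\<rho>. restrict \<rho> {1..i}) R (prefixes G i)"
proof -
  have coset: "\<rho> \<in> (\<lambda>\<tau>. \<sigma> \<circ> \<tau>) ` perm_stab G i \<longleftrightarrow> restrict \<rho> {1..i} = restrict \<sigma> {1..i}"
    if \<rho>: "\<rho> \<in> G" and \<sigma>: "\<sigma> \<in> G" for \<rho> \<sigma>
  proof
    assume "\<rho> \<in> (\<lambda>\<tau>. \<sigma> \<circ> \<tau>) ` perm_stab G i"
    then show "restrict \<rho> {1..i} = restrict \<sigma> {1..i}"
      by (auto simp: perm_stab_def fun_eq_iff)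
  next
    assume eq: "restrict \<rho> {1..i} = restrict \<sigma> {1..i}"
    have "\<rho> j = \<sigma> j" if "j \<in> {1..i}" for j
      using fun_cong[OF eq, of j] that by simp
    then have "inv_into UNIV \<sigma> \<circ> \<rho> \<in> perm_stab G i"
      using \<rho> \<sigma> permutes_inverses[OF perm_G[OF \<sigma>]]
      by (auto simp: perm_stab_def intro!: comp_in_G inv_in_G)
    moreover have "\<rho> = \<sigma> \<circ> (inv_into UNIV \<sigma> \<circ> \<rho>)"
      using permutes_inverses[OF perm_G[OF \<sigma>]] by (auto simp: fun_eq_iff)
    ultimately show "\<rho> \<in> (\<lambda>\<tau>. \<sigma> \<circ> \<tau>) ` perm_stab G i" by blast
  qed
  have RG: "R \<subseteq> G" and ex1: "\<And>\<sigma>. \<sigma> \<in> G \<Longrightarrow> \<exists>!\<rho>. \<rho> \<in> R \<and> restrict \<rho> {1..i} = restrict \<sigma> {1..i}"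
  proof -
    show RG: "R \<subseteq> G" using R by (auto simp: left_coset_reps_def)
    fix \<sigma> assume "\<sigma> \<in> G"
    moreover from this have "\<exists>!\<rho>. \<rho> \<in> R \<and> \<rho> \<in> (\<lambda>\<tau>. \<sigma> \<circ> \<tau>) ` perm_stab G i"
      using R by (auto simp: left_coset_reps_def)
    ultimately show "\<exists>!\<rho>. \<rho> \<in> R \<and> restrict \<rho> {1..i} = restrict \<sigma> {1..i}"
      using coset RG by (smt (verit, best) subsetD)
  qed
  show ?thesis
    unfolding bij_betw_def
  proof (intro conjI)
    show "inj_on (\<lambda>\<rho>. restrict \<rho> {1..i}) R"
      using ex1 RG by (intro inj_onI) (metis subsetD)
    show "(\<lambda>\<rho>. restrict \<rho> {1..i}) ` R = prefixes G i"
      unfolding prefixes_def using RG ex1 by (auto simp: image_iff) (metis)+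
  qed
qed

section \<open>The discriminant as a product over ordered pairs\<close>

definition diff_prod :: "(nat \<Rightarrow> 'b::comm_ring_1) \<Rightarrow> (nat \<times> nat) set \<Rightarrow> 'b" where
  "diff_prod Y A = (\<Prod>(r, s)\<in>A. Y r - Y s)"

text \<open>Ordered pairs, because the denominators of the interpolation are differences
  \<open>X (\<rho> j) - X s\<close> with a prescribed order; dividing by them becomes removing a
  subset.\<close>

definition pairs :: "(nat \<times> nat) set" where
  "pairs = {(r, s). r \<in> {1..n} \<and> s \<in> {1..n} \<and> r \<noteq> s}"

lemma pairs_altdef: "pairs = Sigma {1..n} (\<lambda>r. {1..n} - {r})"
  by (auto simp: pairs_def)

lemma finite_pairs [simp]: "finite pairs"
  by (simp add: pairs_altdef)

lemma card_pairs: "card pairs = n * (n - 1)"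
  by (simp add: pairs_altdef)

text \<open>The sign \<open>(-1) ^ (n * (n - 1) div 2)\<close>, written over the pairs
  \<open>r < s\<close> so that it combines factor by factor with the product of differences.\<close>

definition disc_sign :: int where
  "disc_sign = (\<Prod>s\<in>{1..n}. \<Prod>r\<in>{1..<s}. - 1)"

lemma abs_disc_sign: "\<bar>disc_sign\<bar> = 1"
  by (simp add: disc_sign_def abs_prod)

lemma disc_eq_diff_prod:
  fixes Y :: "nat \<Rightarrow> 'b::comm_ring_1"
  shows "(\<Prod>s\<in>{1..n}. \<Prod>r\<in>{1..<s}. (Y r - Y s) ^ 2) = of_int disc_sign * diff_prod Y pairs"
proof -
  have "diff_prod Y pairs = diff_prod Y (Sigma {1..n} (\<lambda>s. {1..<s}) \<union> prod.swap ` Sigma {1..n} (\<lambda>s. {1..<s}))"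
    by (rule arg_cong[of _ _ "diff_prod Y"]) (auto simp: pairs_def image_iff Bex_def)
  also have "\<dots> = diff_prod Y (Sigma {1..n} (\<lambda>s. {1..<s})) * diff_prod Y (prod.swap ` Sigma {1..n} (\<lambda>s. {1..<s}))"
    unfolding diff_prod_def by (rule prod.union_disjoint) auto
  also have "diff_prod Y (prod.swap ` Sigma {1..n} (\<lambda>s. {1..<s})) = (\<Prod>s\<in>{1..n}. \<Prod>r\<in>{1..<s}. Y r - Y s)"
    unfolding diff_prod_def by (subst prod.reindex) (auto simp: prod.Sigma split_def intro: inj_onI)
  also have "diff_prod Y (Sigma {1..n} (\<lambda>s. {1..<s})) = (\<Prod>s\<in>{1..n}. \<Prod>r\<in>{1..<s}. Y s - Y r)"
    unfolding diff_prod_def by (subst prod.Sigma) auto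
  finally have "of_int disc_sign * diff_prod Y pairs
      = (\<Prod>s\<in>{1..n}. \<Prod>r\<in>{1..<s}. - 1 * ((Y s - Y r) * (Y r - Y s)))"
    unfolding disc_sign_def of_int_prod prod.distrib by simp
  also have "\<dots> = (\<Prod>s\<in>{1..n}. \<Prod>r\<in>{1..<s}. (Y r - Y s) ^ 2)"
    by (intro prod.cong refl) (simp add: power2_eq_square algebra_simps)
  finally show ?thesis by simp
qed

lemma diff_prod_in_L: "A \<subseteq> pairs \<Longrightarrow> diff_prod X A \<in> L"
  unfolding diff_prod_def
  by (intro subfield_prod subfield_K) (auto simp: pairs_def intro!: subfield_diff subfield_K X_in_L)

lemma hom_diff_prod:
  fixes \<phi> :: "'a \<Rightarrow> 'b::field_char_0"
  assumes "hom_on L \<phi>" "A \<subseteq> pairs"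
  shows "\<phi> (diff_prod X A) = diff_prod (\<lambda>j. \<phi> (X j)) A"
proof -
  note S = subfield_K[of "X ` {1..n}"]
  have "X r - X s \<in> L" "\<phi> (X r - X s) = \<phi> (X r) - \<phi> (X s)" if "(r, s) \<in> A" for r s
    using that assms(2) by (auto simp: pairs_def hom_on_diff[OF S assms(1)] X_in_L subfield_diff[OF S])
  then show ?thesis
    unfolding diff_prod_def
    by (subst hom_on_prod[OF S assms(1)]) (auto simp: split_def intro!: prod.cong)
qed

lemma aut_diff_prod_pairs:
  assumes \<sigma>: "\<sigma> \<in> G"
  shows "aut \<sigma> (diff_prod X pairs) = diff_prod X pairs"
proof -
  note p = perm_G[OF \<sigma>]
  have "aut \<sigma> (diff_prod X pairs) = diff_prod (\<lambda>j. aut \<sigma> (X j)) pairs"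
    by (rule hom_diff_prod[OF hom_aut[OF \<sigma>] order.refl])
  also have "\<dots> = (\<Prod>(r, s)\<in>pairs. X (\<sigma> r) - X (\<sigma> s))"
    unfolding diff_prod_def by (intro prod.cong refl) (auto simp: pairs_def aut_X[OF \<sigma>])
  also have "\<dots> = diff_prod X pairs"
    unfolding diff_prod_def
    by (rule prod.reindex_bij_witness[of _ "\<lambda>(r, s). (inv_into UNIV \<sigma> r, inv_into UNIV \<sigma> s)"
          "\<lambda>(r, s). (\<sigma> r, \<sigma> s)"])
      (auto simp: pairs_def permutes_inverses[OF p] permutes_in_image[OF p]
        permutes_in_image[OF permutes_inv[OF p]] inj_eq[OF permutes_inj[OF p]]
        inj_eq[OF permutes_inj[OF permutes_inv[OF p]]] simp del: atLeastAtMost_iff)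
  finally show ?thesis .
qed

text \<open>Justifies the definite description in \<open>rat_discriminant\<close>: automorphisms
  permute the ordered pairs, so the product is fixed by \<open>G\<close> and hence rational.\<close>

lemma rat_discriminant_eq:
  "of_rat (rat_discriminant n X) = of_int disc_sign * diff_prod X pairs"
proof -
  have "\<exists>r. diff_prod X pairs = of_rat r"
    by (intro fixed_imp_rational diff_prod_in_L aut_diff_prod_pairs order.refl)
  then obtain r where "diff_prod X pairs = of_rat r" by blast
  then have eq: "of_rat (of_int disc_sign * r) = (\<Prod>s\<in>{1..n}. \<Prod>r\<in>{1..<s}. (X r - X s) ^ 2)"
    by (simp add: disc_eq_diff_prod of_rat_mult)
  then have "rat_discriminant n X = of_int disc_sign * r"
    unfolding rat_discriminant_def
  proof (rule the_equality)
    fix q :: rat assume "of_rat q = (\<Prod>s\<in>{1..n}. \<Prod>r\<in>{1..<s}. (X r - X s) ^ 2)"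
    then have "(of_rat q :: 'a) = of_rat (of_int disc_sign * r)"
      unfolding eq .
    then show "q = of_int disc_sign * r"
      by (simp only: of_rat_eq_iff)
  qed
  with eq show ?thesis
    by (simp only: disc_eq_diff_prod)
qed

end

section \<open>Coefficients of multivariate polynomials\<close>

lemma mp_const_0 [simp]: "mp_const 0 = 0"
  and mp_const_1 [simp]: "mp_const 1 = 1"
  and mp_const_add: "mp_const (a + b) = mp_const a + mp_const b"
  and mp_const_mult: "mp_const (a * b) = mp_const a * mp_const b"
  by (simp_all add: mp_const_def single_add mult_single)

lemma lookup_mp_const_mult: "Poly_Mapping.lookup (mp_const a * P) m = a * Poly_Mapping.lookup P m"
  unfolding mp_const_def by (simp add: Poly_Mapping.map.rep_eq when_def flip: mult_map_scale_conv_mult)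

interpretation mp_const: comm_ring_hom mp_const
  by unfold_locales (simp_all add: mp_const_add mp_const_mult)

interpretation mp_const: inj_comm_ring_hom mp_const
proof
  fix a :: 'a assume "mp_const a = 0"
  then have "Poly_Mapping.lookup (mp_const a) 0 = Poly_Mapping.lookup 0 (0 :: nat \<Rightarrow>\<^sub>0 nat)" by simp
  then show "a = 0" by (simp add: mp_const_def)
qed

interpretation mp_const_poly: map_poly_comm_ring_hom mp_const ..

definition exponents :: "nat \<Rightarrow> (nat \<Rightarrow> nat) \<Rightarrow> nat \<Rightarrow>\<^sub>0 nat" where
  "exponents i e = (\<Sum>j\<in>{1..i}. Poly_Mapping.single j (e j))"

lemma lookup_exponents: "Poly_Mapping.lookup (exponents i e) l = (if l \<in> {1..i} then e l else 0)"
  by (simp add: exponents_def lookup_sum lookup_single when_def)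

lemma exponents_eq_iff:
  "exponents i e = m \<longleftrightarrow> (\<forall>l. Poly_Mapping.lookup m l = (if l \<in> {1..i} then e l else 0))"
  by (auto simp: poly_mapping_eq_iff fun_eq_iff lookup_exponents)

lemma mp_var_power: "mp_var j ^ e = Poly_Mapping.single (Poly_Mapping.single j e) 1"
  by (induction e) (simp_all add: mp_var_def mult_single One_nat_def flip: single_add)

lemma prod_single:
  "finite A \<Longrightarrow> (\<Prod>j\<in>A. Poly_Mapping.single (k j) (c j)) = Poly_Mapping.single (\<Sum>j\<in>A. k j) (\<Prod>j\<in>A. c j :: 'a::comm_ring_1)"
  by (induction A rule: finite_induct) (simp_all add: mult_single)

lemma prod_mp_var_power:
  "(\<Prod>j\<in>{1..i}. mp_var j ^ e j) = Poly_Mapping.single (exponents i e) (1 :: 'a::comm_ring_1)"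
  by (simp add: mp_var_power prod_single exponents_def)

text \<open>The factors involve different variables, so each monomial arises from exactly one choice
  of exponents and its coefficient is a single product; a variable outside the range occurs in no
  factor.\<close>

lemma lookup_prod_poly_mp_var:
  fixes g :: "nat \<Rightarrow> 'a::comm_ring_1 poly"
  shows "Poly_Mapping.lookup (\<Prod>j\<in>{1..i}. poly (map_poly mp_const (g j)) (mp_var j)) m =
    (if \<forall>l. l \<notin> {1..i} \<longrightarrow> Poly_Mapping.lookup m l = 0
     then \<Prod>j\<in>{1..i}. coeff (g j) (Poly_Mapping.lookup m j) else 0)"
proof -
  let ?c = "\<lambda>\<kappa>. \<Prod>j\<in>{1..i}. coeff (g j) (\<kappa> j)"
  have "poly (map_poly mp_const (g j)) (mp_var j)
      = (\<Sum>e\<in>{..degree (g j)}. Poly_Mapping.single (Poly_Mapping.single j e) (coeff (g j) e))" for j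
    by (simp add: poly_altdef mp_var_power) (simp add: mp_const_def mult_single)
  then have "(\<Prod>j\<in>{1..i}. poly (map_poly mp_const (g j)) (mp_var j))
      = (\<Sum>\<kappa>\<in>PiE {1..i} (\<lambda>j. {..degree (g j)}). Poly_Mapping.single (exponents i \<kappa>) (?c \<kappa>))"
    by (simp add: prod_sum_PiE prod_single exponents_def)
  then have eq: "Poly_Mapping.lookup (\<Prod>j\<in>{1..i}. poly (map_poly mp_const (g j)) (mp_var j)) m
      = (\<Sum>\<kappa>\<in>PiE {1..i} (\<lambda>j. {..degree (g j)}). if exponents i \<kappa> = m then ?c \<kappa> else 0)"
    by (simp add: lookup_sum lookup_single when_def)
  define \<kappa>0 where "\<kappa>0 = restrict (Poly_Mapping.lookup m) {1..i}"
  have \<kappa>0: "\<kappa> = \<kappa>0" if "\<kappa> \<in> PiE {1..i} (\<lambda>j. {..degree (g j)})" "exponents i \<kappa> = m" for \<kappa>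
    using that by (auto simp: \<kappa>0_def fun_eq_iff exponents_eq_iff PiE_iff extensional_def)
  have c0: "?c \<kappa>0 = (\<Prod>j\<in>{1..i}. coeff (g j) (Poly_Mapping.lookup m j))"
    by (intro prod.cong refl) (simp add: \<kappa>0_def)
  show ?thesis
  proof (cases "\<forall>l. l \<notin> {1..i} \<longrightarrow> Poly_Mapping.lookup m l = 0")
    case False
    then have "exponents i \<kappa> \<noteq> m" for \<kappa>
      by (auto simp: exponents_eq_iff)
    then show ?thesis
      unfolding eq if_not_P[OF False] by (intro sum.neutral) auto
  next
    case True
    then have m: "exponents i \<kappa>0 = m"
      by (auto simp: exponents_eq_iff \<kappa>0_def)
    have "(\<Sum>\<kappa>\<in>PiE {1..i} (\<lambda>j. {..degree (g j)}). if exponents i \<kappa> = m then ?c \<kappa> else 0)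
        = (\<Sum>\<kappa>\<in>PiE {1..i} (\<lambda>j. {..degree (g j)}). if \<kappa> = \<kappa>0 then ?c \<kappa>0 else 0)"
    proof (intro sum.cong refl)
      fix \<kappa> assume "\<kappa> \<in> PiE {1..i} (\<lambda>j. {..degree (g j)})"
      then have "exponents i \<kappa> = m \<longleftrightarrow> \<kappa> = \<kappa>0"
        using \<kappa>0 m by blast
      then show "(if exponents i \<kappa> = m then ?c \<kappa> else 0) = (if \<kappa> = \<kappa>0 then ?c \<kappa>0 else 0)"
        by simp
    qed
    also have "\<dots> = (if \<kappa>0 \<in> PiE {1..i} (\<lambda>j. {..degree (g j)}) then ?c \<kappa>0 else 0)"
      by (simp add: finite_PiE)
    \<comment> \<open>If some exponent exceeds the degree of its factor, the tuple is missing from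
      the index set, but then its product of coefficients is 0 anyway.\<close>
    also have "\<dots> = ?c \<kappa>0"
    proof (cases "\<kappa>0 \<in> PiE {1..i} (\<lambda>j. {..degree (g j)})")
      case False
      then obtain j where "j \<in> {1..i}" "\<kappa>0 j > degree (g j)"
        by (auto simp: PiE_iff \<kappa>0_def not_le)
      then have "?c \<kappa>0 = 0"
        by (intro prod_zero bexI[of _ j]) (auto simp: coeff_eq_0)
      with False show ?thesis by simp
    qed simp
    finally show ?thesis
      unfolding eq c0 using True by simp
  qed
qed

lemma exponents_tower_idx_inj:
  assumes "k \<in> tower_idx X i" "k' \<in> tower_idx X i"
    and "exponents i (\<lambda>j. tower_deg X j - k j) = exponents i (\<lambda>j. tower_deg X j - k' j)"
  shows "k = k'"
proof
  fix j
  show "k j = k' j"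
  proof (cases "j \<in> {1..i}")
    case True
    have "Poly_Mapping.lookup (exponents i (\<lambda>j. tower_deg X j - k j)) j
        = Poly_Mapping.lookup (exponents i (\<lambda>j. tower_deg X j - k' j)) j"
      using assms(3) by simp
    moreover have "k j \<le> tower_deg X j" "k' j \<le> tower_deg X j"
      using assms(1,2) True by (auto simp: tower_idx_def PiE_iff)
    ultimately show ?thesis
      using True by (simp add: lookup_exponents)
  next
    case False
    then show ?thesis
      using assms(1,2) unfolding tower_idx_def by (metis PiE_arb)
  qed
qed

text \<open>\<open>k i \<ge> 1\<close> keeps the exponent of the last variable below
  \<open>tower_deg X i\<close>; this separates the leading power from all other monomials.\<close>

lemma exponents_neq_single:
  assumes "k \<in> tower_idx X i" "i \<ge> 1"
  shows "exponents i (\<lambda>j. tower_deg X j - k j) \<noteq> Poly_Mapping.single i (tower_deg X i)"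
proof
  assume "exponents i (\<lambda>j. tower_deg X j - k j) = Poly_Mapping.single i (tower_deg X i)"
  then have "Poly_Mapping.lookup (exponents i (\<lambda>j. tower_deg X j - k j)) i = tower_deg X i"
    by simp
  moreover have "1 \<le> k i" "k i \<le> tower_deg X i"
    using assms by (auto simp: tower_idx_def PiE_iff)
  ultimately show False
    using assms(2) by (simp add: lookup_exponents)
qed

lemma lookup_tower_hat:
  "Poly_Mapping.lookup (tower_hat X i) m =
    (if Poly_Mapping.single i (tower_deg X i) = m then 1 else 0) +
    (\<Sum>k\<in>tower_idx X i. if exponents i (\<lambda>j. tower_deg X j - k j) = m then tower_coeffs X i k else 0)"
  unfolding tower_hat_def
  by (simp add: lookup_add lookup_sum prod_mp_var_power lookup_mp_const_mult)
    (simp add: mp_var_power lookup_single when_def if_distrib[of "\<lambda>a. _ * a"] cong: if_cong)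

text \<open>Collects the linear factors by variable, so that each summand is a product of univariate
  polynomials in different variables.\<close>

lemma interp_poly_altdef:
  fixes x :: "nat \<Rightarrow> 'p::prime_card padic_int"
  shows "interp_poly G R x e \<Delta> d i = mp_const \<Delta> * (mp_var i ^ d -
     (\<Sum>\<rho>\<in>R. mp_const (padic_residue e (x (\<rho> i)) ^ d) *
        (\<Prod>j\<in>{1..i}. poly (map_poly mp_const (\<Prod>y\<in>residue_siblings G x e \<rho> j.
           smult (modular_inverse (int CARD('p) ^ e) (padic_residue e (x (\<rho> j)) - y)) [:- y, 1:])) (mp_var j))))"
proof -
  have "poly (map_poly mp_const (\<Prod>y\<in>A. smult (c y) [:- y, 1:])) (mp_var j)
      = (\<Prod>y\<in>A. (mp_var j - mp_const y) * mp_const (c y))" for A :: "int set" and c j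
    by (simp add: mp_const_poly.hom_prod poly_prod mp_const.map_poly_hom_smult
        mp_const.map_poly_pCons_hom mp_const.hom_uminus mp_const_mult algebra_simps)
  then show ?thesis
    unfolding interp_poly_def by simp
qed

lemma lookup_interp_poly:
  fixes x :: "nat \<Rightarrow> 'p::prime_card padic_int"
  shows "Poly_Mapping.lookup (interp_poly G R x e \<Delta> d i) m = \<Delta> *
    ((if Poly_Mapping.single i d = m then 1 else 0) -
     (\<Sum>\<rho>\<in>R. padic_residue e (x (\<rho> i)) ^ d *
       (if \<forall>l. l \<notin> {1..i} \<longrightarrow> Poly_Mapping.lookup m l = 0
        then \<Prod>j\<in>{1..i}. coeff (\<Prod>y\<in>residue_siblings G x e \<rho> j.
           smult (modular_inverse (int CARD('p) ^ e) (padic_residue e (x (\<rho> j)) - y)) [:- y, 1:])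
             (Poly_Mapping.lookup m j)
        else 0)))"
  unfolding interp_poly_altdef lookup_mp_const_mult lookup_minus lookup_sum lookup_prod_poly_mp_var
  by (simp only: mp_var_power lookup_single when_def)

lemma balanced_lift_exists:
  assumes "odd q" "q > 0"
  shows "\<exists>Q. balanced_lift q P Q"
proof -
  obtain h where h: "q = 2 * h + 1"
    using assms(1) by (auto elim: oddE)
  define b where "b a = (a + h) mod q - h" for a
  have b: "[b a = a] (mod q)" "- (q - 1) \<le> 2 * b a" "2 * b a \<le> q - 1" for a
  proof -
    have "[(a + h) mod q - h = (a + h) - h] (mod q)"
      by (intro cong_diff cong_refl) (simp add: cong_def)
    then show "[b a = a] (mod q)" by (simp add: b_def)
    have "0 \<le> (a + h) mod q" "(a + h) mod q < q"
      using assms(2) by simp_all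
    then show "- (q - 1) \<le> 2 * b a" and "2 * b a \<le> q - 1"
      by (simp_all add: b_def h)
  qed
  have "b 0 = 0"
    using h assms(2) by (simp add: b_def)
  then have "Poly_Mapping.lookup (Poly_Mapping.map b P) m = b (Poly_Mapping.lookup P m)" for m
    by (simp add: Poly_Mapping.map.rep_eq when_def)
  then show ?thesis
    using b by (intro exI[of _ "Poly_Mapping.map b P"]) (simp add: balanced_lift_def)
qed

section \<open>Integrality and size of the coefficients\<close>

lemma norm_coeff_prod_linear_le:
  fixes z :: "'b \<Rightarrow> complex"
  assumes "finite S" "M \<ge> 0" "\<And>s. s \<in> S \<Longrightarrow> cmod (z s) \<le> M"
  shows "cmod (coeff (\<Prod>s\<in>S. [:- z s, 1:]) a) \<le> real (card S choose a) * M ^ (card S - a)"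
  using assms(1,3)
proof (induction S arbitrary: a rule: finite_induct)
  case empty
  then show ?case by (cases a) auto
next
  case (insert s S)
  let ?p = "\<Prod>s\<in>S. [:- z s, 1:]"
  have IH: "cmod (coeff ?p a) \<le> real (card S choose a) * M ^ (card S - a)" for a
    using insert by auto
  have step: "cmod (z s * coeff ?p a) \<le> real (card S choose a) * M ^ (card (insert s S) - a)" for a
  proof (cases "a \<le> card S")
    case True
    have "cmod (z s * coeff ?p a) \<le> M * (real (card S choose a) * M ^ (card S - a))"
      unfolding norm_mult using insert.prems assms(2) by (intro mult_mono IH) auto
    also have "\<dots> = real (card S choose a) * M ^ (card (insert s S) - a)"
      using True insert.hyps by (simp add: Suc_diff_le)
    finally show ?thesis .
  next
    case False
    then have "card S choose a = 0" by simp
    then have "cmod (coeff ?p a) \<le> real 0 * M ^ (card S - a)"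
      using IH[of a] by (simp only:)
    then have "coeff ?p a = 0" by simp
    then show ?thesis using assms(2) by simp
  qed
  show ?case
  proof (cases a)
    case 0
    then show ?thesis
      using step[of 0] insert.hyps by (simp add: norm_mult)
  next
    case (Suc b)
    have "coeff (\<Prod>s\<in>insert s S. [:- z s, 1:]) a = coeff ?p b - z s * coeff ?p a"
      using insert.hyps by (simp add: Suc)
    then have "cmod (coeff (\<Prod>s\<in>insert s S. [:- z s, 1:]) a)
        \<le> cmod (coeff ?p b) + cmod (z s * coeff ?p a)"
      by (simp add: norm_triangle_ineq4)
    also have "\<dots> \<le> real (card S choose b) * M ^ (card S - b)
        + real (card S choose a) * M ^ (card (insert s S) - a)"
      by (intro add_mono IH step)
    also have "\<dots> = real (card (insert s S) choose a) * M ^ (card (insert s S) - a)"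
      using insert.hyps by (simp add: Suc algebra_simps)
    finally show ?thesis .
  qed
qed

lemma of_rat_algebraic_int_imp_Ints:
  assumes "algebraic_int (of_rat r :: 'a::field_char_0)"
  shows "r \<in> \<int>"
proof -
  have "(of_rat r :: 'a) \<in> \<int>"
    using assms by (rule rational_algebraic_int_is_int) simp
  then obtain m where "(of_rat r :: 'a) = of_int m" by (elim Ints_cases)
  then have "(of_rat r :: 'a) = of_rat (of_int m)" by simp
  then have "r = of_int m" by (simp only: of_rat_eq_iff)
  then show ?thesis by simp
qed

context root_tower
begin

abbreviation halves :: "nat \<Rightarrow> nat" where
  "halves i \<equiv> nat \<lceil>real i / 2\<rceil>"

lemma halves_ge_1: "i \<ge> 1 \<Longrightarrow> halves i \<ge> 1"
proof -
  assume "i \<ge> 1"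
  then have "real i / 2 > 0" by simp
  then have "halves i > 0" by (metis zero_less_ceiling zero_less_nat_eq)
  then show ?thesis
    unfolding One_nat_def by (rule Suc_leI)
qed

lemma halves_pos: "i \<ge> 1 \<Longrightarrow> halves i = Suc (halves i - 1)"
  using halves_ge_1[of i] by simp

abbreviation others :: "(nat \<Rightarrow> nat) \<Rightarrow> nat \<Rightarrow> nat set" where
  "others \<rho> j \<equiv> siblings G j \<rho> - {\<rho> j}"

lemma siblings_self: "\<rho> \<in> G \<Longrightarrow> \<rho> j \<in> siblings G j \<rho>"
  unfolding siblings_def by blast

lemma card_other_siblings: "\<rho> \<in> G \<Longrightarrow> j \<in> {1..n} \<Longrightarrow> card (others \<rho> j) = d j - 1"
  by (subst card_Diff_singleton[OF siblings_self]) (simp_all add: card_siblings)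

definition used_pairs :: "nat \<Rightarrow> (nat \<Rightarrow> nat) \<Rightarrow> (nat \<times> nat) set" where
  "used_pairs i \<rho> = (\<lambda>(j, s). (\<rho> j, s)) ` (SIGMA j:{1..i}. others \<rho> j)"

lemma inj_on_used_pairs: "\<rho> \<in> G \<Longrightarrow> inj_on (\<lambda>(j, s). (\<rho> j, s)) A"
  using permutes_inj[OF perm_G, of \<rho>] by (auto simp: inj_on_def dest: injD)

lemma used_pairs_subset:
  assumes "\<rho> \<in> G" "i \<le> n"
  shows "used_pairs i \<rho> \<subseteq> pairs"
proof
  fix a assume "a \<in> used_pairs i \<rho>"
  then obtain j s where j: "j \<in> {1..i}" and s: "s \<in> siblings G j \<rho>" "s \<noteq> \<rho> j" and a: "a = (\<rho> j, s)"
  proof -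
    obtain b where b: "b \<in> (SIGMA j:{1..i}. others \<rho> j)" "a = (\<lambda>(j, s). (\<rho> j, s)) b"
      using \<open>a \<in> used_pairs i \<rho>\<close> unfolding used_pairs_def by (rule imageE)
    show ?thesis
      by (rule that[of "fst b" "snd b"]) (use b in \<open>auto simp: split_def\<close>)
  qed
  have j': "j \<in> {1..n}" using j assms by auto
  have "s \<in> {1..n}" using siblings_subset[OF j'] s by blast
  then show "a \<in> pairs"
    unfolding a pairs_def using G_in[OF assms(1) j'] s by blast
qed

lemma card_used_pairs:
  assumes "\<rho> \<in> G" "i \<le> n"
  shows "card (used_pairs i \<rho>) = (\<Sum>j\<in>{1..i}. d j - 1)"
proof -
  have "card (used_pairs i \<rho>) = (\<Sum>j\<in>{1..i}. card (others \<rho> j))"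
    unfolding used_pairs_def card_image[OF inj_on_used_pairs[OF assms(1)]]
    by (rule card_SigmaI) (simp_all add: finite_siblings)
  also have "\<dots> = (\<Sum>j\<in>{1..i}. d j - 1)"
    using assms by (intro sum.cong refl card_other_siblings) auto
  finally show ?thesis .
qed

lemma diff_prod_used_pairs:
  assumes "\<rho> \<in> G"
  shows "diff_prod Y (used_pairs i \<rho>) = (\<Prod>j\<in>{1..i}. \<Prod>s\<in>others \<rho> j. Y (\<rho> j) - Y s)"
proof -
  have "diff_prod Y (used_pairs i \<rho>) = (\<Prod>(j, s)\<in>(SIGMA j:{1..i}. others \<rho> j). Y (\<rho> j) - Y s)"
    unfolding diff_prod_def used_pairs_def
    by (subst prod.reindex[OF inj_on_used_pairs[OF assms]]) (simp add: split_def o_def)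
  also have "\<dots> = (\<Prod>j\<in>{1..i}. \<Prod>s\<in>others \<rho> j. Y (\<rho> j) - Y s)"
    by (rule prod.Sigma [symmetric]) (simp_all add: finite_siblings)
  finally show ?thesis .
qed

text \<open>
  The pairs \<open>(\<rho> j, s)\<close> with \<open>s\<close> a sibling of \<open>\<rho> j\<close> are distinct, so the denominators of the
  interpolation formula divide a single factor \<open>d(f)\<close>; \<open>cofactor\<close> is the quotient of
  \<open>d(f) ^ \<lceil>i/2\<rceil>\<close> by them, and it is polynomial in the zeros.
\<close>

definition cofactor :: "nat \<Rightarrow> (nat \<Rightarrow> 'b::comm_ring_1) \<Rightarrow> (nat \<Rightarrow> nat) \<Rightarrow> 'b" where
  "cofactor i Y \<rho> = of_int disc_sign ^ halves i * diff_prod Y pairs ^ (halves i - 1) *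
     diff_prod Y (pairs - used_pairs i \<rho>)"

definition numerator :: "nat \<Rightarrow> (nat \<Rightarrow> 'b::comm_ring_1) \<Rightarrow> (nat \<Rightarrow> nat) \<Rightarrow> (nat \<Rightarrow> nat) \<Rightarrow> 'b" where
  "numerator i Y \<rho> k = Y (\<rho> i) ^ d i *
     (\<Prod>j\<in>{1..i}. coeff (\<Prod>s\<in>others \<rho> j. [:- Y s, 1:]) (d j - k j))"

abbreviation weight :: "nat \<Rightarrow> nat" where
  "weight i \<equiv> n * (n - 1) * halves i + d i"

lemma cofactor_mult:
  assumes "\<rho> \<in> G" "i \<in> {1..n}"
  shows "cofactor i Y \<rho> * diff_prod Y (used_pairs i \<rho>) = (of_int disc_sign * diff_prod Y pairs) ^ halves i"
proof -
  have "diff_prod Y (pairs - used_pairs i \<rho>) * diff_prod Y (used_pairs i \<rho>) = diff_prod Y pairs"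
    unfolding diff_prod_def using assms used_pairs_subset[OF assms(1), of i]
    by (subst prod.subset_diff[of "used_pairs i \<rho>" pairs]) auto
  then have "cofactor i Y \<rho> * diff_prod Y (used_pairs i \<rho>)
      = of_int disc_sign ^ halves i * (diff_prod Y pairs ^ (halves i - 1) * diff_prod Y pairs)"
    by (simp add: cofactor_def mult.assoc)
  also have "diff_prod Y pairs ^ (halves i - 1) * diff_prod Y pairs = diff_prod Y pairs ^ halves i"
    using halves_pos[of i] assms(2) by (metis power_Suc2 atLeastAtMost_iff)
  finally show ?thesis by (simp add: power_mult_distrib)
qed

lemma tower_denom_eq:
  "of_rat (tower_denom \<gamma> n X i) = of_int \<gamma> ^ weight i * (of_int disc_sign * diff_prod X pairs) ^ halves i"
  by (simp add: tower_denom_def of_rat_mult of_rat_power rat_discriminant_eq)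

lemma diff_prod_nz: "A \<subseteq> pairs \<Longrightarrow> diff_prod X A \<noteq> 0"
proof -
  assume A: "A \<subseteq> pairs"
  have "X r - X s \<noteq> 0" if "(r, s) \<in> A" for r s
  proof -
    have rs: "r \<in> {1..n}" "s \<in> {1..n}" "r \<noteq> s"
      using subsetD[OF A that] unfolding pairs_def by blast+
    then show ?thesis
      using inj_onD[OF inj _ rs(1,2)] by auto
  qed
  moreover have "finite A" using A finite_pairs by (rule finite_subset)
  ultimately show ?thesis
    by (auto simp: diff_prod_def prod_zero_iff)
qed

lemma tower_denom_nz: "\<gamma> \<noteq> 0 \<Longrightarrow> tower_denom \<gamma> n X i \<noteq> 0"
proof
  assume "\<gamma> \<noteq> 0" "tower_denom \<gamma> n X i = 0"
  then show False
    using tower_denom_eq[of \<gamma> i] diff_prod_nz[OF order.refl] abs_disc_sign by auto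
qed

lemma coeff_basis_poly:
  "coeff (basis_poly \<rho> j) m = inverse (\<Prod>s\<in>others \<rho> j. X (\<rho> j) - X s) *
     coeff (\<Prod>s\<in>others \<rho> j. [:- X s, 1:]) m"
  by (simp only: basis_poly_def prod_smult coeff_smult prod_inversef [symmetric] o_def)

context
  fixes i :: nat and R :: "(nat \<Rightarrow> nat) set"
  assumes R: "left_coset_reps G (perm_stab G i) R" and i: "i \<in> {1..n}"
begin

lemma R_G: "\<rho> \<in> R \<Longrightarrow> \<rho> \<in> G"
  using R unfolding left_coset_reps_def by blast

lemma card_R: "card R = (\<Prod>j\<in>{1..i}. d j)"
  using bij_betw_same_card[OF left_coset_reps_bij[OF R i]] card_prefixes i by simp

lemma scaled_tower_coeffs:
  assumes k: "k \<in> tower_idx X i"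
  shows "of_rat (tower_denom \<gamma> n X i * - tower_coeffs X i k)
    = (\<Sum>\<rho>\<in>R. of_int \<gamma> ^ weight i * cofactor i X \<rho> * numerator i X \<rho> k)"
proof -
  have "of_rat (- tower_coeffs X i k)
      = (\<Sum>t\<in>prefixes G i. X (t i) ^ d i * (\<Prod>j\<in>{1..i}. coeff (basis_poly t j) (d j - k j)))"
    by (rule tower_coeffs_eq[OF i k])
  also have "\<dots> = (\<Sum>\<rho>\<in>R. X (restrict \<rho> {1..i} i) ^ d i *
      (\<Prod>j\<in>{1..i}. coeff (basis_poly (restrict \<rho> {1..i}) j) (d j - k j)))"
    by (rule sum.reindex_bij_betw[OF left_coset_reps_bij[OF R i], symmetric])
  also have "\<dots> = (\<Sum>\<rho>\<in>R. X (\<rho> i) ^ d i * (\<Prod>j\<in>{1..i}. coeff (basis_poly \<rho> j) (d j - k j)))"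
  proof (intro sum.cong refl)
    fix \<rho>
    have "basis_poly (restrict \<rho> {1..i}) j = basis_poly \<rho> j" if "j \<in> {1..i}" for j
      using that by (intro basis_poly_cong) auto
    then show "X (restrict \<rho> {1..i} i) ^ d i * (\<Prod>j\<in>{1..i}. coeff (basis_poly (restrict \<rho> {1..i}) j) (d j - k j))
        = X (\<rho> i) ^ d i * (\<Prod>j\<in>{1..i}. coeff (basis_poly \<rho> j) (d j - k j))"
      using i by simp
  qed
  finally have "of_rat (tower_denom \<gamma> n X i * - tower_coeffs X i k) = (\<Sum>\<rho>\<in>R. of_rat (tower_denom \<gamma> n X i) *
      (X (\<rho> i) ^ d i * (\<Prod>j\<in>{1..i}. coeff (basis_poly \<rho> j) (d j - k j))))"
    by (simp only: of_rat_mult sum_distrib_left)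
  also have "\<dots> = (\<Sum>\<rho>\<in>R. of_int \<gamma> ^ weight i * cofactor i X \<rho> * numerator i X \<rho> k)"
  proof (intro sum.cong refl)
    fix \<rho> assume "\<rho> \<in> R"
    then have \<rho>: "\<rho> \<in> G" by (rule R_G)
    let ?U = "diff_prod X (used_pairs i \<rho>)"
    have U: "?U \<noteq> 0"
      using i by (intro diff_prod_nz used_pairs_subset \<rho>) auto
    have "(\<Prod>j\<in>{1..i}. coeff (basis_poly \<rho> j) (d j - k j)) = inverse ?U *
        (\<Prod>j\<in>{1..i}. coeff (\<Prod>s\<in>others \<rho> j. [:- X s, 1:]) (d j - k j))"
      unfolding coeff_basis_poly prod.distrib diff_prod_used_pairs[OF \<rho>]
      by (simp only: prod_inversef [symmetric] o_def)
    then have "of_rat (tower_denom \<gamma> n X i) * (X (\<rho> i) ^ d i * (\<Prod>j\<in>{1..i}. coeff (basis_poly \<rho> j) (d j - k j)))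
        = of_int \<gamma> ^ weight i * (cofactor i X \<rho> * ?U) * inverse ?U * numerator i X \<rho> k"
      unfolding cofactor_mult[OF \<rho> i] tower_denom_eq numerator_def by simp
    also have "\<dots> = of_int \<gamma> ^ weight i * cofactor i X \<rho> * numerator i X \<rho> k"
      using U by simp
    finally show "of_rat (tower_denom \<gamma> n X i) * (X (\<rho> i) ^ d i * (\<Prod>j\<in>{1..i}. coeff (basis_poly \<rho> j) (d j - k j)))
        = of_int \<gamma> ^ weight i * cofactor i X \<rho> * numerator i X \<rho> k" .
  qed
  finally show ?thesis .
qed

lemma sum_d_le: "(\<Sum>j\<in>{1..i}. d j - 1) \<le> n * (n - 1)"
  using card_mono[OF finite_pairs used_pairs_subset[OF id_in_G, of i]] card_used_pairs[OF id_in_G, of i] i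
  by (simp add: card_pairs)

lemma card_unused: "\<rho> \<in> G \<Longrightarrow> card (pairs - used_pairs i \<rho>) = n * (n - 1) - (\<Sum>j\<in>{1..i}. d j - 1)"
  using i used_pairs_subset[of \<rho> i] finite_subset[OF used_pairs_subset finite_pairs, of \<rho> i]
  by (simp add: card_Diff_subset card_used_pairs card_pairs)

lemma weight_eq:
  "\<rho> \<in> G \<Longrightarrow> weight i = n * (n - 1) * (halves i - 1) + card (pairs - used_pairs i \<rho>) + (\<Sum>j\<in>{1..i}. d j - 1) + d i"
proof -
  assume "\<rho> \<in> G"
  have "n * (n - 1) * halves i = n * (n - 1) * (halves i - 1) + n * (n - 1)"
    using halves_pos[of i] i by (metis mult_Suc_right add.commute atLeastAtMost_iff)
  then show ?thesis
    using card_unused[OF \<open>\<rho> \<in> G\<close>] sum_d_le by linarith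
qed

context
  fixes \<gamma> :: int
  assumes alg: "\<And>j. j \<in> {1..n} \<Longrightarrow> algebraic_int (of_int \<gamma> * X j)"
begin

lemma algebraic_int_diff_prod:
  assumes "A \<subseteq> pairs"
  shows "algebraic_int (of_int \<gamma> ^ card A * diff_prod X A)"
proof -
  have "of_int \<gamma> ^ card A * diff_prod X A = (\<Prod>(r, s)\<in>A. of_int \<gamma> * X r - of_int \<gamma> * X s)"
    by (simp add: diff_prod_def prod.distrib [symmetric] prod_constant [symmetric] split_def
        right_diff_distrib del: prod_constant)
  also have "algebraic_int \<dots>"
    using assms by (intro algebraic_int_prod) (auto simp: pairs_def intro!: algebraic_int_diff alg)
  finally show ?thesis .
qed

lemma tower_denom_Ints: "tower_denom \<gamma> n X i \<in> \<int>"
proof (rule of_rat_algebraic_int_imp_Ints[where 'a = 'a])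
  have "of_rat (tower_denom \<gamma> n X i)
      = of_int disc_sign ^ halves i * (of_int \<gamma> ^ card pairs * diff_prod X pairs) ^ halves i * of_int \<gamma> ^ d i"
    by (simp add: tower_denom_eq power_add power_mult_distrib power_mult card_pairs)
  also have "algebraic_int \<dots>"
    by (intro algebraic_int_mult algebraic_int_power algebraic_int_diff_prod algebraic_int_of_int order.refl)
  finally show "algebraic_int (of_rat (tower_denom \<gamma> n X i) :: 'a)" .
qed

lemma scaled_tower_coeffs_Ints:
  assumes k: "k \<in> tower_idx X i"
  shows "tower_denom \<gamma> n X i * - tower_coeffs X i k \<in> \<int>"
proof (rule of_rat_algebraic_int_imp_Ints[where 'a = 'a])
  have "algebraic_int (of_int \<gamma> ^ weight i * cofactor i X \<rho> * numerator i X \<rho> k)" if "\<rho> \<in> R" for \<rho>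
  proof -
    have \<rho>: "\<rho> \<in> G" using that by (rule R_G)
    let ?S = "\<lambda>j. others \<rho> j"
    have sub: "?S j \<subseteq> {1..n}" if "j \<in> {1..i}" for j
      using siblings_subset[of j \<rho>] that i by auto
    have "(of_int \<gamma> :: 'a) ^ (\<Sum>j\<in>{1..i}. d j - 1) = (\<Prod>j\<in>{1..i}. of_int \<gamma> ^ card (?S j))"
      unfolding power_sum using i by (intro prod.cong refl) (simp add: card_other_siblings[OF \<rho>])
    then have "of_int \<gamma> ^ weight i * cofactor i X \<rho> * numerator i X \<rho> k =
        of_int disc_sign ^ halves i * (of_int \<gamma> ^ card pairs * diff_prod X pairs) ^ (halves i - 1) *
        (of_int \<gamma> ^ card (pairs - used_pairs i \<rho>) * diff_prod X (pairs - used_pairs i \<rho>)) *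
        (of_int \<gamma> * X (\<rho> i)) ^ d i *
        (\<Prod>j\<in>{1..i}. of_int \<gamma> ^ card (?S j) * coeff (\<Prod>s\<in>?S j. [:- X s, 1:]) (d j - k j))"
      unfolding weight_eq[OF \<rho>] cofactor_def numerator_def prod.distrib
      by (simp add: power_add power_mult_distrib power_mult card_pairs mult_ac)
    also have "algebraic_int \<dots>"
    proof (rule algebraic_int_mult[OF algebraic_int_mult[OF algebraic_int_mult[OF algebraic_int_mult]]])
      show "algebraic_int (of_int disc_sign ^ halves i :: 'a)"
        by (intro algebraic_int_power algebraic_int_of_int)
      show "algebraic_int ((of_int \<gamma> ^ card pairs * diff_prod X pairs) ^ (halves i - 1))"
        by (intro algebraic_int_power algebraic_int_diff_prod order.refl)
      show "algebraic_int (of_int \<gamma> ^ card (pairs - used_pairs i \<rho>) * diff_prod X (pairs - used_pairs i \<rho>))"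
        by (intro algebraic_int_diff_prod Diff_subset)
      show "algebraic_int ((of_int \<gamma> * X (\<rho> i)) ^ d i)"
        by (intro algebraic_int_power alg G_in[OF \<rho> i])
      show "algebraic_int (\<Prod>j\<in>{1..i}. of_int \<gamma> ^ card (?S j) * coeff (\<Prod>s\<in>?S j. [:- X s, 1:]) (d j - k j))"
      proof (intro algebraic_int_prod algebraic_int_coeff_prod_linear algebraic_int_of_int)
        show "finite (?S j)" for j by (simp add: finite_siblings)
        show "algebraic_int (of_int \<gamma> * X s)" if "j \<in> {1..i}" "s \<in> ?S j" for j s
          using sub that by (intro alg) blast
      qed
    qed
    finally show ?thesis .
  qed
  then show "algebraic_int (of_rat (tower_denom \<gamma> n X i * - tower_coeffs X i k) :: 'a)"
    unfolding scaled_tower_coeffs[OF k] by (rule algebraic_int_sum)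
qed

end

end

lemma complex_hom_exists: "\<exists>\<phi> :: 'a \<Rightarrow> complex. hom_on L \<phi>"
proof -
  define \<phi> :: "'a \<Rightarrow> complex" where "\<phi> y = of_rat (inv_into UNIV of_rat y)" for y
  have \<phi>: "\<phi> (of_rat r) = of_rat r" for r
    by (simp add: \<phi>_def inv_f_f inj_def)
  have "hom_on (K 1) \<phi>"
    unfolding hom_on_def
  proof (intro conjI ballI)
    show "\<phi> 1 = 1" using \<phi>[of 1] by simp
  next
    fix a b assume "a \<in> K 1" "b \<in> K 1"
    then obtain r s where rs: "a = of_rat r" "b = of_rat s"
      by (auto simp: rat_adjoin_empty)
    show "\<phi> (a + b) = \<phi> a + \<phi> b" "\<phi> (a * b) = \<phi> a * \<phi> b"
      unfolding rs of_rat_add [symmetric] of_rat_mult [symmetric] \<phi>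
      by (simp_all only: of_rat_add of_rat_mult)
  qed
  then show ?thesis
  proof -
    have "\<exists>\<psi>. hom_on L \<psi> \<and> (\<forall>y\<in>K 1. \<psi> y = \<phi> y)"
      using \<open>hom_on (K 1) \<phi>\<close> by (intro hom_on_extend_L alg_closed_imp_poly_has_root) auto
    then show ?thesis by blast
  qed
qed

lemma hom_cofactor:
  fixes \<phi> :: "'a \<Rightarrow> 'b::field_char_0"
  assumes "hom_on L \<phi>"
  shows "\<phi> (cofactor i X \<rho>) = cofactor i (\<lambda>j. \<phi> (X j)) \<rho>" and "cofactor i X \<rho> \<in> L"
proof -
  note S = subfield_K[of "X ` {1..n}"]
  note S' = S assms
  note mem = subfield_mult[OF S] subfield_power[OF S] subfield_of_int[OF S] diff_prod_in_L
  show "cofactor i X \<rho> \<in> L"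
    unfolding cofactor_def by (intro mem) auto
  show "\<phi> (cofactor i X \<rho>) = cofactor i (\<lambda>j. \<phi> (X j)) \<rho>"
    unfolding cofactor_def
    by (simp add: hom_on_mult[OF S'] hom_on_power[OF S'] hom_on_of_int[OF S'] hom_diff_prod[OF assms] mem)
qed

lemma hom_numerator:
  fixes \<phi> :: "'a \<Rightarrow> 'b::field_char_0"
  assumes "hom_on L \<phi>" "\<rho> \<in> G" "i \<in> {1..n}"
  shows "\<phi> (numerator i X \<rho> k) = numerator i (\<lambda>j. \<phi> (X j)) \<rho> k" and "numerator i X \<rho> k \<in> L"
proof -
  note S = subfield_K[of "X ` {1..n}"]
  note S' = S assms(1)
  let ?p = "\<lambda>Y j. \<Prod>s\<in>others \<rho> j. [:- Y s, 1:]"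
  have sib: "X s \<in> L" if "j \<in> {1..i}" "s \<in> others \<rho> j" for j s
    using that siblings_subset[of j \<rho>] assms(3) by (intro X_in_L) auto
  have over: "?p X j \<in> polys_over L" if "j \<in> {1..i}" for j
    using that by (intro polys_over_prod[OF S] polys_over_linear[OF S] sib)
  have c: "\<phi> (coeff (?p X j) m) = coeff (?p (\<lambda>j. \<phi> (X j)) j) m" if "j \<in> {1..i}" for j m
  proof -
    have "map_poly \<phi> (?p X j) = (\<Prod>s\<in>others \<rho> j. map_poly \<phi> [:- X s, 1:])"
      using that by (intro map_poly_hom_prod[OF S'] polys_over_linear[OF S] sib)
    also have "\<dots> = ?p (\<lambda>j. \<phi> (X j)) j"
      using that by (intro prod.cong refl map_poly_hom_linear[OF S'] sib)
    finally show ?thesis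
      using coeff_map_poly_hom[OF S', of "?p X j" m] by simp
  qed
  have x: "X (\<rho> i) \<in> L" by (rule X_in_L[OF G_in[OF assms(2,3)]])
  have prod_in: "(\<Prod>j\<in>{1..i}. coeff (?p X j) (d j - k j)) \<in> L"
    by (intro subfield_prod[OF S] polys_overD over)
  show "numerator i X \<rho> k \<in> L"
    unfolding numerator_def by (intro subfield_mult[OF S] subfield_power[OF S] x prod_in)
  have "\<phi> (\<Prod>j\<in>{1..i}. coeff (?p X j) (d j - k j)) = (\<Prod>j\<in>{1..i}. \<phi> (coeff (?p X j) (d j - k j)))"
    by (intro hom_on_prod[OF S'] polys_overD over)
  also have "\<dots> = (\<Prod>j\<in>{1..i}. coeff (?p (\<lambda>j. \<phi> (X j)) j) (d j - k j))"
    by (intro prod.cong refl c)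
  finally show "\<phi> (numerator i X \<rho> k) = numerator i (\<lambda>j. \<phi> (X j)) \<rho> k"
    unfolding numerator_def hom_on_mult[OF S' subfield_power[OF S x] prod_in] hom_on_power[OF S' x]
    by simp
qed

lemma norm_diff_prod_le:
  fixes z :: "nat \<Rightarrow> complex"
  assumes "A \<subseteq> pairs" "D \<ge> 0"
    and "\<And>r s. r \<in> {1..n} \<Longrightarrow> s \<in> {1..n} \<Longrightarrow> r \<noteq> s \<Longrightarrow> cmod (z r - z s) \<le> D"
  shows "cmod (diff_prod z A) \<le> D ^ card A"
proof -
  have "cmod (diff_prod z A) = (\<Prod>a\<in>A. cmod (case a of (r, s) \<Rightarrow> z r - z s))"
    by (simp add: diff_prod_def prod_norm)
  also have "\<dots> \<le> (\<Prod>a\<in>A. D)"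
    using assms by (intro prod_mono) (auto simp: pairs_def)
  finally show ?thesis by simp
qed

lemma norm_scaled_tower_coeffs_le:
  fixes \<gamma> :: int
  assumes R: "left_coset_reps G (perm_stab G i) R" and i: "i \<in> {1..n}" and k: "k \<in> tower_idx X i"
    and "D > 0" "M > 0"
    and M: "\<And>z :: complex. poly (map_poly of_rat f) z = 0 \<Longrightarrow> cmod z < M"
    and D: "\<And>z z' :: complex. poly (map_poly of_rat f) z = 0 \<Longrightarrow> poly (map_poly of_rat f) z' = 0 \<Longrightarrow>
              z \<noteq> z' \<Longrightarrow> cmod (z - z') < D"
  shows "\<bar>of_rat (tower_denom \<gamma> n X i * - tower_coeffs X i k)\<bar> \<le> tower_bound \<gamma> D M n X i"
proof -
  obtain \<phi> :: "'a \<Rightarrow> complex" where \<phi>: "hom_on L \<phi>"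
    using complex_hom_exists by blast
  note S = subfield_K[of "X ` {1..n}"]
  note S' = S \<phi>
  define z where "z j = \<phi> (X j)" for j
  have root: "poly (map_poly of_rat f) (z j) = 0" if "j \<in> {1..n}" for j
  proof -
    have "poly (map_poly \<phi> (map_poly of_rat f)) (z j) = \<phi> (poly (map_poly of_rat f) (X j))"
      unfolding z_def using that by (intro poly_map_poly_hom[OF S'] f_over S X_in_L)
    also have "\<dots> = 0"
      using that root_iff[of "X j"] by (simp add: hom_on_0[OF S'])
    finally show ?thesis
      by (simp add: hom_on_map_poly_of_rat[OF S'])
  qed
  have sign: "cmod (of_int disc_sign) = 1"
    using abs_disc_sign by (metis norm_of_int of_int_abs of_int_1)
  have zM: "cmod (z j) \<le> M" if "j \<in> {1..n}" for j
    using M[OF root[OF that]] by simp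
  have zD: "cmod (z r - z s) \<le> D" if "r \<in> {1..n}" "s \<in> {1..n}" "r \<noteq> s" for r s
  proof -
    have "X r \<noteq> X s" using inj_onD[OF inj _ that(1,2)] that(3) by blast
    then have "z r \<noteq> z s"
      unfolding z_def hom_on_eq_iff[OF S' X_in_L[OF that(1)] X_in_L[OF that(2)]] .
    then show ?thesis
      using D[OF root[OF that(1)] root[OF that(2)]] by simp
  qed
  define A where "A = (\<Sum>j\<in>{1..i}. d j - 1)"
  define B where "B = (\<Sum>j\<in>{1..i}. k j - 1)"
  have A_le: "A \<le> n * (n - 1)" "A \<le> n * (n - 1) * halves i"
  proof -
    show A1: "A \<le> n * (n - 1)" unfolding A_def by (rule sum_d_le[OF R i])
    have "n * (n - 1) * 1 \<le> n * (n - 1) * halves i"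
      using i by (intro mult_le_mono2 halves_ge_1) auto
    with A1 show "A \<le> n * (n - 1) * halves i" by (metis mult.right_neutral order.trans)
  qed
  have kd: "1 \<le> k j" "k j \<le> d j" if "j \<in> {1..i}" for j
    using k that by (auto simp: tower_idx_def PiE_iff)
  define T where "T = \<bar>of_int \<gamma>\<bar> ^ weight i * D ^ (n * (n - 1) * halves i - A) *
    (M ^ d i * (\<Prod>j\<in>{1..i}. real ((d j - 1) choose (k j - 1)) * M ^ (k j - 1)))"
  have T: "cmod (of_int \<gamma> ^ weight i * cofactor i z \<rho> * numerator i z \<rho> k) \<le> T" if "\<rho> \<in> R" for \<rho>
  proof -
    have \<rho>: "\<rho> \<in> G" using R_G[OF R i that] .
    have "cmod (cofactor i z \<rho>) = cmod (diff_prod z pairs) ^ (halves i - 1) * cmod (diff_prod z (pairs - used_pairs i \<rho>))"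
      by (simp add: cofactor_def norm_mult norm_power sign del: norm_of_int)
    also have "\<dots> \<le> (D ^ card pairs) ^ (halves i - 1) * D ^ card (pairs - used_pairs i \<rho>)"
      using \<open>D > 0\<close> zD by (intro mult_mono power_mono norm_diff_prod_le) auto
    also have "\<dots> = D ^ (n * (n - 1) * (halves i - 1) + (n * (n - 1) - A))"
      by (simp add: power_add power_mult card_pairs card_unused[OF R i \<rho>] A_def)
    also have "n * (n - 1) * (halves i - 1) + (n * (n - 1) - A) = n * (n - 1) * halves i - A"
      using weight_eq[OF R i \<rho>] A_le by (simp add: card_unused[OF R i \<rho>] A_def)
    finally have 1: "cmod (cofactor i z \<rho>) \<le> D ^ (n * (n - 1) * halves i - A)" .
    have "cmod (coeff (\<Prod>s\<in>others \<rho> j. [:- z s, 1:]) (d j - k j))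
        \<le> real ((d j - 1) choose (k j - 1)) * M ^ (k j - 1)" if j: "j \<in> {1..i}" for j
    proof -
      have j': "j \<in> {1..n}" using j i by auto
      have "cmod (coeff (\<Prod>s\<in>others \<rho> j. [:- z s, 1:]) (d j - k j))
          \<le> real (card (others \<rho> j) choose (d j - k j)) *
            M ^ (card (others \<rho> j) - (d j - k j))"
        using \<open>M > 0\<close> siblings_subset[OF j', of \<rho>] finite_siblings
        by (intro norm_coeff_prod_linear_le zM) auto
      also have "\<dots> = real ((d j - 1) choose (d j - k j)) * M ^ (d j - 1 - (d j - k j))"
        by (simp add: card_other_siblings[OF \<rho> j'])
      also have "d j - 1 - (d j - k j) = k j - 1"
        using kd[OF j] by linarith
      also have "(d j - 1) choose (d j - k j) = (d j - 1) choose (k j - 1)"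
        using kd[OF j] by (subst binomial_symmetric) auto
      finally show ?thesis .
    qed
    then have 2: "cmod (numerator i z \<rho> k) \<le> M ^ d i * (\<Prod>j\<in>{1..i}. real ((d j - 1) choose (k j - 1)) * M ^ (k j - 1))"
      unfolding numerator_def norm_mult norm_power prod_norm [symmetric] using \<open>M > 0\<close>
      by (intro mult_mono power_mono prod_mono zM G_in[OF \<rho> i] prod_nonneg conjI) auto
    show ?thesis
      unfolding norm_mult norm_power T_def norm_of_int using \<open>D > 0\<close>
      by (intro mult_mono 1 2) auto
  qed
  have "of_rat (tower_denom \<gamma> n X i * - tower_coeffs X i k)
      = \<phi> (of_rat (tower_denom \<gamma> n X i * - tower_coeffs X i k))"
    by (simp only: hom_on_of_rat[OF S'])
  also have "\<dots> = (\<Sum>\<rho>\<in>R. of_int \<gamma> ^ weight i * cofactor i z \<rho> * numerator i z \<rho> k)"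
  proof -
    have *: "of_int \<gamma> ^ weight i * cofactor i X \<rho> * numerator i X \<rho> k \<in> L"
      "\<phi> (of_int \<gamma> ^ weight i * cofactor i X \<rho> * numerator i X \<rho> k)
        = of_int \<gamma> ^ weight i * cofactor i z \<rho> * numerator i z \<rho> k" if "\<rho> \<in> R" for \<rho>
    proof -
      have \<rho>: "\<rho> \<in> G" using R_G[OF R i that] .
      note mem = hom_cofactor(2)[OF \<phi>, of i \<rho>] hom_numerator(2)[OF \<phi> \<rho> i, of k]
        subfield_power[OF S subfield_of_int[OF S]]
      show "of_int \<gamma> ^ weight i * cofactor i X \<rho> * numerator i X \<rho> k \<in> L"
        by (intro subfield_mult[OF S] mem)
      show "\<phi> (of_int \<gamma> ^ weight i * cofactor i X \<rho> * numerator i X \<rho> k)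
        = of_int \<gamma> ^ weight i * cofactor i z \<rho> * numerator i z \<rho> k"
        unfolding hom_on_mult[OF S' subfield_mult[OF S mem(3) mem(1)] mem(2)] hom_on_mult[OF S' mem(3) mem(1)]
          hom_on_power[OF S' subfield_of_int[OF S]] hom_on_of_int[OF S'] hom_cofactor(1)[OF \<phi>]
          hom_numerator(1)[OF \<phi> \<rho> i] z_def ..
    qed
    show ?thesis
      unfolding scaled_tower_coeffs[OF R i k] by (subst hom_on_sum[OF S']) (simp_all add: *)
  qed
  finally have "cmod (of_rat (tower_denom \<gamma> n X i * - tower_coeffs X i k)) \<le> (\<Sum>\<rho>\<in>R. T)"
    by (simp only:) (intro sum_norm_le T)
  moreover have "cmod (of_rat r) = \<bar>of_rat r\<bar>" for r
    by (cases r) (simp add: of_rat_rat norm_divide)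
  ultimately have le: "\<bar>of_rat (tower_denom \<gamma> n X i * - tower_coeffs X i k)\<bar> \<le> real (card R) * T"
    by simp
  have "(\<Sum>j\<in>{1..i}. int (k j)) - int i = int B"
  proof -
    have "int B = (\<Sum>j\<in>{1..i}. int (k j) - 1)"
      unfolding B_def of_nat_sum using kd by (intro sum.cong refl) (simp add: of_nat_diff)
    then show ?thesis by (simp add: sum_subtractf)
  qed
  then have eM: "M powi ((\<Sum>j\<in>{1..i}. int (k j)) - int i + int (d i)) = M ^ d i * M ^ B"
    by (metis power_int_of_nat of_nat_add power_add mult.commute)
  have "int (n * (n - 1) * halves i) - (\<Sum>j\<in>{1..i}. int (d j)) + int i = int (n * (n - 1) * halves i - A)"
  proof -
    have "int A = (\<Sum>j\<in>{1..i}. int (d j) - 1)"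
      unfolding A_def of_nat_sum using kd
      by (intro sum.cong refl) (metis of_nat_1 of_nat_diff order.trans)
    then show ?thesis using A_le(2) by (simp add: sum_subtractf of_nat_diff)
  qed
  then have eD: "D powi (int (n * (n - 1) * halves i) - (\<Sum>j\<in>{1..i}. int (d j)) + int i)
      = D ^ (n * (n - 1) * halves i - A)"
    by (simp only: power_int_of_nat)
  have "real (card R) * T = (\<Prod>j\<in>{1..i}. real (d j)) *
      real_of_int \<bar>\<gamma>\<bar> ^ weight i * (\<Prod>j\<in>{1..i}. real ((d j - 1) choose (k j - 1))) *
      M powi ((\<Sum>j\<in>{1..i}. int (k j)) - int i + int (d i)) *
      D powi (int (n * (n - 1) * halves i) - (\<Sum>j\<in>{1..i}. int (d j)) + int i)"
    unfolding eM eD by (simp add: T_def card_R[OF R i] prod.distrib power_sum [symmetric] B_def)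
  also have "\<dots> \<le> tower_bound \<gamma> D M n X i"
    unfolding tower_bound_def using k by (intro Max_ge) auto
  finally show ?thesis using le by linarith
qed

lemma tower_denom_le_bound: "\<bar>of_rat (tower_denom \<gamma> n X i)\<bar> \<le> tower_bound \<gamma> D M n X i"
  unfolding tower_bound_def by (intro Max_ge) auto

end

section \<open>Reduction modulo a prime power\<close>

lemma lift_exponent_bound:
  assumes "p \<ge> 2" "\<Lambda> \<ge> 1"
  shows "lift_exponent p \<Lambda> \<ge> 1" and "2 * \<Lambda> - 1 < real p ^ lift_exponent p \<Lambda>"
proof -
  define y where "y = ln (2 * \<Lambda> - 1) / ln (real p)"
  have lnp: "ln (real p) > 0" using assms by simp
  have "y \<ge> 0" using assms lnp by (simp add: y_def)
  then have fl: "\<lfloor>y\<rfloor> \<ge> 0" by simp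
  have e: "lift_exponent p \<Lambda> = nat (\<lfloor>y\<rfloor> + 1)"
    by (simp add: lift_exponent_def y_def)
  then show "lift_exponent p \<Lambda> \<ge> 1" using fl by linarith
  have "y < real (lift_exponent p \<Lambda>)"
    unfolding e using fl by (simp add: real_of_int_floor_add_one_gt)
  then have "real p powr y < real p powr real (lift_exponent p \<Lambda>)"
    using assms by (intro powr_less_mono) auto
  also have "\<dots> = real p ^ lift_exponent p \<Lambda>"
    using assms by (intro powr_realpow) auto
  also have "real p powr y = 2 * \<Lambda> - 1"
    using assms lnp by (simp add: powr_def y_def)
  finally show "2 * \<Lambda> - 1 < real p ^ lift_exponent p \<Lambda>" .
qed

context root_tower
begin

context
  fixes h :: "'b::comm_ring_1 \<Rightarrow> 'c::comm_ring_1"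
  assumes h: "comm_ring_hom h"
begin

interpretation h: comm_ring_hom h by (rule h)
interpretation hp: map_poly_comm_ring_hom h ..

lemma diff_prod_ring_hom: "diff_prod (\<lambda>j. h (Y j)) A = h (diff_prod Y A)"
  by (simp add: diff_prod_def h.hom_prod split_def h.hom_minus)

lemma cofactor_ring_hom: "cofactor i (\<lambda>j. h (Y j)) \<rho> = h (cofactor i Y \<rho>)"
  by (simp add: cofactor_def diff_prod_ring_hom h.hom_mult h.hom_power h.hom_of_int)

lemma numerator_ring_hom: "numerator i (\<lambda>j. h (Y j)) \<rho> k = h (numerator i Y \<rho> k)"
proof -
  have "coeff (\<Prod>s\<in>S. [:- h (Y s), 1:]) m = h (coeff (\<Prod>s\<in>S. [:- Y s, 1:]) m)" for S m
  proof -
    have "map_poly h (\<Prod>s\<in>S. [:- Y s, 1:]) = (\<Prod>s\<in>S. [:- h (Y s), 1:])"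
      by (simp add: hp.hom_prod h.map_poly_pCons_hom h.hom_uminus)
    then show ?thesis
      by (metis h.coeff_map_poly_hom)
  qed
  then show ?thesis
    by (simp add: numerator_def h.hom_mult h.hom_power h.hom_prod)
qed

end

end

lemma (in hensel_setup) root_tower_padic_zeros:
  fixes x :: "nat \<Rightarrow> 'p padic_int"
  assumes "padic_zeros f n x"
  shows "root_tower f n (\<lambda>j. to_fract (x j))"
  using padic_zeros_split[OF assms] by unfold_locales

lemma comm_ring_hom_to_fract: "comm_ring_hom (to_fract :: 'a::idom \<Rightarrow> 'a fract)"
  by unfold_locales auto

locale lifted_tower = hensel_setup f F c n ty for f F c n and ty :: "'p::prime_card itself" +
  fixes x :: "nat \<Rightarrow> 'p padic_int" and \<gamma> :: int and i :: nat and R :: "(nat \<Rightarrow> nat) set" and e :: nat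
  assumes x: "padic_zeros f n x"
    and \<gamma>: "\<gamma> \<noteq> 0" "\<And>j. j \<in> {1..n} \<Longrightarrow> algebraic_int (of_int \<gamma> * to_fract (x j) :: 'p padic)"
    and i: "i \<in> {1..n}"
    and R: "left_coset_reps (galois_perms n (\<lambda>j. to_fract (x j) :: 'p padic))
              (perm_stab (galois_perms n (\<lambda>j. to_fract (x j) :: 'p padic)) i) R"
    and e: "e \<ge> 1"
begin

sublocale root_tower f n "\<lambda>j. to_fract (x j) :: 'p padic"
  by (rule root_tower_padic_zeros[OF x])

abbreviation "X \<equiv> \<lambda>j. to_fract (x j) :: 'p padic"
abbreviation "r \<equiv> \<lambda>j. padic_residue e (x j)"
abbreviation "residue_poly \<rho> j \<equiv> \<Prod>s\<in>others \<rho> j. [:- r s, 1:]"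
abbreviation "scaled_cofactor \<rho> \<equiv> of_int \<gamma> ^ weight i * cofactor i x \<rho>"

definition \<Delta> :: int where "\<Delta> = \<lfloor>tower_denom \<gamma> n X i\<rfloor>"

lemma of_int_\<Delta>: "rat_of_int \<Delta> = tower_denom \<gamma> n X i"
  unfolding \<Delta>_def using tower_denom_Ints[OF R i \<gamma>(2)] by (auto elim: Ints_cases)

definition H :: "(nat \<Rightarrow> nat) \<Rightarrow> int" where "H k = \<lfloor>tower_denom \<gamma> n X i * - tower_coeffs X i k\<rfloor>"

lemma of_int_H: "k \<in> tower_idx X i \<Longrightarrow> rat_of_int (H k) = tower_denom \<gamma> n X i * - tower_coeffs X i k"
  unfolding H_def using scaled_tower_coeffs_Ints[OF R i \<gamma>(2), of k] by (auto elim: Ints_cases)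

interpretation tf: inj_comm_ring_hom "to_fract :: 'p padic_int \<Rightarrow> 'p padic"
  by unfold_locales auto

lemma padic_H:
  assumes k: "k \<in> tower_idx X i"
  shows "(of_int (H k) :: 'p padic_int) = (\<Sum>\<rho>\<in>R. scaled_cofactor \<rho> * numerator i x \<rho> k)"
proof -
  have "(of_int (H k) :: 'p padic) = of_rat (of_int (H k))" by simp
  also have "\<dots> = (\<Sum>\<rho>\<in>R. of_int \<gamma> ^ weight i * cofactor i X \<rho> * numerator i X \<rho> k)"
    unfolding of_int_H[OF k] by (rule scaled_tower_coeffs[OF R i k])
  also have "\<dots> = to_fract (\<Sum>\<rho>\<in>R. scaled_cofactor \<rho> * numerator i x \<rho> k)"
    by (simp only: cofactor_ring_hom[OF comm_ring_hom_to_fract] numerator_ring_hom[OF comm_ring_hom_to_fract]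
        tf.hom_sum tf.hom_mult tf.hom_power tf.hom_of_int)
  finally have "to_fract (of_int (H k) :: 'p padic_int)
      = to_fract (\<Sum>\<rho>\<in>R. scaled_cofactor \<rho> * numerator i x \<rho> k)"
    by (simp only: to_fract_of_int)
  then show ?thesis by (simp only: to_fract_eq_iff)
qed

lemma padic_\<Delta>:
  assumes \<rho>: "\<rho> \<in> G"
  shows "(of_int \<Delta> :: 'p padic_int) = scaled_cofactor \<rho> *
    (\<Prod>j\<in>{1..i}. \<Prod>s\<in>others \<rho> j. x (\<rho> j) - x s)"
proof -
  have "(of_int \<Delta> :: 'p padic) = of_rat (of_int \<Delta>)" by simp
  also have "\<dots> = of_int \<gamma> ^ weight i * (cofactor i X \<rho> * diff_prod X (used_pairs i \<rho>))"
    unfolding of_int_\<Delta> cofactor_mult[OF \<rho> i] by (rule tower_denom_eq)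
  also have "\<dots> = to_fract (of_int \<gamma> ^ weight i * (cofactor i x \<rho> * diff_prod x (used_pairs i \<rho>)))"
    by (simp only: cofactor_ring_hom[OF comm_ring_hom_to_fract] diff_prod_ring_hom[OF comm_ring_hom_to_fract]
        tf.hom_mult tf.hom_power tf.hom_of_int)
  finally have "to_fract (of_int \<Delta> :: 'p padic_int)
      = to_fract (of_int \<gamma> ^ weight i * (cofactor i x \<rho> * diff_prod x (used_pairs i \<rho>)))"
    by (simp only: to_fract_of_int)
  then show ?thesis by (simp only: to_fract_eq_iff diff_prod_used_pairs[OF \<rho>] mult.assoc)
qed

lemma others_subset: "j \<in> {1..i} \<Longrightarrow> others \<rho> j \<subseteq> {1..n}"
  using siblings_subset[of j \<rho>] i by auto

lemma finite_others: "finite (others \<rho> j)"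
  by (simp add: finite_siblings)

lemma inj_on_residues: "inj_on r {1..n}"
proof (rule inj_onI, rule ccontr)
  fix j l assume jl: "j \<in> {1..n}" "l \<in> {1..n}" "r j = r l" "j \<noteq> l"
  then have "coprime 0 (int CARD('p) ^ e)"
    using coprime_residue_diff[OF x jl(1,2,4) e] by simp
  moreover have "CARD('p) > 1" by (rule nontriv)
  ultimately show False
    using e by simp
qed

lemma residue_siblings_eq:
  assumes \<rho>: "\<rho> \<in> G" and j: "j \<in> {1..n}"
  shows "residue_siblings G x e \<rho> j = r ` others \<rho> j"
proof -
  have "residue_siblings G x e \<rho> j = r ` siblings G j \<rho> - {r (\<rho> j)}"
    unfolding residue_siblings_def siblings_def by blast
  also have "\<dots> = r ` others \<rho> j"
  proof -
    have "r ` (siblings G j \<rho> - {\<rho> j}) = r ` siblings G j \<rho> - r ` {\<rho> j}"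
      using siblings_subset[OF j] G_in[OF \<rho> j] by (intro inj_on_image_set_diff[OF inj_on_residues]) auto
    then show ?thesis by simp
  qed
  finally show ?thesis .
qed

abbreviation "inv_res \<rho> j s \<equiv> modular_inverse (int CARD('p) ^ e) (r (\<rho> j) - r s)"

lemma coeff_residue_poly:
  assumes \<rho>: "\<rho> \<in> G" and j: "j \<in> {1..i}"
  shows "coeff (\<Prod>y\<in>residue_siblings G x e \<rho> j. smult (modular_inverse (int CARD('p) ^ e) (r (\<rho> j) - y)) [:- y, 1:]) m
    = (\<Prod>s\<in>others \<rho> j. inv_res \<rho> j s) * coeff (residue_poly \<rho> j) m"
proof -
  have j': "j \<in> {1..n}" using j i by auto
  have "inj_on r (others \<rho> j)"
    by (rule inj_on_subset[OF inj_on_residues others_subset[OF j]])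
  then show ?thesis
    unfolding residue_siblings_eq[OF \<rho> j'] by (simp only: prod.reindex o_def prod_smult coeff_smult)
qed

lemma cong_\<Delta>_inverses:
  assumes \<rho>: "\<rho> \<in> G"
  shows "[\<Delta> * (\<Prod>j\<in>{1..i}. \<Prod>s\<in>others \<rho> j. inv_res \<rho> j s)
    = padic_residue e (scaled_cofactor \<rho>)] (mod int CARD('p) ^ e)"
proof -
  let ?C = "scaled_cofactor \<rho>"
  let ?I = "\<Prod>j\<in>{1..i}. \<Prod>s\<in>others \<rho> j. inv_res \<rho> j s"
  let ?D = "\<Prod>j\<in>{1..i}. \<Prod>s\<in>others \<rho> j. r (\<rho> j) - r s"
  have "[padic_residue e (\<Prod>j\<in>{1..i}. \<Prod>s\<in>others \<rho> j. x (\<rho> j) - x s) = ?D] (mod int CARD('p) ^ e)"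
    by (intro cong_trans[OF cong_padic_residue_prod] cong_prod cong_padic_residue_diff)
  then have "[padic_residue e (of_int \<Delta> :: 'p padic_int) = padic_residue e ?C * ?D] (mod int CARD('p) ^ e)"
    unfolding padic_\<Delta>[OF \<rho>] by (intro cong_trans[OF cong_padic_residue_mult] cong_mult cong_refl)
  then have "[\<Delta> = padic_residue e ?C * ?D] (mod int CARD('p) ^ e)"
    by (rule cong_trans[OF cong_sym[OF cong_padic_residue_of_int]])
  then have "[\<Delta> * ?I = padic_residue e ?C * ?D * ?I] (mod int CARD('p) ^ e)"
    by (intro cong_mult cong_refl)
  also have "padic_residue e ?C * ?D * ?I
      = padic_residue e ?C * (\<Prod>j\<in>{1..i}. \<Prod>s\<in>others \<rho> j. (r (\<rho> j) - r s) * inv_res \<rho> j s)"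
    by (simp only: prod.distrib mult.assoc)
  also have "[\<dots> = padic_residue e ?C * (\<Prod>j\<in>{1..i}. \<Prod>s\<in>others \<rho> j. 1)] (mod int CARD('p) ^ e)"
  proof (intro cong_mult cong_refl cong_prod)
    fix j s assume j: "j \<in> {1..i}" and s: "s \<in> others \<rho> j"
    have j': "j \<in> {1..n}" using j i by auto
    have "s \<in> {1..n}" "\<rho> j \<noteq> s"
      using others_subset[OF j] s by blast+
    then show "[(r (\<rho> j) - r s) * inv_res \<rho> j s = 1] (mod int CARD('p) ^ e)"
      by (intro cong_modular_inverse1 coprime_residue_diff[OF x G_in[OF \<rho> j'] _ _ e])
  qed
  finally show ?thesis by simp
qed

lemma cong_H:
  assumes k: "k \<in> tower_idx X i"
  shows "[H k = (\<Sum>\<rho>\<in>R. padic_residue e (scaled_cofactor \<rho>) *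
    (r (\<rho> i) ^ d i * (\<Prod>j\<in>{1..i}. coeff (residue_poly \<rho> j) (d j - k j))))] (mod int CARD('p) ^ e)"
proof -
  have num: "[padic_residue e (numerator i x \<rho> k)
      = r (\<rho> i) ^ d i * (\<Prod>j\<in>{1..i}. coeff (residue_poly \<rho> j) (d j - k j))] (mod int CARD('p) ^ e)" for \<rho>
    unfolding numerator_def
    by (rule cong_trans[OF cong_padic_residue_mult cong_mult[OF cong_padic_residue_power
          cong_trans[OF cong_padic_residue_prod cong_prod[OF cong_coeff_prod_linear[OF finite_others]]]]])
  have "[H k = padic_residue e (of_int (H k) :: 'p padic_int)] (mod int CARD('p) ^ e)"
    by (rule cong_sym[OF cong_padic_residue_of_int])
  also have "[padic_residue e (of_int (H k) :: 'p padic_int)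
      = (\<Sum>\<rho>\<in>R. padic_residue e (scaled_cofactor \<rho> * numerator i x \<rho> k))] (mod int CARD('p) ^ e)"
    unfolding padic_H[OF k] by (rule cong_padic_residue_sum)
  also have "[(\<Sum>\<rho>\<in>R. padic_residue e (scaled_cofactor \<rho> * numerator i x \<rho> k))
    = (\<Sum>\<rho>\<in>R. padic_residue e (scaled_cofactor \<rho>) *
    (r (\<rho> i) ^ d i * (\<Prod>j\<in>{1..i}. coeff (residue_poly \<rho> j) (d j - k j))))] (mod int CARD('p) ^ e)"
    by (rule cong_sum, rule cong_trans[OF cong_padic_residue_mult cong_mult[OF cong_refl num]])
  finally show ?thesis .
qed

abbreviation "P \<equiv> interp_poly G R x e \<Delta> (d i) i"

lemma lookup_P:
  assumes "\<And>l. l \<notin> {1..i} \<Longrightarrow> Poly_Mapping.lookup m l = 0"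
  shows "Poly_Mapping.lookup P m = \<Delta> * ((if Poly_Mapping.single i (d i) = m then 1 else 0) -
     (\<Sum>\<rho>\<in>R. r (\<rho> i) ^ d i * (\<Prod>j\<in>{1..i}. (\<Prod>s\<in>others \<rho> j. inv_res \<rho> j s) *
        coeff (residue_poly \<rho> j) (Poly_Mapping.lookup m j))))"
proof -
  have eq: "r (\<rho> i) ^ d i * (if \<forall>l. l \<notin> {1..i} \<longrightarrow> Poly_Mapping.lookup m l = 0
        then \<Prod>j\<in>{1..i}. coeff (\<Prod>y\<in>residue_siblings G x e \<rho> j.
           smult (modular_inverse (int CARD('p) ^ e) (r (\<rho> j) - y)) [:- y, 1:]) (Poly_Mapping.lookup m j) else 0)
      = r (\<rho> i) ^ d i * (\<Prod>j\<in>{1..i}. (\<Prod>s\<in>others \<rho> j. inv_res \<rho> j s) *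
        coeff (residue_poly \<rho> j) (Poly_Mapping.lookup m j))" if "\<rho> \<in> R" for \<rho>
  proof -
    have \<rho>: "\<rho> \<in> G" by (rule R_G[OF R i that])
    have "(\<forall>l. l \<notin> {1..i} \<longrightarrow> Poly_Mapping.lookup m l = 0) = True"
      using assms by blast
    then show ?thesis
      by (simp only: if_True) (intro arg_cong2[where f = "(*)"] refl prod.cong coeff_residue_poly[OF \<rho>])
  qed
  show ?thesis
    unfolding lookup_interp_poly
    by (rule arg_cong2[where f = "(*)", OF refl], rule arg_cong2[where f = "(-)", OF refl],
        rule sum.cong[OF refl], rule eq)
qed

lemma lookup_P_high_degree:
  assumes "\<And>l. l \<notin> {1..i} \<Longrightarrow> Poly_Mapping.lookup m l = 0" "j \<in> {1..i}" "Poly_Mapping.lookup m j \<ge> d j"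
  shows "Poly_Mapping.lookup P m = \<Delta> * (if Poly_Mapping.single i (d i) = m then 1 else 0)"
proof -
  have j: "j \<in> {1..n}" using assms(2) i by auto
  have "(\<Prod>j\<in>{1..i}. (\<Prod>s\<in>others \<rho> j. inv_res \<rho> j s) *
        coeff (residue_poly \<rho> j) (Poly_Mapping.lookup m j)) = 0" if "\<rho> \<in> R" for \<rho>
  proof (rule prod_zero)
    have \<rho>: "\<rho> \<in> G" by (rule R_G[OF R i that])
    have "degree (residue_poly \<rho> j) \<le> (\<Sum>s\<in>others \<rho> j. degree [:- r s, 1:])"
      using finite_others by (rule order.trans[OF degree_prod_sum_le]) (simp add: o_def)
    also have "\<dots> = d j - 1"
      using card_other_siblings[OF \<rho> j] by simp
    also have "\<dots> < Poly_Mapping.lookup m j"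
      using tower_deg_pos[OF j] assms(3) by linarith
    finally have "coeff (residue_poly \<rho> j) (Poly_Mapping.lookup m j) = 0"
      by (rule coeff_eq_0)
    then show "\<exists>j\<in>{1..i}. (\<Prod>s\<in>others \<rho> j. inv_res \<rho> j s) *
        coeff (residue_poly \<rho> j) (Poly_Mapping.lookup m j) = 0"
      using assms(2) by (intro bexI[of _ j]) simp_all
  qed simp
  then have "(\<Sum>\<rho>\<in>R. r (\<rho> i) ^ d i * (\<Prod>j\<in>{1..i}. (\<Prod>s\<in>others \<rho> j. inv_res \<rho> j s) *
        coeff (residue_poly \<rho> j) (Poly_Mapping.lookup m j))) = 0"
    by (intro sum.neutral) simp
  then show ?thesis
    using assms(1) by (subst lookup_P) simp_all
qed

lemma cong_lookup_P:
  assumes k: "k \<in> tower_idx X i"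
  shows "[Poly_Mapping.lookup P (exponents i (\<lambda>j. d j - k j)) = - H k] (mod int CARD('p) ^ e)"
proof -
  let ?m = "exponents i (\<lambda>j. d j - k j)"
  let ?c = "\<lambda>\<rho>. \<Prod>j\<in>{1..i}. coeff (residue_poly \<rho> j) (d j - k j)"
  let ?I = "\<lambda>\<rho>. \<Prod>j\<in>{1..i}. \<Prod>s\<in>others \<rho> j. inv_res \<rho> j s"
  have ne: "Poly_Mapping.single i (d i) \<noteq> ?m"
    using exponents_neq_single[OF k] i by (metis atLeastAtMost_iff)
  have c: "(\<Prod>j\<in>{1..i}. (\<Prod>s\<in>others \<rho> j. inv_res \<rho> j s) *
        coeff (residue_poly \<rho> j) (Poly_Mapping.lookup ?m j)) = ?I \<rho> * ?c \<rho>" for \<rho>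
    unfolding prod.distrib [symmetric] by (intro prod.cong refl) (simp add: lookup_exponents)
  have eq: "Poly_Mapping.lookup P ?m = - (\<Sum>\<rho>\<in>R. (\<Delta> * ?I \<rho>) * (r (\<rho> i) ^ d i * ?c \<rho>))"
  proof -
    have "Poly_Mapping.lookup P ?m = \<Delta> * ((if Poly_Mapping.single i (d i) = ?m then 1 else 0) -
        (\<Sum>\<rho>\<in>R. r (\<rho> i) ^ d i * (?I \<rho> * ?c \<rho>)))"
      unfolding c [symmetric] by (rule lookup_P) (auto simp: lookup_exponents)
    then show ?thesis
      using ne by (simp add: sum_distrib_left mult_ac)
  qed
  have "[(\<Sum>\<rho>\<in>R. (\<Delta> * ?I \<rho>) * (r (\<rho> i) ^ d i * ?c \<rho>))
      = (\<Sum>\<rho>\<in>R. padic_residue e (scaled_cofactor \<rho>) *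
          (r (\<rho> i) ^ d i * ?c \<rho>))] (mod int CARD('p) ^ e)"
    by (rule cong_sum, rule cong_mult[OF cong_\<Delta>_inverses[OF R_G[OF R i]] cong_refl])
  from cong_trans[OF this cong_sym[OF cong_H[OF k]]] show ?thesis
    unfolding eq cong_minus_minus_iff .
qed

lemma lifted_coefficient:
  assumes "D > 0" "M > 0"
    and M: "\<And>z :: complex. poly (map_poly of_rat f) z = 0 \<Longrightarrow> cmod z < M"
    and D: "\<And>z z' :: complex. poly (map_poly of_rat f) z = 0 \<Longrightarrow> poly (map_poly of_rat f) z' = 0 \<Longrightarrow>
              z \<noteq> z' \<Longrightarrow> cmod (z - z') < D"
  shows "\<exists>t. rat_of_int t = tower_denom \<gamma> n X i * Poly_Mapping.lookup (tower_hat X i) m \<and>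
    [Poly_Mapping.lookup P m = t] (mod int CARD('p) ^ e) \<and> \<bar>real_of_int t\<bar> \<le> tower_bound \<gamma> D M n X i"
proof -
  have i1: "i \<ge> 1" "i \<in> {1..i}" using i by auto
  have real_of_rat_int: "real_of_int t = of_rat (rat_of_int t)" for t by simp
  have bound_nonneg: "0 \<le> tower_bound \<gamma> D M n X i"
    by (rule order.trans[OF abs_ge_zero tower_denom_le_bound])
  consider (lead) "Poly_Mapping.single i (d i) = m"
    | (tower) k where "k \<in> tower_idx X i" "exponents i (\<lambda>j. d j - k j) = m"
    | (other) "Poly_Mapping.single i (d i) \<noteq> m" "\<And>k. k \<in> tower_idx X i \<Longrightarrow> exponents i (\<lambda>j. d j - k j) \<noteq> m"
    by blast
  then show ?thesis
  proof cases
    case lead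
    have "(\<Sum>k\<in>tower_idx X i. if exponents i (\<lambda>j. d j - k j) = m then tower_coeffs X i k else 0) = 0"
      using exponents_neq_single i1(1) lead by (intro sum.neutral) auto
    then have "Poly_Mapping.lookup (tower_hat X i) m = 1"
      unfolding lookup_tower_hat using lead by simp
    moreover have "Poly_Mapping.lookup P m = \<Delta> * (if Poly_Mapping.single i (d i) = m then 1 else 0)"
      by (rule lookup_P_high_degree[OF _ i1(2)])
        (use lead i1(1) in \<open>auto simp: lookup_single when_def\<close>)
    then have "Poly_Mapping.lookup P m = \<Delta>"
      using lead by simp
    moreover have "\<bar>real_of_int \<Delta>\<bar> \<le> tower_bound \<gamma> D M n X i"
      unfolding real_of_rat_int of_int_\<Delta> by (rule tower_denom_le_bound)
    ultimately show ?thesis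
      by (intro exI[of _ \<Delta>]) (simp add: of_int_\<Delta>)
  next
    case (tower k)
    have "(\<Sum>k'\<in>tower_idx X i. if exponents i (\<lambda>j. d j - k' j) = m then tower_coeffs X i k' else 0)
        = (\<Sum>k'\<in>tower_idx X i. if k' = k then tower_coeffs X i k else 0)"
    proof (intro sum.cong refl)
      fix k' assume "k' \<in> tower_idx X i"
      then have "exponents i (\<lambda>j. d j - k' j) = m \<longleftrightarrow> k' = k"
        unfolding tower(2) [symmetric] using exponents_tower_idx_inj[OF _ tower(1)] by blast
      then show "(if exponents i (\<lambda>j. d j - k' j) = m then tower_coeffs X i k' else 0)
          = (if k' = k then tower_coeffs X i k else 0)" by simp
    qed
    also have "\<dots> = tower_coeffs X i k"
      using tower(1) by simp
    finally have "Poly_Mapping.lookup (tower_hat X i) m = tower_coeffs X i k"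
      unfolding lookup_tower_hat using exponents_neq_single[OF tower(1) i1(1)] tower(2) by auto
    moreover have "[Poly_Mapping.lookup P m = - H k] (mod int CARD('p) ^ e)"
      using cong_lookup_P[OF tower(1)] unfolding tower(2) .
    moreover have "\<bar>real_of_int (H k)\<bar> \<le> tower_bound \<gamma> D M n X i"
      unfolding real_of_rat_int of_int_H[OF tower(1)]
      by (rule norm_scaled_tower_coeffs_le[OF R i tower(1) assms])
    ultimately show ?thesis
      by (intro exI[of _ "- H k"]) (simp add: of_int_H[OF tower(1)])
  next
    case other
    have "(\<Sum>k\<in>tower_idx X i. if exponents i (\<lambda>j. d j - k j) = m then tower_coeffs X i k else 0) = 0"
      using other by (intro sum.neutral) auto
    then have "Poly_Mapping.lookup (tower_hat X i) m = 0"
      unfolding lookup_tower_hat using other by simp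
    moreover have "Poly_Mapping.lookup P m = 0"
    proof (cases "\<forall>l. l \<notin> {1..i} \<longrightarrow> Poly_Mapping.lookup m l = 0")
      case False
      then show ?thesis
        unfolding lookup_interp_poly if_not_P[OF False] using other by simp
    next
      case True
      have "\<exists>j\<in>{1..i}. Poly_Mapping.lookup m j \<ge> d j"
      proof (rule ccontr)
        assume "\<not> ?thesis"
        then have lt: "Poly_Mapping.lookup m j < d j" if "j \<in> {1..i}" for j
          using that by (auto simp: not_le)
        define k where "k = (\<lambda>j\<in>{1..i}. d j - Poly_Mapping.lookup m j)"
        have "k \<in> tower_idx X i"
          unfolding tower_idx_def k_def
          by (rule restrict_PiE_iff[THEN iffD2]) (use lt in \<open>auto simp: One_nat_def Suc_le_eq\<close>)
        moreover have "exponents i (\<lambda>j. d j - k j) = m"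
          unfolding exponents_eq_iff
        proof
          fix l
          show "Poly_Mapping.lookup m l = (if l \<in> {1..i} then d l - k l else 0)"
          proof (cases "l \<in> {1..i}")
            case l: True
            then show ?thesis using lt[OF l] by (simp add: k_def)
          next
            case False
            then show ?thesis unfolding if_not_P[OF False] using True by blast
          qed
        qed
        ultimately show False using other by blast
      qed
      then obtain j where j: "j \<in> {1..i}" "Poly_Mapping.lookup m j \<ge> d j" by blast
      have "Poly_Mapping.lookup P m = \<Delta> * (if Poly_Mapping.single i (d i) = m then 1 else 0)"
        using True by (intro lookup_P_high_degree[OF _ j]) blast
      then show ?thesis using other by simp
    qed
    ultimately show ?thesis
      using bound_nonneg by (intro exI[of _ 0]) simp
  qed
qed

end

lemma balanced_residue_unique:
  fixes a t q :: int
  assumes "[a = t] (mod q)" "- (q - 1) \<le> 2 * a" "2 * a \<le> q - 1" "2 * \<bar>t\<bar> \<le> q"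
  shows "a = t"
proof (rule ccontr)
  assume "a \<noteq> t"
  have "q dvd a - t"
    using assms(1) by (simp add: cong_iff_dvd_diff)
  then have "\<bar>q\<bar> \<le> \<bar>a - t\<bar>"
    using \<open>a \<noteq> t\<close> by (intro dvd_imp_le_int) auto
  then show False using assms(2-4) by linarith
qed

theorem theorem11:
  fixes f :: "rat poly" and F :: "int poly" and c :: int and n :: nat and D M :: real
  assumes "lead_coeff f = 1" and "irreducible f" and "degree f = n"
    and cf: "map_poly of_int F = smult (of_int c) f"
    and split: "splits_distinct n (map_poly of_int F :: 'p::prime_card mod_ring poly)"
    and "D > 0" and "M > 0"
    and M: "\<And>z :: complex. poly (map_poly of_rat f) z = 0 \<Longrightarrow> cmod z < M"
    and D: "\<And>z z' :: complex. poly (map_poly of_rat f) z = 0 \<Longrightarrow> poly (map_poly of_rat f) z' = 0 \<Longrightarrow>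
              z \<noteq> z' \<Longrightarrow> cmod (z - z') < D"
  shows "(\<exists>x :: nat \<Rightarrow> 'p padic_int. padic_zeros f n x \<and>
            bij_betw (\<lambda>j. of_int (padic_residue 1 (x j)) :: 'p mod_ring) {1..n}
              {a. poly (map_poly of_int F) a = 0}) \<and>
         (\<forall>(x :: nat \<Rightarrow> 'p padic_int) (\<gamma> :: int) i R.
            padic_zeros f n x \<longrightarrow>
            \<gamma> \<noteq> 0 \<longrightarrow> (\<forall>j\<in>{1..n}. algebraic_int (of_int \<gamma> * to_fract (x j) :: 'p padic)) \<longrightarrow>
            i \<in> {1..n} \<longrightarrow>
            (let X = (\<lambda>j. to_fract (x j) :: 'p padic);
                 G = galois_perms n X;
                 \<Delta> = tower_denom \<gamma> n X i;
                 e = lift_exponent CARD('p) (tower_bound \<gamma> D M n X i);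
                 q = int CARD('p) ^ e;
                 P = interp_poly G R x e \<lfloor>\<Delta>\<rfloor> (tower_deg X i) i
             in left_coset_reps G (perm_stab G i) R \<longrightarrow>
                \<Delta> \<in> \<int> \<and>
                (odd CARD('p) \<longrightarrow> (\<exists>Q. balanced_lift q P Q)) \<and>
                (\<forall>Q. balanced_lift q P Q \<longrightarrow>
                   Poly_Mapping.map rat_of_int Q = mp_const \<Delta> * tower_hat X i)))"
proof -
  interpret hs: hensel_setup f F c n "TYPE('p)"
    using assms(1,3,4,5) by unfold_locales
  have p2: "CARD('p) \<ge> 2"
    using nontriv[where 'a = 'p] by simp
  show ?thesis
    unfolding Let_def
  proof (intro conjI allI impI)
    show "\<exists>x :: nat \<Rightarrow> 'p padic_int. padic_zeros f n x \<and>
            bij_betw (\<lambda>j. of_int (padic_residue 1 (x j)) :: 'p mod_ring) {1..n}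
              {a. poly (map_poly of_int F) a = 0}"
      using hs.padic_zeros_exist hs.padic_zeros_residues by blast
  next
    fix x :: "nat \<Rightarrow> 'p padic_int" and \<gamma> i R
    let ?X = "\<lambda>j. to_fract (x j) :: 'p padic"
    let ?G = "galois_perms n ?X"
    let ?\<Lambda> = "tower_bound \<gamma> D M n ?X i"
    let ?e = "lift_exponent CARD('p) ?\<Lambda>"
    let ?q = "int CARD('p) ^ ?e"
    let ?P = "interp_poly ?G R x ?e \<lfloor>tower_denom \<gamma> n ?X i\<rfloor> (tower_deg ?X i) i"
    assume x: "padic_zeros f n x" and \<gamma>: "\<gamma> \<noteq> 0"
      and alg: "\<forall>j\<in>{1..n}. algebraic_int (of_int \<gamma> * to_fract (x j) :: 'p padic)"
      and i: "i \<in> {1..n}" and R: "left_coset_reps ?G (perm_stab ?G i) R"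
    interpret rt: root_tower f n ?X
      by (rule hs.root_tower_padic_zeros[OF x])
    show Ints: "tower_denom \<gamma> n ?X i \<in> \<int>"
      using alg by (intro rt.tower_denom_Ints[OF R i]) blast
    then obtain \<Delta> where \<Delta>: "tower_denom \<gamma> n ?X i = of_int \<Delta>"
      by (elim Ints_cases)
    then have "\<Delta> \<noteq> 0"
      using rt.tower_denom_nz[OF \<gamma>, of i] by auto
    then have "1 \<le> \<bar>real_of_int \<Delta>\<bar>" by linarith
    also have "\<dots> \<le> ?\<Lambda>"
      using rt.tower_denom_le_bound[of \<gamma> i D M] by (simp add: \<Delta>)
    finally have "1 \<le> ?\<Lambda>" .
    note e = lift_exponent_bound[OF p2 this]
    interpret lt: lifted_tower f F c n "TYPE('p)" x \<gamma> i R ?e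
      using x \<gamma> alg i R e(1) by unfold_locales blast+
    show "\<exists>Q. balanced_lift ?q ?P Q" if "odd CARD('p)"
      using that p2 by (intro balanced_lift_exists) auto
    fix Q assume Q: "balanced_lift ?q ?P Q"
    show "Poly_Mapping.map rat_of_int Q = mp_const (tower_denom \<gamma> n ?X i) * tower_hat ?X i"
    proof (rule poly_mapping_eqI)
      fix m
      obtain t where t: "rat_of_int t = tower_denom \<gamma> n ?X i * Poly_Mapping.lookup (tower_hat ?X i) m"
        "[Poly_Mapping.lookup ?P m = t] (mod ?q)" "\<bar>real_of_int t\<bar> \<le> ?\<Lambda>"
        using lt.lifted_coefficient[OF \<open>D > 0\<close> \<open>M > 0\<close> M D] unfolding lt.\<Delta>_def by blast
      have "real_of_int (2 * \<bar>t\<bar> - 1) \<le> 2 * ?\<Lambda> - 1"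
        using t(3) by simp
      also have "\<dots> < real_of_int ?q"
        using e(2) by simp
      finally have "2 * \<bar>t\<bar> \<le> ?q" by linarith
      moreover have Qm: "[Poly_Mapping.lookup Q m = Poly_Mapping.lookup ?P m] (mod ?q) \<and>
          - (?q - 1) \<le> 2 * Poly_Mapping.lookup Q m \<and> 2 * Poly_Mapping.lookup Q m \<le> ?q - 1"
        using Q unfolding balanced_lift_def by (rule spec)
      have "[Poly_Mapping.lookup Q m = t] (mod ?q)"
        by (rule cong_trans[OF conjunct1[OF Qm] t(2)])
      ultimately have "Poly_Mapping.lookup Q m = t"
        using Qm by (intro balanced_residue_unique[of _ _ ?q]) blast+
      moreover have "Poly_Mapping.lookup (Poly_Mapping.map rat_of_int Q) m = rat_of_int (Poly_Mapping.lookup Q m)"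
        by (simp add: Poly_Mapping.map.rep_eq when_def)
      ultimately show "Poly_Mapping.lookup (Poly_Mapping.map rat_of_int Q) m
          = Poly_Mapping.lookup (mp_const (tower_denom \<gamma> n ?X i) * tower_hat ?X i) m"
        using t(1) by (simp only: lookup_mp_const_mult)
    qed
  qed
qed

end
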